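(* Let $K$ be a field of characteristic zero, let $A_1=K\langle X,Y\mid [Y,X]=1\rangle$ be the first Weyl algebra over $K$, and put $H:=YX$. Let $C$ be a maximal commutative subalgebra of $A_1$ and let $0\neq\delta\in\mathrm{Der}_K(C)$. Then: 1. The following are equivalent: (a) $\delta$ is a locally nilpotent derivation of the algebra $C$; (b) there exists an element $c\in C\setminus\ker(\delta)$ such that $\delta^n(c)=0$ for some $n\ge 2$; (c) $C=K[t]$ for some element $t\in C$ and $\delta=\frac{d}{dt}$. 2. The following are equivalent: (a) $\delta$ is a semi-simple derivation of the algebra $C$; (b) $\delta(c)=\lambda c$ for some $0\ne c\in C$ and $\lambda\in K^*$; (c) $C=\bigoplus_{\lambda\in\mathrm{Ev}(\delta)}\ker(\delta-\lambda)$, $\dim_K(\ker(\delta-\lambda))=1$ for all $\lambda\in\mathrm{Ev}(\delta)$, and the additive monoid $\mathrm{Ev}(\delta)$ of eigenvalues of $\delta$ is a submonoid of the additive monoid $\mathbb{N}\rho$ for some $\rho\in K^*$ such that $\mathbb{Z}\,\mathrm{Ev}(\delta)=\mathbb{Z}\rho$; moreover, one of the following three cases occurs (the cases (ii) and (iii) are not mutually exclusive): (i) if $C=K[H]$ then $\delta=\rho H\frac{d}{dH}$ and $\mathrm{Ev}(\delta)=\rho\mathbb{N}$; (ii) if $\{0\}\subsetneq\mathrm{supp}(C)\subseteq\mathbb{N}$ then $\mathrm{Ev}(\delta)=\rho'\,\mathrm{supp}(C)$ for some $\rho'\in K^*$; moreover, $\mathrm{Ev}(\delta)=\frac{\lambda}{v(c_\lambda)}\mathrm{supp}(C)$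 for all $0\ne\lambda\in\mathrm{Ev}(\delta)$ and $0\ne c_\lambda\in\ker(\delta-\lambda)$, and $\delta$ is the unique extension to $C$ of the derivation $\lambda c_\lambda\frac{d}{dc_\lambda}$ of the polynomial algebra $K[c_\lambda]$; (iii) if $\{0\}\subsetneq\mathrm{supp}_-(C)\subseteq-\mathbb{N}$ then $\mathrm{Ev}(\delta)=\rho'\,\mathrm{supp}_-(C)$ for some $\rho'\in K^*$; moreover, $\mathrm{Ev}(\delta)=-\frac{\lambda}{v_-(c_\lambda)}\mathrm{supp}_-(C)$ for all $0\ne\lambda\in\mathrm{Ev}(\delta)$ and $0\ne c_\lambda\in\ker(\delta-\lambda)$, and $\delta$ is the unique extension to $C$ of the derivation $\lambda c_\lambda\frac{d}{dc_\lambda}$ of the polynomial algebra $K[c_\lambda]$; (d) there exists a nonzero additive submonoid $E$ of $(\mathbb{N},+)$ such that the algebra $C$ is isomorphic to the monoid subalgebra $\bigoplus_{i\in E}Kt^i$ of the polynomial algebra $K[t]$ in a variable $t$, $\delta=\rho t\frac{d}{dt}$ (under this isomorphism) for some $\rho\in K^*$, and $\mathrm{Ev}(\delta)=\rho E$. 3. $\ker(\delta)=K$.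
   Context: $\mathbb{N}=\{0,1,2,\dots\}$ and $K^*=K\setminus\{0\}$. $\mathrm{Der}_K(C)$ is the set of $K$-derivations of $C$. A linear map $\varphi:V\to V$ is locally nilpotent if $V=\bigcup_{n\ge1}\ker(\varphi^n)$. It is semi-simple if $V=\bigoplus_{\lambda\in\mathrm{Ev}(\varphi)}\ker(\varphi-\lambda)$, where $\mathrm{Ev}(\varphi)$ is the set of eigenvalues of $\varphi$ in the field $K$. The Weyl algebra is $\mathbb{Z}$-graded: $A_1=\bigoplus_{i\in\mathbb{Z}}K[H]v_i$ where $v_i=X^i$ for $i>0$, $v_0=1$, $v_i=Y^{-i}$ for $i<0$. For $0\ne a\in A_1$ put $v(a):=\min\{d\in\mathbb{Z}\mid a\in\bigoplus_{i\le d}K[H]v_i\}$ and $v_-(a):=-\max\{d\in\mathbb{Z}\mid a\in\bigoplus_{i\ge d}K[H]v_i\}$. For a subalgebra $C$ of $A_1$, $\mathrm{supp}(C):=v(C\setminus\{0\})$ and $\mathrm{supp}_-(C):=-v_-(C\setminus\{0\})$; these are additive submonoids of $(\mathbb{Z},+)$.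
   Formalization: In 2(c)(i) the formula δ=ρH d/dH is replaced by δ=ρ(H−μ) d/dH for some μ∈K, because the printed form fails for the semi-simple derivation (H−1) d/dH of C=K[H]. *)

theory Defs
  imports
    "HOL-Library.Poly_Mapping"
    "HOL-Computational_Algebra.Polynomial"
    "HOL-Computational_Algebra.Group_Closure"
begin

section \<open>The first Weyl algebra by generators and relations\<close>

subsection \<open>The free associative algebra on two generators\<close>

datatype weyl_gen = GenX | GenY

datatype weyl_word = Word (letters: "weyl_gen list")

text \<open>Words form a monoid under concatenation, written additively because
  \<open>poly_mapping\<close> expects an additive monoid of exponents; the addition is not commutative.\<close>

instantiation weyl_word :: monoid_add
begin
definition "0 = Word []"
definition "u + w = Word (letters u @ letters w)"
instance by standard (simp_all add: zero_weyl_word_def plus_weyl_word_def)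
end

type_synonym 'k free_alg = "weyl_word \<Rightarrow>\<^sub>0 'k"

definition freeX :: "'k::field free_alg"
  where "freeX = Poly_Mapping.single (Word [GenX]) 1"

definition freeY :: "'k::field free_alg"
  where "freeY = Poly_Mapping.single (Word [GenY]) 1"

inductive_set weyl_ideal :: "'k::field free_alg set" where
  zero: "0 \<in> weyl_ideal"
| add: "r \<in> weyl_ideal \<Longrightarrow> a * (freeY * freeX - freeX * freeY - 1) * b + r \<in> weyl_ideal"

lemma weyl_ideal_plus: "r \<in> weyl_ideal \<Longrightarrow> s \<in> weyl_ideal \<Longrightarrow> r + s \<in> weyl_ideal"
  by (induction r rule: weyl_ideal.induct) (auto simp: add.assoc intro: weyl_ideal.add)

lemma weyl_ideal_mult_left: "r \<in> weyl_ideal \<Longrightarrow> c * r \<in> weyl_ideal"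
proof (induction r rule: weyl_ideal.induct)
  case (add r a b)
  have "(c * a) * (freeY * freeX - freeX * freeY - 1) * b + c * r \<in> weyl_ideal"
    by (rule weyl_ideal.add[OF add.IH])
  then show ?case by (simp only: distrib_left mult.assoc)
qed (simp add: weyl_ideal.zero)

lemma weyl_ideal_mult_right: "r \<in> weyl_ideal \<Longrightarrow> r * c \<in> weyl_ideal"
proof (induction r rule: weyl_ideal.induct)
  case (add r a b)
  have "a * (freeY * freeX - freeX * freeY - 1) * (b * c) + r * c \<in> weyl_ideal"
    by (rule weyl_ideal.add[OF add.IH])
  then show ?case by (simp only: distrib_right mult.assoc)
qed (simp add: weyl_ideal.zero)

lemma weyl_ideal_uminus: "r \<in> weyl_ideal \<Longrightarrow> - r \<in> weyl_ideal"
  using weyl_ideal_mult_left[of r "- 1"] by simp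

lemma weyl_ideal_diff: "r \<in> weyl_ideal \<Longrightarrow> s \<in> weyl_ideal \<Longrightarrow> r - s \<in> weyl_ideal"
  using weyl_ideal_plus[OF _ weyl_ideal_uminus] by (metis uminus_add_conv_diff add.commute)

subsection \<open>The defining ideal is proper\<close>

text \<open>The free algebra acts on polynomials by letting X multiply by the variable and Y
  differentiate. This is used only for the axiom \<open>0 \<noteq> 1\<close> of class \<open>ring_1\<close>.\<close>

primrec gen_act :: "weyl_gen \<Rightarrow> 'k::field poly \<Rightarrow> 'k poly" where
  "gen_act GenX p = pCons 0 p"
| "gen_act GenY p = pderiv p"

definition word_act :: "weyl_word \<Rightarrow> 'k::field poly \<Rightarrow> 'k poly"
  where "word_act w = foldr gen_act (letters w)"

definition free_act :: "'k::field free_alg \<Rightarrow> 'k poly \<Rightarrow> 'k poly"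
  where "free_act f p =
    (\<Sum>w\<in>Poly_Mapping.keys f. smult (Poly_Mapping.lookup f w) (word_act w p))"

lemma word_act_zero [simp]: "word_act 0 p = p"
  by (simp add: word_act_def zero_weyl_word_def)

lemma word_act_plus: "word_act (u + w) p = word_act u (word_act w p)"
  by (simp add: word_act_def plus_weyl_word_def)

lemma gen_act_add: "gen_act g (p + q) = gen_act g p + gen_act g q"
  by (cases g) (simp_all add: pderiv_add)

lemma gen_act_smult: "gen_act g (smult c p) = smult c (gen_act g p)"
  by (cases g) (simp_all add: pderiv_smult)

lemma word_act_add: "word_act w (p + q) = word_act w p + word_act w q"
proof -
  have "foldr gen_act gs (p + q) = foldr gen_act gs p + foldr gen_act gs q" for gs
    by (induction gs) (simp_all add: gen_act_add)
  then show ?thesis by (simp add: word_act_def)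
qed

lemma word_act_smult: "word_act w (smult c p) = smult c (word_act w p)"
proof -
  have "foldr gen_act gs (smult c p) = smult c (foldr gen_act gs p)" for gs
    by (induction gs) (simp_all add: gen_act_smult)
  then show ?thesis by (simp add: word_act_def)
qed

lemma word_act_0_right [simp]: "word_act w (0 :: 'k::field poly) = 0"
  using word_act_smult[of w 0 "0 :: 'k poly"] by simp

lemma free_act_superset:
  assumes "finite S" "Poly_Mapping.keys f \<subseteq> S"
  shows "free_act f p = (\<Sum>w\<in>S. smult (Poly_Mapping.lookup f w) (word_act w p))"
  unfolding free_act_def
  by (rule sum.mono_neutral_left) (use assms in \<open>auto simp: in_keys_iff\<close>)

lemma free_act_plus: "free_act (f + g) p = free_act f p + free_act g p"
proof -
  let ?S = "Poly_Mapping.keys f \<union> Poly_Mapping.keys g"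
  have "Poly_Mapping.keys (f + g) \<subseteq> ?S" by (rule keys_add)
  then show ?thesis
    by (simp add: free_act_superset[of ?S] lookup_add smult_add_left sum.distrib)
qed

lemma free_act_0 [simp]: "free_act 0 p = 0"
  by (simp add: free_act_def)

lemma free_act_single: "free_act (Poly_Mapping.single w c) p = smult c (word_act w p)"
  by (cases "c = 0") (simp_all add: free_act_def)

lemma free_act_uminus: "free_act (- f) p = - free_act f p"
  using free_act_plus[of f "- f" p] by (simp add: eq_neg_iff_add_eq_0 add.commute)

lemma free_act_diff: "free_act (f - g) p = free_act f p - free_act g p"
  using free_act_plus[of f "- g" p] by (simp add: free_act_uminus)

lemma free_act_0_right [simp]: "free_act f 0 = 0"
  by (simp add: free_act_def)

lemma free_alg_induct [case_names zero add]:
  assumes "P 0" "\<And>w c f. P f \<Longrightarrow> P (Poly_Mapping.single w c + f)"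
  shows "P (f :: 'k::field free_alg)"
proof (induction f rule: update_induct)
  case (update f w c)
  have "Poly_Mapping.update w c f = Poly_Mapping.single w c + f"
    using update.hyps
    by (intro poly_mapping_eqI) (auto simp: lookup_update lookup_add lookup_single when_def in_keys_iff)
  then show ?case using assms(2) update by simp
qed (rule assms(1))

lemma free_act_single_mult:
  "free_act (Poly_Mapping.single w c * g) p = smult c (word_act w (free_act g p))"
proof (induction g rule: free_alg_induct)
  case zero
  then show ?case by simp
next
  case (add u d g)
  then show ?case
    by (simp add: distrib_left free_act_plus mult_single free_act_single word_act_plus
        word_act_add word_act_smult smult_add_right)
qed

lemma free_act_mult: "free_act (f * g) p = free_act f (free_act g p)"
  by (induction f rule: free_alg_induct)
    (simp_all add: distrib_right free_act_plus free_act_single_mult free_act_single)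

lemma free_act_one: "free_act 1 p = p"
  using free_act_single[of 0 1 p] by simp

lemma free_act_weyl_ideal: "r \<in> weyl_ideal \<Longrightarrow> free_act r p = 0"
proof (induction r arbitrary: p rule: weyl_ideal.induct)
  case (add r a b)
  have "free_act (freeY * freeX - freeX * freeY - 1) q = 0" for q :: "'a poly"
    by (simp add: free_act_diff free_act_mult free_act_one freeX_def freeY_def free_act_single
        word_act_def pderiv_pCons)
  then show ?case using add.IH by (simp add: free_act_plus free_act_mult)
qed simp

lemma one_notin_weyl_ideal: "1 \<notin> weyl_ideal"
  using free_act_weyl_ideal[of 1 1] by (auto simp: free_act_one)

subsection \<open>The quotient\<close>

definition weyl_rel :: "'k::field free_alg \<Rightarrow> 'k free_alg \<Rightarrow> bool"
  where "weyl_rel a b \<longleftrightarrow> a - b \<in> weyl_ideal"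

lemma equivp_weyl_rel: "equivp weyl_rel"
proof (rule equivpI)
  show "reflp weyl_rel" by (auto intro!: reflpI simp: weyl_rel_def weyl_ideal.zero)
  show "symp weyl_rel"
    by (auto intro!: sympI simp: weyl_rel_def) (metis minus_diff_eq weyl_ideal_uminus)
  show "transp weyl_rel"
    by (auto intro!: transpI simp: weyl_rel_def) (metis diff_add_cancel add_diff_eq weyl_ideal_plus)
qed

quotient_type (overloaded) 'k weyl = "'k::field free_alg" / weyl_rel
  by (rule equivp_weyl_rel)

instantiation weyl :: (field) ring_1
begin

lift_definition zero_weyl :: "'a weyl" is 0 .
lift_definition one_weyl :: "'a weyl" is 1 .
lift_definition plus_weyl :: "'a weyl \<Rightarrow> 'a weyl \<Rightarrow> 'a weyl" is "(+)"
proof -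
  fix a a' b b' :: "'a free_alg"
  assume "weyl_rel a a'" "weyl_rel b b'"
  moreover have "(a + b) - (a' + b') = (a - a') + (b - b')" by (rule add_diff_add)
  ultimately show "weyl_rel (a + b) (a' + b')"
    unfolding weyl_rel_def by (simp only: weyl_ideal_plus)
qed
lift_definition uminus_weyl :: "'a weyl \<Rightarrow> 'a weyl" is uminus
proof -
  fix a a' :: "'a free_alg"
  assume "weyl_rel a a'"
  moreover have "- a - - a' = - (a - a')" by simp
  ultimately show "weyl_rel (- a) (- a')"
    unfolding weyl_rel_def by (simp only: weyl_ideal_uminus)
qed
lift_definition minus_weyl :: "'a weyl \<Rightarrow> 'a weyl \<Rightarrow> 'a weyl" is "(-)"
proof -
  fix a a' b b' :: "'a free_alg"
  assume "weyl_rel a a'" "weyl_rel b b'"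
  moreover have "(a - b) - (a' - b') = (a - a') - (b - b')" by simp
  ultimately show "weyl_rel (a - b) (a' - b')"
    unfolding weyl_rel_def by (simp only: weyl_ideal_diff)
qed
lift_definition times_weyl :: "'a weyl \<Rightarrow> 'a weyl \<Rightarrow> 'a weyl" is "(*)"
proof -
  fix a a' b b' :: "'a free_alg"
  assume "weyl_rel a a'" "weyl_rel b b'"
  moreover have "a * b - a' * b' = (a - a') * b + a' * (b - b')"
    by (simp add: algebra_simps)
  ultimately show "weyl_rel (a * b) (a' * b')"
    unfolding weyl_rel_def
    by (simp only: weyl_ideal_plus weyl_ideal_mult_left weyl_ideal_mult_right)
qed

instance
proof
  show "(0::'a weyl) \<noteq> 1"
    by transfer
      (use one_notin_weyl_ideal weyl_ideal_uminus in \<open>fastforce simp: weyl_rel_def\<close>)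
qed (transfer, simp add: algebra_simps weyl_rel_def weyl_ideal.zero)+

end

lift_definition weyl_X :: "'k::field weyl" is freeX .
lift_definition weyl_Y :: "'k::field weyl" is freeY .
lift_definition weyl_const :: "'k::field \<Rightarrow> 'k weyl" is "Poly_Mapping.single 0" .

definition weyl_H :: "'k::field weyl"
  where "weyl_H = weyl_Y * weyl_X"

definition weyl_scale :: "'k::field \<Rightarrow> 'k weyl \<Rightarrow> 'k weyl"  (infixr \<open>*\<^sub>W\<close> 75)
  where "k *\<^sub>W a = weyl_const k * a"

lemma weyl_relation: "weyl_Y * weyl_X - weyl_X * weyl_Y = (1 :: 'k::field weyl)"
proof transfer
  have "0 \<in> (weyl_ideal :: 'k free_alg set)" by (rule weyl_ideal.zero)
  from weyl_ideal.add[OF this, of 1 1]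
  show "weyl_rel (freeY * freeX - freeX * freeY) (1 :: 'k free_alg)"
    by (simp add: weyl_rel_def)
qed

lemma weyl_const_add: "weyl_const (k + l) = weyl_const k + weyl_const l"
  by transfer (simp add: single_add weyl_rel_def weyl_ideal.zero)

lemma weyl_const_mult: "weyl_const (k * l) = weyl_const k * weyl_const l"
  by transfer (simp add: mult_single weyl_rel_def weyl_ideal.zero)

lemma weyl_const_1: "weyl_const 1 = 1"
  by transfer (simp add: weyl_rel_def weyl_ideal.zero)

lemma weyl_const_central: "weyl_const k * a = a * weyl_const k"
proof transfer
  fix k :: 'a and f :: "'a free_alg"
  have "Poly_Mapping.single 0 k * f = f * Poly_Mapping.single 0 k"
    by (induction f rule: free_alg_induct)
      (simp_all add: distrib_left distrib_right mult_single mult.commute)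
  then show "weyl_rel (Poly_Mapping.single 0 k * f) (f * Poly_Mapping.single 0 k)"
    by (simp add: weyl_rel_def weyl_ideal.zero)
qed

global_interpretation weyl: vector_space "weyl_scale :: 'k::field \<Rightarrow> 'k weyl \<Rightarrow> 'k weyl"
  by standard
    (simp_all add: weyl_scale_def weyl_const_add weyl_const_mult weyl_const_1 algebra_simps)

definition weyl_poly :: "'k::field poly \<Rightarrow> 'k weyl \<Rightarrow> 'k weyl"
  where "weyl_poly p a = (\<Sum>i\<le>degree p. coeff p i *\<^sub>W a ^ i)"

definition weyl_adjoin :: "'k::field weyl \<Rightarrow> 'k weyl set"
  where "weyl_adjoin a = range (\<lambda>p. weyl_poly p a)"

definition weyl_transcendental :: "'k::field weyl \<Rightarrow> bool"
  where "weyl_transcendental a \<longleftrightarrow> inj (\<lambda>p. weyl_poly p a)"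


section \<open>The grading and the supports\<close>

definition weyl_v :: "int \<Rightarrow> 'k::field weyl"
  where "weyl_v i = (if i \<ge> 0 then weyl_X ^ nat i else weyl_Y ^ nat (- i))"

definition weyl_piece :: "int \<Rightarrow> 'k::field weyl set"
  where "weyl_piece i = (\<lambda>h. h * weyl_v i) ` weyl_adjoin weyl_H"

definition weyl_deg :: "'k::field weyl \<Rightarrow> int"
  where "weyl_deg a = (LEAST d. a \<in> weyl.span (\<Union>i\<in>{..d}. weyl_piece i))"

definition weyl_deg_minus :: "'k::field weyl \<Rightarrow> int"
  where "weyl_deg_minus a = - (GREATEST d. a \<in> weyl.span (\<Union>i\<in>{d..}. weyl_piece i))"

definition supp :: "'k::field weyl set \<Rightarrow> int set"
  where "supp C = weyl_deg ` (C - {0})"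

definition supp_minus :: "'k::field weyl set \<Rightarrow> int set"
  where "supp_minus C = (\<lambda>a. - weyl_deg_minus a) ` (C - {0})"


section \<open>Subalgebras and derivations\<close>

definition weyl_subalgebra :: "'k::field weyl set \<Rightarrow> bool"
  where "weyl_subalgebra C \<longleftrightarrow>
    weyl.subspace C \<and> 1 \<in> C \<and> (\<forall>a\<in>C. \<forall>b\<in>C. a * b \<in> C)"

definition commutative_subalgebra :: "'k::field weyl set \<Rightarrow> bool"
  where "commutative_subalgebra C \<longleftrightarrow>
    weyl_subalgebra C \<and> (\<forall>a\<in>C. \<forall>b\<in>C. a * b = b * a)"

definition maximal_commutative_subalgebra :: "'k::field weyl set \<Rightarrow> bool"
  where "maximal_commutative_subalgebra C \<longleftrightarrow>
    commutative_subalgebra C \<and> (\<forall>D. commutative_subalgebra D \<and> C \<subseteq> D \<longrightarrow> D = C)"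

text \<open>A map on a subalgebra is represented by a function on the whole algebra whose values
  outside the subalgebra are never used.\<close>

definition derivations :: "'k::field weyl set \<Rightarrow> ('k weyl \<Rightarrow> 'k weyl) set"
  where "derivations C = {\<delta>.
    (\<forall>a\<in>C. \<delta> a \<in> C) \<and>
    (\<forall>a\<in>C. \<forall>b\<in>C. \<delta> (a + b) = \<delta> a + \<delta> b) \<and>
    (\<forall>k. \<forall>a\<in>C. \<delta> (k *\<^sub>W a) = k *\<^sub>W \<delta> a) \<and>
    (\<forall>a\<in>C. \<forall>b\<in>C. \<delta> (a * b) = \<delta> a * b + a * \<delta> b)}"

definition ker_on :: "'k::field weyl set \<Rightarrow> ('k weyl \<Rightarrow> 'k weyl) \<Rightarrow> 'k weyl set"
  where "ker_on C \<phi> = {a \<in> C. \<phi> a = 0}"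

definition locally_nilpotent_on :: "'k::field weyl set \<Rightarrow> ('k weyl \<Rightarrow> 'k weyl) \<Rightarrow> bool"
  where "locally_nilpotent_on V \<phi> \<longleftrightarrow> V = (\<Union>n\<in>{1..}. ker_on V (\<phi> ^^ n))"

definition Ev :: "'k::field weyl set \<Rightarrow> ('k weyl \<Rightarrow> 'k weyl) \<Rightarrow> 'k set"
  where "Ev V \<phi> = {k. \<exists>a\<in>V. a \<noteq> 0 \<and> \<phi> a = k *\<^sub>W a}"

definition eigenspace :: "'k::field weyl set \<Rightarrow> ('k weyl \<Rightarrow> 'k weyl) \<Rightarrow> 'k \<Rightarrow> 'k weyl set"
  where "eigenspace V \<phi> k = ker_on V (\<lambda>a. \<phi> a - k *\<^sub>W a)"

text \<open>\<open>internal_direct_sum I U V\<close>: every element of \<open>V\<close> is, in exactly one way, the sum of a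
  finitely supported family with members in the \<open>U i\<close>, and all such sums lie in \<open>V\<close>.\<close>

definition internal_direct_sum :: "'i set \<Rightarrow> ('i \<Rightarrow> 'k::field weyl set) \<Rightarrow> 'k weyl set \<Rightarrow> bool"
  where "internal_direct_sum I U V \<longleftrightarrow>
    bij_betw (\<lambda>f. \<Sum>i | f i \<noteq> 0. f i)
      {f. finite {i. f i \<noteq> 0} \<and> (\<forall>i\<in>I. f i \<in> U i) \<and> (\<forall>i. i \<notin> I \<longrightarrow> f i = 0)} V"

definition semisimple_on :: "'k::field weyl set \<Rightarrow> ('k weyl \<Rightarrow> 'k weyl) \<Rightarrow> bool"
  where "semisimple_on V \<phi> \<longleftrightarrow> internal_direct_sum (Ev V \<phi>) (eigenspace V \<phi>) V"

definition additive_submonoid :: "'a::monoid_add set \<Rightarrow> bool"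
  where "additive_submonoid E \<longleftrightarrow> 0 \<in> E \<and> (\<forall>a\<in>E. \<forall>b\<in>E. a + b \<in> E)"

text \<open>\<open>\<delta>\<close> is the unique derivation of \<open>C\<close> that extends the derivation \<open>\<mu> c (d/dc)\<close> of the
  polynomial algebra \<open>K[c]\<close>.\<close>

definition unique_euler_extension ::
  "'k::field weyl set \<Rightarrow> ('k weyl \<Rightarrow> 'k weyl) \<Rightarrow> 'k \<Rightarrow> 'k weyl \<Rightarrow> bool"
  where "unique_euler_extension C \<delta> \<mu> c \<longleftrightarrow>
    c \<in> C \<and> weyl_transcendental c \<and>
    (let extends = (\<lambda>\<delta>'. \<delta>' \<in> derivations C \<and>
          (\<forall>p. \<delta>' (weyl_poly p c) = \<mu> *\<^sub>W (c * weyl_poly (pderiv p) c)))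
     in extends \<delta> \<and> (\<forall>\<delta>'. extends \<delta>' \<longrightarrow> (\<forall>a\<in>C. \<delta>' a = \<delta> a)))"

definition monoid_subalgebra :: "nat set \<Rightarrow> 'k::field poly set"
  where "monoid_subalgebra E = {p. \<forall>i. coeff p i \<noteq> 0 \<longrightarrow> i \<in> E}"

definition alg_iso_to_poly ::
  "'k::field weyl set \<Rightarrow> 'k poly set \<Rightarrow> ('k weyl \<Rightarrow> 'k poly) \<Rightarrow> bool"
  where "alg_iso_to_poly C P \<phi> \<longleftrightarrow>
    bij_betw \<phi> C P \<and> \<phi> 1 = 1 \<and>
    (\<forall>a\<in>C. \<forall>b\<in>C. \<phi> (a + b) = \<phi> a + \<phi> b) \<and>
    (\<forall>a\<in>C. \<forall>b\<in>C. \<phi> (a * b) = \<phi> a * \<phi> b) \<and>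
    (\<forall>k. \<forall>a\<in>C. \<phi> (k *\<^sub>W a) = smult k (\<phi> a))"


section \<open>The assertions of the theorem\<close>

definition lnd_normal_form :: "'k::field weyl set \<Rightarrow> ('k weyl \<Rightarrow> 'k weyl) \<Rightarrow> bool"
  where "lnd_normal_form C \<delta> \<longleftrightarrow>
    (\<exists>t\<in>C. weyl_transcendental t \<and> C = weyl_adjoin t \<and>
      (\<forall>p. \<delta> (weyl_poly p t) = weyl_poly (pderiv p) t))"

text \<open>The conclusion for \<open>C = K[H]\<close>. The derivation is Euler's for the generator \<open>H - \<mu>\<close> of
  \<open>K[H]\<close>; the shift is needed: \<open>(H - 1) d/dH\<close> is semisimple on \<open>K[H]\<close>, with eigenvectors
  \<open>(H - 1)\<^sup>n\<close>, and is not a multiple of \<open>H d/dH\<close>.\<close>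

definition case_KH :: "'k::field weyl set \<Rightarrow> ('k weyl \<Rightarrow> 'k weyl) \<Rightarrow> 'k \<Rightarrow> bool"
  where "case_KH C \<delta> \<rho> \<longleftrightarrow>
    (\<exists>\<mu>. \<forall>p. \<delta> (weyl_poly p weyl_H) =
      \<rho> *\<^sub>W ((weyl_H - weyl_const \<mu>) * weyl_poly (pderiv p) weyl_H)) \<and>
    Ev C \<delta> = range (\<lambda>n. \<rho> * of_nat n)"

definition case_supp :: "'k::field weyl set \<Rightarrow> ('k weyl \<Rightarrow> 'k weyl) \<Rightarrow> bool"
  where "case_supp C \<delta> \<longleftrightarrow>
    (\<exists>\<rho>'. \<rho>' \<noteq> 0 \<and> Ev C \<delta> = (\<lambda>n. \<rho>' * of_int n) ` supp C) \<and>
    (\<forall>\<mu>\<in>Ev C \<delta> - {0}. \<forall>c\<in>eigenspace C \<delta> \<mu> - {0}.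
      Ev C \<delta> = (\<lambda>n. \<mu> / of_int (weyl_deg c) * of_int n) ` supp C \<and>
      unique_euler_extension C \<delta> \<mu> c)"

definition case_supp_minus :: "'k::field weyl set \<Rightarrow> ('k weyl \<Rightarrow> 'k weyl) \<Rightarrow> bool"
  where "case_supp_minus C \<delta> \<longleftrightarrow>
    (\<exists>\<rho>'. \<rho>' \<noteq> 0 \<and> Ev C \<delta> = (\<lambda>n. \<rho>' * of_int n) ` supp_minus C) \<and>
    (\<forall>\<mu>\<in>Ev C \<delta> - {0}. \<forall>c\<in>eigenspace C \<delta> \<mu> - {0}.
      Ev C \<delta> = (\<lambda>n. - (\<mu> / of_int (weyl_deg_minus c)) * of_int n) ` supp_minus C \<and>
      unique_euler_extension C \<delta> \<mu> c)"

text \<open>``One of the cases occurs'': the hypothesis of at least one case holds, and each case whose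
  hypothesis holds has its conclusion.\<close>

definition semisimple_structure :: "'k::field weyl set \<Rightarrow> ('k weyl \<Rightarrow> 'k weyl) \<Rightarrow> bool"
  where "semisimple_structure C \<delta> \<longleftrightarrow>
    internal_direct_sum (Ev C \<delta>) (eigenspace C \<delta>) C \<and>
    (\<forall>\<mu>\<in>Ev C \<delta>. weyl.dim (eigenspace C \<delta> \<mu>) = 1) \<and>
    (\<exists>\<rho>. \<rho> \<noteq> 0 \<and>
      additive_submonoid (Ev C \<delta>) \<and>
      Ev C \<delta> \<subseteq> range (\<lambda>n. of_nat n * \<rho>) \<and>
      group_closure (Ev C \<delta>) = range (\<lambda>z. of_int z * \<rho>) \<and>
      (C = weyl_adjoin weyl_H \<or>
        ({0} \<subset> supp C \<and> supp C \<subseteq> {0..}) \<or>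
        ({0} \<subset> supp_minus C \<and> supp_minus C \<subseteq> {..0})) \<and>
      (C = weyl_adjoin weyl_H \<longrightarrow> case_KH C \<delta> \<rho>) \<and>
      ({0} \<subset> supp C \<and> supp C \<subseteq> {0..} \<longrightarrow> case_supp C \<delta>) \<and>
      ({0} \<subset> supp_minus C \<and> supp_minus C \<subseteq> {..0} \<longrightarrow> case_supp_minus C \<delta>))"

definition monoid_algebra_normal_form :: "'k::field weyl set \<Rightarrow> ('k weyl \<Rightarrow> 'k weyl) \<Rightarrow> bool"
  where "monoid_algebra_normal_form C \<delta> \<longleftrightarrow>
    (\<exists>E \<phi> \<rho>. additive_submonoid E \<and> E \<noteq> {0} \<and>
      alg_iso_to_poly C (monoid_subalgebra E) \<phi> \<and>
      \<rho> \<noteq> 0 \<and> (\<forall>a\<in>C. \<phi> (\<delta> a) = smult \<rho> (monom 1 1 * pderiv (\<phi> a))) \<and>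
      Ev C \<delta> = (\<lambda>n. \<rho> * of_nat n) ` E)"

end

theory Submission
  imports Defs
begin

text \<open>
  Let \<open>A\<^sub>1\<close> act on \<open>K[x]\<close>. The leading homogeneous component of an element becomes a nonzero polynomial
  in \<open>n\<close>, and multiplication of leading components becomes multiplication of polynomials up to a
  shift of the argument. Two commuting elements satisfy a shift identity. If one of them has
  positive degree, the identity forces the other to have nonnegative degree and determines its
  leading component from its degree up to a scalar. So unless \<open>C = K[H]\<close>, the degree \<open>v\<close> or \<open>v\<^sub>-\<close> is a
  degree function \<open>d\<close> on \<open>C\<close> with values in \<open>\<nat>\<close> and one-dimensional graded pieces; on \<open>K[H]\<close> the degree
  in \<open>H\<close> has the same properties.

  For such a \<open>d\<close>, the set of degrees is a numerical semigroup, so a derivation \<open>\<delta>\<close> raises degrees by a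
  bounded amount. Any two nonscalar elements have powers with proportional leading terms, hence a
  nonzero \<open>\<delta>\<close> raises the degree of every nonscalar element by the same integer \<open>M\<close>; in particular
  its kernel is \<open>K\<close>. A slice \<open>t\<close> with \<open>\<delta> t = 1\<close> gives \<open>M = - d t < 0\<close>, so \<open>\<delta>\<close> is locally nilpotent and
  \<open>C = K[t]\<close>. An eigenvector with a nonzero eigenvalue gives \<open>M = 0\<close>, and comparing leading terms of
  powers shows that \<open>\<delta>\<close> acts on the graded piece of degree \<open>n\<close> as \<open>n\<close> times a fixed nonzero scalar;
  a triangular map with distinct diagonal entries is diagonalizable.
\<close>

section \<open>Polynomials in an element and the grading\<close>

lemma weyl_poly_superset:
  assumes "degree p \<le> n"
  shows "weyl_poly p a = (\<Sum>i\<le>n. coeff p i *\<^sub>W a ^ i)"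
  unfolding weyl_poly_def
  by (rule sum.mono_neutral_left) (use assms in \<open>auto simp: coeff_eq_0\<close>)

lemma weyl_poly_0 [simp]: "weyl_poly 0 a = 0"
  by (simp add: weyl_poly_def)

lemma weyl_poly_add: "weyl_poly (p + q) a = weyl_poly p a + weyl_poly q a"
  by (simp add: weyl_poly_superset[of _ "max (degree p) (degree q)"] degree_add_le
      weyl.scale_left_distrib sum.distrib)

lemma weyl_scale_mult_left: "(k *\<^sub>W a) * b = k *\<^sub>W (a * b)"
  by (simp add: weyl_scale_def mult.assoc)

lemma weyl_scale_mult_right: "a * (k *\<^sub>W b) = k *\<^sub>W (a * b)"
  by (metis weyl_const_central weyl_scale_def mult.assoc)

lemma weyl_poly_smult: "weyl_poly (smult k p) a = k *\<^sub>W weyl_poly p a"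
  by (simp add: weyl_poly_superset[of _ "degree p"] degree_smult_le
      weyl.scale_sum_right)

lemma weyl_poly_pCons: "weyl_poly (pCons k p) a = weyl_const k + a * weyl_poly p a"
proof -
  have "weyl_poly (pCons k p) a = (\<Sum>i\<le>Suc (degree p). coeff (pCons k p) i *\<^sub>W a ^ i)"
    by (rule weyl_poly_superset) (rule degree_pCons_le)
  also have "\<dots> = weyl_const k + a * weyl_poly p a"
    by (subst sum.atMost_Suc_shift)
      (simp add: weyl_poly_def weyl_scale_def sum_distrib_left weyl_const_central mult.assoc)
  finally show ?thesis .
qed

lemma weyl_poly_1 [simp]: "weyl_poly 1 a = 1"
  by (simp add: one_pCons weyl_poly_pCons weyl_const_1)

lemma weyl_const_0 [simp]: "weyl_const 0 = 0"
  using weyl_const_add[of 0 0] by simp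

lemma weyl_poly_mult: "weyl_poly (p * q) a = weyl_poly p a * weyl_poly q a"
  by (induction p)
    (simp_all add: weyl_poly_pCons weyl_poly_add weyl_poly_smult weyl_scale_def algebra_simps)

lemma weyl_poly_commute: "weyl_poly p a * weyl_poly q a = weyl_poly q a * weyl_poly p a"
  by (metis weyl_poly_mult mult.commute)

text \<open>Moving \<open>b\<close> past \<open>a\<close> translates \<open>a\<close> by
  \<open>k\<close>, so moving it past a polynomial in \<open>a\<close> translates the argument; the
  induction follows the Horner form. The values -1 and 1 of \<open>k\<close> give the rules for X
  and Y against K[H].\<close>

lemma weyl_poly_skew_commute:
  assumes "b * a = (a + weyl_const k) * b"
  shows "b * weyl_poly p a = weyl_poly (pcompose p [:k, 1:]) a * b"
proof (induction p)
  case (pCons c p)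
  have "b * (a * weyl_poly p a) = (a + weyl_const k) * (b * weyl_poly p a)"
    by (metis assms mult.assoc)
  also have "\<dots> = (a + weyl_const k) * weyl_poly (pcompose p [:k, 1:]) a * b"
    by (simp add: pCons.IH mult.assoc)
  finally show ?case
    by (simp add: weyl_poly_pCons weyl_poly_add pcompose_pCons weyl_poly_mult weyl_poly_smult weyl_const_1
        weyl_const_central weyl_scale_def algebra_simps)
qed simp

lemma weyl_X_mult_poly_H:
  "weyl_X * weyl_poly p weyl_H = weyl_poly (pcompose p [:-1, 1:]) weyl_H * weyl_X"
proof (rule weyl_poly_skew_commute)
  have "weyl_X * weyl_Y = weyl_Y * weyl_X - (1 :: 'a weyl)"
    by (metis weyl_relation diff_diff_eq2 add_diff_cancel_left' )
  moreover have "weyl_const (-1) = (-1 :: 'a weyl)"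
    using weyl_const_add[of 1 "-1 :: 'a"] by (simp add: weyl_const_1 eq_neg_iff_add_eq_0 add.commute)
  ultimately show "weyl_X * weyl_H = (weyl_H + weyl_const (-1)) * (weyl_X :: 'a weyl)"
    by (simp add: weyl_H_def flip: mult.assoc)
qed

lemma weyl_Y_mult_poly_H:
  "weyl_Y * weyl_poly p weyl_H = weyl_poly (pcompose p [:1, 1:]) weyl_H * weyl_Y"
proof (rule weyl_poly_skew_commute)
  have "weyl_Y * weyl_X = weyl_X * weyl_Y + (1 :: 'a weyl)"
    by (metis weyl_relation diff_add_cancel add.commute)
  then have "weyl_Y * (weyl_Y * weyl_X) = weyl_Y * (weyl_X * weyl_Y + (1 :: 'a weyl))"
    by (rule arg_cong)
  then show "weyl_Y * weyl_H = (weyl_H + weyl_const 1) * (weyl_Y :: 'a weyl)"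
    by (simp add: weyl_H_def weyl_const_1 distrib_left distrib_right mult.assoc)
qed

text \<open>For i < 0 the product X v_i begins with X Y = H - 1, so it equals (H - 1) v_(i+1) and
  the extra factor is absorbed into K[H]; for i \<ge> 0 no such factor appears.\<close>

lemma weyl_X_mult_piece:
  assumes "a \<in> weyl_piece i" shows "weyl_X * a \<in> weyl_piece (i + 1)"
proof -
  from assms obtain p where a: "a = weyl_poly p weyl_H * weyl_v i"
    by (auto simp: weyl_piece_def weyl_adjoin_def)
  let ?p = "pcompose p [:-1, 1:]"
  have XY: "weyl_X * weyl_Y = weyl_poly [:-1, 1:] (weyl_H :: 'a weyl)"
    using weyl_relation[where 'k='a] weyl_const_add[of 1 "-1 :: 'a"]
    by (simp add: weyl_poly_pCons weyl_const_1 weyl_H_def algebra_simps eq_neg_iff_add_eq_0)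
  have 1: "weyl_X * a = weyl_poly ?p weyl_H * (weyl_X * weyl_v i)"
    by (simp add: a weyl_X_mult_poly_H flip: mult.assoc)
  show ?thesis
  proof (cases "i \<ge> 0")
    case True
    then have "weyl_X * weyl_v i = (weyl_v (i + 1) :: 'a weyl)"
      by (simp add: weyl_v_def nat_add_distrib)
    then show ?thesis using 1 by (auto simp: weyl_piece_def weyl_adjoin_def)
  next
    case False
    then have "nat (- i) = Suc (nat (- (i + 1)))" by simp
    then have "weyl_X * weyl_v i = weyl_poly [:-1, 1:] weyl_H * (weyl_v (i + 1) :: 'a weyl)"
      using False by (auto simp: weyl_v_def XY simp flip: mult.assoc)
    then have "weyl_X * a = weyl_poly (?p * [:-1, 1:]) weyl_H * weyl_v (i + 1)"
      using 1 by (simp only: weyl_poly_mult mult.assoc)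
    then show ?thesis unfolding weyl_piece_def weyl_adjoin_def by blast
  qed
qed

text \<open>Mirror image of the previous lemma: for i > 0 one has Y v_i = (Y X) v_(i-1) = H
  v_(i-1).\<close>

lemma weyl_Y_mult_piece:
  assumes "a \<in> weyl_piece i" shows "weyl_Y * a \<in> weyl_piece (i - 1)"
proof -
  from assms obtain p where a: "a = weyl_poly p weyl_H * weyl_v i"
    by (auto simp: weyl_piece_def weyl_adjoin_def)
  let ?p = "pcompose p [:1, 1:]"
  have YX: "weyl_Y * weyl_X = weyl_poly [:0, 1:] (weyl_H :: 'a weyl)"
    by (simp add: weyl_poly_pCons weyl_const_1 weyl_H_def)
  have 1: "weyl_Y * a = weyl_poly ?p weyl_H * (weyl_Y * weyl_v i)"
    by (simp add: a weyl_Y_mult_poly_H flip: mult.assoc)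
  show ?thesis
  proof (cases "i \<le> 0")
    case True
    then have "nat (- (i - 1)) = Suc (nat (- i))" by simp
    then have "weyl_Y * weyl_v i = (weyl_v (i - 1) :: 'a weyl)"
      using True by (auto simp: weyl_v_def)
    then show ?thesis using 1 by (auto simp: weyl_piece_def weyl_adjoin_def)
  next
    case False
    then have "nat i = Suc (nat (i - 1))" by simp
    then have "weyl_Y * weyl_v i = weyl_poly [:0, 1:] weyl_H * (weyl_v (i - 1) :: 'a weyl)"
      using False by (auto simp: weyl_v_def YX simp flip: mult.assoc)
    then have "weyl_Y * a = weyl_poly (?p * [:0, 1:]) weyl_H * weyl_v (i - 1)"
      using 1 by (simp only: weyl_poly_mult mult.assoc)
    then show ?thesis unfolding weyl_piece_def weyl_adjoin_def by blast
  qed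
qed

text \<open>Words span the free algebra, and each word arises from 1 by left multiplications with
  generators; both facts pass to the quotient.\<close>

lemma weyl_induct [case_names one add scale X Y]:
  assumes "P 1" "\<And>a b. P a \<Longrightarrow> P b \<Longrightarrow> P (a + b)" "\<And>k a. P a \<Longrightarrow> P (k *\<^sub>W a)"
    "\<And>a. P a \<Longrightarrow> P (weyl_X * a)" "\<And>a. P a \<Longrightarrow> P (weyl_Y * a)"
  shows "P (a :: 'k::field weyl)"
proof -
  have word: "P (abs_weyl (Poly_Mapping.single (Word gs) 1))" for gs
  proof (induction gs)
    case Nil
    have "abs_weyl (Poly_Mapping.single (Word []) (1::'k)) = 1"
      by (simp add: one_weyl_def flip: zero_weyl_word_def)
    then show ?case using assms(1) by simp
  next
    case (Cons g gs)
    let ?s = "Poly_Mapping.single (Word gs) (1::'k)"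
    have "Poly_Mapping.single (Word (g # gs)) 1 = (case g of GenX \<Rightarrow> freeX | GenY \<Rightarrow> freeY) * ?s"
      by (cases g) (simp_all add: freeX_def freeY_def mult_single plus_weyl_word_def)
    then have "abs_weyl (Poly_Mapping.single (Word (g # gs)) 1)
        = (case g of GenX \<Rightarrow> weyl_X | GenY \<Rightarrow> weyl_Y) * abs_weyl ?s"
      by (cases g) (simp_all add: weyl_X_def weyl_Y_def times_weyl.abs_eq)
    then show ?case using Cons assms(4,5) by (cases g) simp_all
  qed
  have "P (abs_weyl f)" for f :: "'k free_alg"
  proof (induction f rule: free_alg_induct)
    case zero
    have "abs_weyl 0 = 0 *\<^sub>W (1 :: 'k weyl)" by (simp add: zero_weyl_def)
    then show ?case using assms(1,3) by metis
  next
    case (add w c f)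
    have "Poly_Mapping.single w c = Poly_Mapping.single 0 c * Poly_Mapping.single (Word (letters w)) 1"
      by (simp add: mult_single)
    then have "abs_weyl (Poly_Mapping.single w c)
        = c *\<^sub>W abs_weyl (Poly_Mapping.single (Word (letters w)) 1)"
      by (simp add: weyl_scale_def weyl_const_def times_weyl.abs_eq)
    moreover have "abs_weyl (Poly_Mapping.single w c + f)
        = abs_weyl (Poly_Mapping.single w c) + abs_weyl f"
      by (simp add: plus_weyl.abs_eq)
    ultimately show ?case using assms(2)[OF assms(3)[OF word] add] by metis
  qed
  then show ?thesis using Quotient3_abs_rep[OF Quotient3_weyl] by metis
qed

lemma weyl_mult_span:
  assumes "\<And>b. b \<in> S \<Longrightarrow> c * b \<in> weyl.span T" "a \<in> weyl.span S"
  shows "c * a \<in> weyl.span T"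
  using assms(2)
proof (induction rule: weyl.span_induct_alt)
  case base
  show ?case by (simp add: weyl.span_zero)
next
  case (step k x y)
  then show ?case
    by (simp add: distrib_left weyl_scale_mult_right weyl.span_add weyl.span_scale assms(1))
qed

text \<open>Existence half of the grading: the span contains 1 and is stable under left
  multiplication by X and Y, which move the pieces one step up or down. Uniqueness of the components
  comes later, from the action on K[x].\<close>

lemma weyl_span_pieces: "weyl.span (\<Union>i. weyl_piece i) = (UNIV :: 'k::field weyl set)"
proof -
  have "a \<in> weyl.span (\<Union>i. weyl_piece i)" for a :: "'k weyl"
  proof (induction a rule: weyl_induct)
    case one
    have "1 \<in> weyl_piece 0"
      unfolding weyl_piece_def weyl_adjoin_def weyl_v_def
      using rangeI[of "\<lambda>p. weyl_poly p weyl_H" 1] by force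
    then show ?case by (auto intro: weyl.span_base)
  next
    case (X a)
    then show ?case
      by (rule weyl_mult_span[rotated]) (auto intro!: weyl.span_base dest: weyl_X_mult_piece)
  next
    case (Y a)
    then show ?case
      by (rule weyl_mult_span[rotated]) (auto intro!: weyl.span_base dest: weyl_Y_mult_piece)
  qed (simp_all add: weyl.span_add weyl.span_scale)
  then show ?thesis by auto
qed

lemma weyl_span_pieces_iff:
  "a \<in> weyl.span (\<Union>i\<in>A. weyl_piece i) \<longleftrightarrow>
    (\<exists>I f. finite I \<and> I \<subseteq> A \<and> a = (\<Sum>i\<in>I. weyl_poly (f i) weyl_H * weyl_v i))"
  (is "?L \<longleftrightarrow> ?R")
proof
  assume ?R
  then show ?L
    unfolding weyl_piece_def weyl_adjoin_def
    by (elim exE conjE) (hypsubst, intro weyl.span_sum weyl.span_base, blast)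
next
  assume ?L
  then show ?R
  proof (induction rule: weyl.span_induct_alt)
    case base
    show ?case by (intro exI[of _ "{}"]) auto
  next
    case (step k x y)
    from step(1) obtain i p where i: "i \<in> A" "x = weyl_poly p weyl_H * weyl_v i"
      by (auto simp: weyl_piece_def weyl_adjoin_def)
    from step(2) obtain I f where I: "finite I" "I \<subseteq> A"
      "y = (\<Sum>i\<in>I. weyl_poly (f i) weyl_H * weyl_v i)" by blast
    \<comment> \<open>The values of \<open>f\<close> outside \<open>I\<close> are arbitrary and must
      be replaced by 0, and \<open>i\<close> may already lie in \<open>I\<close>, in which case the
      new term is added to the old one.\<close>
    define g where "g j = (if j \<in> I then f j else 0) + (if j = i then smult k p else 0)" for j
    have "k *\<^sub>W x + y = (\<Sum>j\<in>insert i I. weyl_poly (g j) weyl_H * weyl_v j)"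
    proof -
      have "(\<Sum>j\<in>insert i I. weyl_poly (g j) weyl_H * weyl_v j)
        = (\<Sum>j\<in>insert i I. weyl_poly (if j \<in> I then f j else 0) weyl_H * weyl_v j) +
          (\<Sum>j\<in>insert i I. weyl_poly (if j = i then smult k p else 0) weyl_H * weyl_v j)"
        by (simp only: g_def weyl_poly_add distrib_right sum.distrib)
      also have "(\<Sum>j\<in>insert i I. weyl_poly (if j \<in> I then f j else 0) weyl_H * weyl_v j) = y"
        unfolding I(3) by (rule sum.mono_neutral_cong_right) (use I(1) in auto)
      also have "(\<Sum>j\<in>insert i I. weyl_poly (if j = i then smult k p else 0) weyl_H * weyl_v j) = k *\<^sub>W x"
      proof -
        have "(\<Sum>j\<in>insert i I. weyl_poly (if j = i then smult k p else 0) weyl_H * weyl_v j) =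
          (\<Sum>j\<in>insert i I. if j = i then k *\<^sub>W x else 0)"
          by (rule sum.cong) (auto simp: i(2) weyl_poly_smult weyl_scale_mult_left)
        then show ?thesis using I(1) by simp
      qed
      finally show ?thesis by (simp add: add.commute)
    qed
    then show ?case using I i by (intro exI[of _ "insert i I"] exI[of _ g]) auto
  qed
qed

section \<open>The action on K[x]: X multiplies by x and Y differentiates\<close>

lift_definition weyl_act :: "'k::field weyl \<Rightarrow> 'k poly \<Rightarrow> 'k poly" is free_act
proof
  fix f g :: "'k free_alg" and p
  assume "weyl_rel f g"
  then show "free_act f p = free_act g p"
    using free_act_weyl_ideal[of "f - g" p] by (simp add: weyl_rel_def free_act_diff)
qed

lemma weyl_act_add: "weyl_act (a + b) p = weyl_act a p + weyl_act b p"
  by transfer (rule free_act_plus)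

lemma weyl_act_mult: "weyl_act (a * b) p = weyl_act a (weyl_act b p)"
  by transfer (rule free_act_mult)

lemma weyl_act_1 [simp]: "weyl_act 1 p = p"
  by transfer (rule free_act_one)

lemma weyl_act_0 [simp]: "weyl_act 0 p = 0"
  by transfer (rule free_act_0)

lemma weyl_act_scale: "weyl_act (k *\<^sub>W a) p = smult k (weyl_act a p)"
proof -
  have "weyl_act (weyl_const k) q = smult k q" for q
    by transfer (simp add: free_act_single)
  then show ?thesis by (simp add: weyl_scale_def weyl_act_mult)
qed

lemma weyl_act_sum: "weyl_act (\<Sum>i\<in>I. f i) p = (\<Sum>i\<in>I. weyl_act (f i) p)"
  by (induction I rule: infinite_finite_induct) (simp_all add: weyl_act_add)

lemma weyl_act_X: "weyl_act weyl_X p = pCons 0 p"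
  by transfer (simp add: freeX_def free_act_single word_act_def)

lemma weyl_act_Y: "weyl_act weyl_Y p = pderiv p"
  by transfer (simp add: freeY_def free_act_single word_act_def)

lemma weyl_act_add_right: "weyl_act a (p + q) = weyl_act a p + weyl_act a q"
  by transfer (simp add: free_act_def word_act_add smult_add_right sum.distrib)

lemma weyl_act_smult_right: "weyl_act a (smult k p) = smult k (weyl_act a p)"
  by (induction a arbitrary: p rule: weyl_induct)
    (simp_all add: weyl_act_add weyl_act_mult weyl_act_scale weyl_act_X weyl_act_Y smult_add_right
      pderiv_smult mult.commute)

lemma weyl_act_0_right [simp]: "weyl_act a 0 = 0"
  by transfer simp

lemma weyl_act_sum_right: "weyl_act a (\<Sum>i\<in>I. f i) = (\<Sum>i\<in>I. weyl_act a (f i))"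
  by (induction I rule: infinite_finite_induct) (simp_all add: weyl_act_add_right)

section \<open>Homogeneous components as polynomial functions\<close>

text \<open>In characteristic zero the naturals from \<open>N\<close> on give infinitely many
  points, while a nonzero polynomial has finitely many roots.\<close>

lemma poly_eq_of_nat:
  fixes p q :: "'k::field_char_0 poly"
  assumes "\<And>n. n \<ge> N \<Longrightarrow> poly p (of_nat n) = poly q (of_nat n)"
  shows "p = q"
proof (rule ccontr)
  assume "p \<noteq> q"
  then have "finite {x. poly (p - q) x = 0}" by (intro poly_roots_finite) simp
  moreover have "of_nat ` {N..} \<subseteq> {x. poly (p - q) x = 0}" using assms by auto
  ultimately have "finite (of_nat ` {N..} :: 'k set)" by (rule finite_subset[rotated])
  then have "finite {N..}" by (rule finite_imageD) (simp add: inj_on_def)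
  then show False using infinite_Ici by blast
qed

text \<open>For i = -k < 0 this is the falling factorial x (x - 1) ... (x - k + 1), whose value at n
  is the coefficient produced by differentiating x^n k times; for i \<ge> 0 it is the empty product
  1.\<close>

definition weyl_vpoly :: "int \<Rightarrow> 'k::field poly"
  where "weyl_vpoly i = (\<Prod>j<nat (- i). [:- of_nat j, 1:])"

lemma weyl_vpoly_nonzero: "weyl_vpoly i \<noteq> 0"
  by (simp add: weyl_vpoly_def)

lemma poly_weyl_vpoly_eq_0: "int n + i < 0 \<Longrightarrow> poly (weyl_vpoly i) (of_nat n) = 0"
  by (auto simp: weyl_vpoly_def poly_prod)

text \<open>H = Y X first multiplies by x and then differentiates, so x^n is an eigenvector with
  eigenvalue n + 1. This is the source of the offset 1 in the coefficient formulas.\<close>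

lemma weyl_act_poly_H:
  "weyl_act (weyl_poly p weyl_H) (monom 1 n) = smult (poly p (of_nat n + 1)) (monom 1 n)"
proof (induction p)
  case (pCons c p)
  have "weyl_act weyl_H (monom 1 n) = smult (of_nat n + 1) (monom (1 :: 'a) n)"
    using smult_add_left[of "of_nat n" 1 "monom (1 :: 'a) n"] by (simp add: weyl_H_def weyl_act_mult weyl_act_X weyl_act_Y pderiv_monom smult_monom
        add.commute flip: monom_Suc)
  moreover have "weyl_act (weyl_const c) q = smult c q" for q
    using weyl_act_scale[of c 1 q] by (simp add: weyl_scale_def)
  ultimately show ?case
    by (simp add: weyl_poly_pCons weyl_act_add weyl_act_mult pCons.IH weyl_act_smult_right
        mult.commute flip: smult_add_left)
qed simp

lemma weyl_act_v:
  "weyl_act (weyl_v i) (monom 1 n) =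
    smult (poly (weyl_vpoly i) (of_nat n)) (monom 1 (nat (int n + i)))"
proof (cases "i \<ge> 0")
  case True
  have "weyl_act (weyl_X ^ k) (monom 1 n) = monom (1 :: 'a) (n + k)" for k
    by (induction k) (simp_all add: weyl_act_mult weyl_act_X flip: monom_Suc)
  then show ?thesis using True by (simp add: weyl_v_def weyl_vpoly_def nat_add_distrib)
next
  case False
  have "weyl_act (weyl_Y ^ k) (monom 1 n) =
    smult (poly (\<Prod>j<k. [:- of_nat j, 1:]) (of_nat n)) (monom (1 :: 'a) (n - k))" for k
  proof (induction k)
    case (Suc k)
    \<comment> \<open>For k > n the product contains the factor n - n = 0, so the truncated
      subtraction \<open>n - k\<close> does no harm.\<close>
    have "poly (\<Prod>j<k. [:- of_nat j, 1 :: 'a:]) (of_nat n) * of_nat (n - k)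
      = poly (\<Prod>j<k. [:- of_nat j, 1:]) (of_nat n) * (of_nat n - of_nat k)"
      by (cases "k \<le> n") (auto simp: of_nat_diff poly_prod)
    then show ?case
      by (simp add: weyl_act_mult Suc.IH weyl_act_Y weyl_act_smult_right pderiv_monom smult_monom
          pderiv_smult algebra_simps)
  qed simp
  moreover have "n - nat (- i) = nat (int n + i)" using False by linarith
  ultimately show ?thesis using False by (simp add: weyl_v_def weyl_vpoly_def)
qed

text \<open>v_j sends x^n to a falling factorial times x^(n+j), on which f_j(H) acts as the scalar
  f_j(n + j + 1). The other summands contribute only to other powers of x.\<close>

lemma coeff_weyl_act_sum_pieces:
  fixes f :: "int \<Rightarrow> 'k::field_char_0 poly"
  assumes "finite I" "int n + j \<ge> 0"
  shows "coeff (weyl_act (\<Sum>i\<in>I. weyl_poly (f i) weyl_H * weyl_v i) (monom 1 n)) (nat (int n + j)) =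
    (if j \<in> I then poly (weyl_vpoly j * pcompose (f j) [:of_int j + 1, 1:]) (of_nat n) else 0)"
proof -
  have "coeff (weyl_act (weyl_poly (f i) weyl_H * weyl_v i) (monom 1 n)) (nat (int n + j)) =
    (if i = j then poly (weyl_vpoly j * pcompose (f j) [:of_int j + 1, 1:]) (of_nat n) else 0)" for i
  proof (cases "int n + i < 0")
    case True
    then have "i \<noteq> j" using assms(2) by auto
    then show ?thesis
      using True by (simp add: weyl_act_mult weyl_act_v poly_weyl_vpoly_eq_0)
  next
    case False
    moreover have "(of_nat (nat (int n + j)) :: 'k) = of_nat n + of_int j"
      using assms(2) by (metis int_nat_eq of_int_add of_int_of_nat_eq)
    ultimately show ?thesis
      using assms(2)
      by (auto simp: weyl_act_mult weyl_act_v weyl_act_smult_right weyl_act_poly_H poly_pcompose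
          algebra_simps nat_eq_iff)
  qed
  then show ?thesis
    using assms(1) by (simp add: weyl_act_sum coeff_sum)
qed

text \<open>The action on \<open>K[x]\<close> turns the component of degree \<open>i\<close> of an element \<open>a\<close> into the
  polynomial function giving the coefficient of \<open>x\<^sup>n\<^sup>+\<^sup>i\<close> in \<open>a x\<^sup>n\<close>.\<close>

definition weyl_coeff :: "'k::field_char_0 weyl \<Rightarrow> int \<Rightarrow> 'k poly"
  where "weyl_coeff a i = (SOME p. \<forall>n. int n + i \<ge> 0 \<longrightarrow>
    poly p (of_nat n) = coeff (weyl_act a (monom 1 n)) (nat (int n + i)))"

lemma weyl_decomposition:
  obtains I f where "finite I" "a = (\<Sum>i\<in>I. weyl_poly (f i) weyl_H * weyl_v i)"
  using weyl_span_pieces_iff[of a UNIV] weyl_span_pieces by blast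

lemma poly_weyl_coeff:
  assumes "int n + i \<ge> 0"
  shows "poly (weyl_coeff a i) (of_nat n) = coeff (weyl_act a (monom 1 n)) (nat (int n + i))"
proof -
  obtain I f where I: "finite I" "a = (\<Sum>i\<in>I. weyl_poly (f i) weyl_H * weyl_v i)"
    by (rule weyl_decomposition)
  have "\<exists>p. \<forall>n. int n + i \<ge> 0 \<longrightarrow>
    poly p (of_nat n) = coeff (weyl_act a (monom 1 n)) (nat (int n + i))"
    by (rule exI[of _ "if i \<in> I then weyl_vpoly i * pcompose (f i) [:of_int i + 1, 1:] else 0"])
      (simp add: I(2) coeff_weyl_act_sum_pieces[OF I(1)])
  from someI_ex[OF this] show ?thesis using assms unfolding weyl_coeff_def by blast
qed

text \<open>Agreement for all large n determines a polynomial. In this way the coefficients of sums,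
  multiples and products are computed from the action on monomials.\<close>

lemma weyl_coeff_eqI:
  assumes "\<And>n. n \<ge> N \<Longrightarrow> int n + i \<ge> 0 \<Longrightarrow>
    poly p (of_nat n) = coeff (weyl_act a (monom 1 n)) (nat (int n + i))"
  shows "weyl_coeff a i = p"
  by (rule poly_eq_of_nat[of "max N (nat (- i))"]) (use assms in \<open>auto simp: poly_weyl_coeff\<close>)

lemma weyl_coeff_sum_pieces:
  assumes "finite I"
  shows "weyl_coeff (\<Sum>i\<in>I. weyl_poly (f i) weyl_H * weyl_v i) j =
    (if j \<in> I then weyl_vpoly j * pcompose (f j) [:of_int j + 1, 1:] else 0)"
  by (rule weyl_coeff_eqI) (simp add: coeff_weyl_act_sum_pieces[OF assms])

lemma weyl_coeff_add: "weyl_coeff (a + b) i = weyl_coeff a i + weyl_coeff b i"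
  by (rule weyl_coeff_eqI) (simp add: poly_weyl_coeff weyl_act_add)

lemma weyl_coeff_scale: "weyl_coeff (k *\<^sub>W a) i = smult k (weyl_coeff a i)"
  by (rule weyl_coeff_eqI) (simp add: poly_weyl_coeff weyl_act_scale)

lemma weyl_coeff_0 [simp]: "weyl_coeff 0 i = 0"
  by (rule weyl_coeff_eqI) simp

lemma weyl_coeff_diff: "weyl_coeff (a - b) i = weyl_coeff a i - weyl_coeff b i"
  by (metis weyl_coeff_add add_diff_cancel diff_add_cancel)

definition weyl_support :: "'k::field_char_0 weyl \<Rightarrow> int set"
  where "weyl_support a = {i. weyl_coeff a i \<noteq> 0}"

lemma finite_weyl_support: "finite (weyl_support a)"
proof -
  obtain I f where I: "finite I" "a = (\<Sum>i\<in>I. weyl_poly (f i) weyl_H * weyl_v i)"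
    by (rule weyl_decomposition)
  then have "weyl_support a \<subseteq> I" by (auto simp: weyl_support_def weyl_coeff_sum_pieces)
  then show ?thesis using I(1) by (rule finite_subset)
qed

text \<open>Uniqueness half of the grading: \<open>weyl_coeff a i\<close> is the polynomial f_i with
  translated argument times a nonzero factor, so it vanishes only if f_i does. The degrees defined
  through spans can then be read off the support.\<close>

lemma weyl_in_span_pieces_iff_support:
  "a \<in> weyl.span (\<Union>i\<in>A. weyl_piece i) \<longleftrightarrow> weyl_support a \<subseteq> A"
proof
  assume "weyl_support a \<subseteq> A"
  obtain I f where I: "finite I" "a = (\<Sum>i\<in>I. weyl_poly (f i) weyl_H * weyl_v i)"
    by (rule weyl_decomposition)
  have "f i = 0" if "i \<in> I - A" for i
  proof -
    have "weyl_coeff a i = 0" using that \<open>weyl_support a \<subseteq> A\<close> by (auto simp: weyl_support_def)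
    then have "pcompose (f i) [:of_int i + 1, 1:] = 0"
      using that I by (simp add: weyl_coeff_sum_pieces weyl_vpoly_nonzero)
    then show ?thesis by (rule pcompose_eq_0) simp
  qed
  then have "a = (\<Sum>i\<in>I \<inter> A. weyl_poly (f i) weyl_H * weyl_v i)"
    unfolding I(2) by (intro sum.mono_neutral_right) (use I(1) in auto)
  then show "a \<in> weyl.span (\<Union>i\<in>A. weyl_piece i)"
    using I(1) unfolding weyl_span_pieces_iff by blast
qed (auto simp: weyl_span_pieces_iff weyl_support_def weyl_coeff_sum_pieces split: if_splits)

lemma weyl_support_empty_iff [simp]: "weyl_support a = {} \<longleftrightarrow> a = 0"
  using weyl_in_span_pieces_iff_support[of a "{}"] by (auto simp: weyl_support_def)

text \<open>The falling factorial of a negative degree contains the factor x. The root 0 is the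
  starting point of the root argument for commuting elements.\<close>

lemma poly_weyl_coeff_at_0:
  assumes "i < 0"
  shows "poly (weyl_coeff a i) 0 = 0"
proof -
  obtain I f where I: "finite I" "a = (\<Sum>i\<in>I. weyl_poly (f i) weyl_H * weyl_v i)"
    by (rule weyl_decomposition)
  then show ?thesis
    using assms poly_weyl_vpoly_eq_0[of 0 i, where 'a='a] by (simp add: weyl_coeff_sum_pieces)
qed

text \<open>\<open>b\<close> sends x^n to the sum of the terms b_j(n) x^(n+j), and the component of
  \<open>a\<close> of degree k - j acts on x^(n+j) by its value at n + j; hence the translation by
  j.\<close>

lemma weyl_coeff_mult:
  "weyl_coeff (a * b) k =
    (\<Sum>j\<in>weyl_support b. weyl_coeff b j * pcompose (weyl_coeff a (k - j)) [:of_int j, 1:])"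
proof (rule weyl_coeff_eqI)
  \<comment> \<open>The bound on \<open>n\<close> makes n + j nonnegative for every j in the support
    of \<open>b\<close>, so no exponent is truncated.\<close>
  fix n assume n: "n \<ge> Max (insert 0 ((\<lambda>j. nat (- j)) ` weyl_support b))" "int n + k \<ge> 0"
  have nj: "int n + j \<ge> 0" if "j \<in> weyl_support b" for j
  proof -
    have "nat (- j) \<le> Max (insert 0 ((\<lambda>j. nat (- j)) ` weyl_support b))"
      using that finite_weyl_support[of b] by (intro Max_ge) auto
    then show ?thesis using n(1) by linarith
  qed
  let ?q = "weyl_act b (monom 1 n)"
  have q: "?q = (\<Sum>j\<in>weyl_support b. smult (poly (weyl_coeff b j) (of_nat n)) (monom 1 (nat (int n + j))))"
  proof (rule poly_eqI)
    fix m
    have "coeff ?q m = poly (weyl_coeff b (int m - int n)) (of_nat n)"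
      by (simp add: poly_weyl_coeff)
    also have "\<dots> = (\<Sum>j\<in>weyl_support b. if j = int m - int n then poly (weyl_coeff b j) (of_nat n) else 0)"
      using finite_weyl_support[of b] by (auto simp: weyl_support_def)
    also have "\<dots> = (\<Sum>j\<in>weyl_support b. poly (weyl_coeff b j) (of_nat n) *
        coeff (monom 1 (nat (int n + j))) m)"
      by (rule sum.cong) (use nj in \<open>auto simp: nat_eq_iff2\<close>)
    finally show "coeff ?q m = coeff (\<Sum>j\<in>weyl_support b. smult (poly (weyl_coeff b j) (of_nat n))
        (monom 1 (nat (int n + j)))) m"
      by (simp add: coeff_sum)
  qed
  have "coeff (weyl_act a (monom 1 (nat (int n + j)))) (nat (int n + k)) =
      poly (weyl_coeff a (k - j)) (of_nat n + of_int j)" if "j \<in> weyl_support b" for j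
  proof -
    have "(of_nat (nat (int n + j)) :: 'a) = of_nat n + of_int j"
      using nj[OF that] by (metis int_nat_eq of_int_add of_int_of_nat_eq)
    then show ?thesis
      using poly_weyl_coeff[of "nat (int n + j)" "k - j" a] nj[OF that] n(2) by simp
  qed
  then show "poly (\<Sum>j\<in>weyl_support b. weyl_coeff b j * pcompose (weyl_coeff a (k - j)) [:of_int j, 1:])
      (of_nat n) = coeff (weyl_act (a * b) (monom 1 n)) (nat (int n + k))"
    unfolding weyl_act_mult q
    by (simp add: weyl_act_sum_right weyl_act_smult_right coeff_sum poly_sum poly_pcompose add.commute)
qed

lemma weyl_coeff_mult_unique:
  assumes "e \<in> weyl_support b"
    "\<And>i j. i \<in> weyl_support a \<Longrightarrow> j \<in> weyl_support b \<Longrightarrow> i + j = d + e \<Longrightarrow> j = e"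
  shows "weyl_coeff (a * b) (d + e) = weyl_coeff b e * pcompose (weyl_coeff a d) [:of_int e, 1:]"
proof -
  have "weyl_coeff (a * b) (d + e) = (\<Sum>j\<in>weyl_support b.
      if j = e then weyl_coeff b e * pcompose (weyl_coeff a d) [:of_int e, 1:] else 0)"
    unfolding weyl_coeff_mult
  proof (rule sum.cong)
    fix j assume j: "j \<in> weyl_support b"
    show "weyl_coeff b j * pcompose (weyl_coeff a (d + e - j)) [:of_int j, 1:] =
      (if j = e then weyl_coeff b e * pcompose (weyl_coeff a d) [:of_int e, 1:] else 0)"
      using assms(2)[OF _ j, of "d + e - j"]
      by (cases "weyl_coeff a (d + e - j) = 0") (auto simp: weyl_support_def)
  qed simp
  then show ?thesis using assms(1) finite_weyl_support[of b] by simp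
qed

section \<open>Leading components and commuting elements\<close>

text \<open>With s = 1 this is v and with s = -1 it is v_-, so that one argument serves both. At 0
  the maximum is over the empty set and carries no information.\<close>

definition weyl_sdeg :: "int \<Rightarrow> 'k::field_char_0 weyl \<Rightarrow> int"
  where "weyl_sdeg s a = Max ((\<lambda>i. s * i) ` weyl_support a)"

text \<open>The factor \<open>s\<close> turns the signed degree back into an index of the
  grading.\<close>

definition weyl_lead :: "int \<Rightarrow> 'k::field_char_0 weyl \<Rightarrow> 'k poly"
  where "weyl_lead s a = weyl_coeff a (s * weyl_sdeg s a)"

lemma weyl_sdeg_ge: "i \<in> weyl_support a \<Longrightarrow> s * i \<le> weyl_sdeg s a"
  unfolding weyl_sdeg_def using finite_weyl_support[of a] by (intro Max_ge) auto

lemma weyl_sdeg_in_support: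
  assumes "s * s = 1" "a \<noteq> 0"
  shows "s * weyl_sdeg s a \<in> weyl_support a"
proof -
  have "weyl_sdeg s a \<in> (\<lambda>i. s * i) ` weyl_support a"
    unfolding weyl_sdeg_def using finite_weyl_support[of a] assms(2) by (intro Max_in) auto
  then obtain i where "i \<in> weyl_support a" "weyl_sdeg s a = s * i" by blast
  then show ?thesis using assms(1) by (simp flip: mult.assoc)
qed

lemma weyl_lead_nonzero: "s * s = 1 \<Longrightarrow> a \<noteq> 0 \<Longrightarrow> weyl_lead s a \<noteq> 0"
  using weyl_sdeg_in_support by (auto simp: weyl_lead_def weyl_support_def)

lemma weyl_sdeg_leI:
  assumes "s * s = 1" "a \<noteq> 0" "\<And>i. i \<in> weyl_support a \<Longrightarrow> s * i \<le> n"
  shows "weyl_sdeg s a \<le> n"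
  using assms(3)[OF weyl_sdeg_in_support[OF assms(1,2)]] assms(1) by (simp flip: mult.assoc)

text \<open>Both signed degrees are maximal, so the top degree splits in only one way and a single
  term of the product formula survives.\<close>

lemma weyl_lead_mult_aux:
  assumes s: "s * s = 1" and "a \<noteq> 0" "b \<noteq> 0"
  shows "weyl_coeff (a * b) (s * (weyl_sdeg s a + weyl_sdeg s b)) =
    weyl_lead s b * pcompose (weyl_lead s a) [:of_int (s * weyl_sdeg s b), 1:]"
proof -
  have "j = s * weyl_sdeg s b"
    if "i \<in> weyl_support a" "j \<in> weyl_support b" "i + j = s * weyl_sdeg s a + s * weyl_sdeg s b" for i j
  proof -
    have "s * i + s * j = s * s * weyl_sdeg s a + s * s * weyl_sdeg s b"
      using arg_cong[OF that(3), of "\<lambda>x. s * x"] by (simp add: distrib_left mult.assoc)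
    then have "s * j = weyl_sdeg s b"
      using weyl_sdeg_ge[OF that(1), of s] weyl_sdeg_ge[OF that(2), of s] s by simp
    then show ?thesis using s by (metis mult.assoc mult_1)
  qed
  then show ?thesis
    using weyl_coeff_mult_unique[OF weyl_sdeg_in_support[OF s assms(3)], of a "s * weyl_sdeg s a"]
    by (simp add: weyl_lead_def distrib_left)
qed

lemma weyl_lead_mult_nonzero:
  assumes "s * s = 1" "a \<noteq> 0" "b \<noteq> 0"
  shows "weyl_coeff (a * b) (s * (weyl_sdeg s a + weyl_sdeg s b)) \<noteq> 0"
proof -
  have "pcompose (weyl_lead s a) [:of_int (s * weyl_sdeg s b), 1:] \<noteq> 0"
    using weyl_lead_nonzero[OF assms(1,2)] by (auto dest: pcompose_eq_0)
  then show ?thesis using weyl_lead_nonzero[OF assms(1,3)] by (simp add: weyl_lead_mult_aux[OF assms])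
qed

text \<open>Leading polynomials multiply, up to a translation of one argument, inside the integral
  domain K[x]; the sign s = 1 suffices for this.\<close>

instance weyl :: (field_char_0) ring_1_no_zero_divisors
proof
  fix a b :: "'a weyl"
  assume "a \<noteq> 0" "b \<noteq> 0"
  from weyl_lead_mult_nonzero[of 1, OF _ this] show "a * b \<noteq> 0" by auto
qed

lemma weyl_sdeg_mult:
  assumes s: "s * s = 1" and "a \<noteq> 0" "b \<noteq> 0"
  shows "weyl_sdeg s (a * b) = weyl_sdeg s a + weyl_sdeg s b"
proof (rule antisym)
  show "weyl_sdeg s (a * b) \<le> weyl_sdeg s a + weyl_sdeg s b"
  proof (rule weyl_sdeg_leI[OF s])
    fix k assume "k \<in> weyl_support (a * b)"
    then obtain j where "j \<in> weyl_support b" "k - j \<in> weyl_support a"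
      by (force simp: weyl_support_def weyl_coeff_mult dest: sum.not_neutral_contains_not_neutral)
    then show "s * k \<le> weyl_sdeg s a + weyl_sdeg s b"
      using weyl_sdeg_ge[of j b s] weyl_sdeg_ge[of "k - j" a s] by (simp add: algebra_simps)
  qed (use assms in simp)
  have "s * (weyl_sdeg s a + weyl_sdeg s b) \<in> weyl_support (a * b)"
    using weyl_lead_mult_nonzero[OF assms] by (simp add: weyl_support_def)
  from weyl_sdeg_ge[OF this, of s] show "weyl_sdeg s a + weyl_sdeg s b \<le> weyl_sdeg s (a * b)"
    using s by (simp flip: mult.assoc)
qed

lemma weyl_lead_mult:
  assumes "s * s = 1" and "a \<noteq> 0" "b \<noteq> 0"
  shows "weyl_lead s (a * b) =
    weyl_lead s b * pcompose (weyl_lead s a) [:of_int (s * weyl_sdeg s b), 1:]"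
  using weyl_lead_mult_aux[OF assms] by (simp add: weyl_lead_def weyl_sdeg_mult[OF assms])

lemma weyl_sdeg_add:
  assumes "s * s = 1" "a + b \<noteq> 0"
  shows "weyl_sdeg s (a + b) \<le> max (weyl_sdeg s a) (weyl_sdeg s b)"
proof (rule weyl_sdeg_leI[OF assms])
  fix i assume "i \<in> weyl_support (a + b)"
  then have "i \<in> weyl_support a \<or> i \<in> weyl_support b"
    by (auto simp: weyl_support_def weyl_coeff_add)
  then show "s * i \<le> max (weyl_sdeg s a) (weyl_sdeg s b)"
    using weyl_sdeg_ge[of i a s] weyl_sdeg_ge[of i b s] by (auto simp: le_max_iff_disj)
qed

lemma weyl_sdeg_cancel_lead:
  assumes s: "s * s = 1" and "weyl_sdeg s a = weyl_sdeg s b" "weyl_lead s a = smult k (weyl_lead s b)"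
  shows "a = k *\<^sub>W b \<or> weyl_sdeg s (a - k *\<^sub>W b) < weyl_sdeg s a"
proof (cases "a = k *\<^sub>W b")
  case False
  then have nz: "a - k *\<^sub>W b \<noteq> 0" by simp
  have "weyl_sdeg s (a - k *\<^sub>W b) \<le> weyl_sdeg s a - 1"
  proof (rule weyl_sdeg_leI[OF s nz])
    fix i assume i: "i \<in> weyl_support (a - k *\<^sub>W b)"
    then have "i \<in> weyl_support a \<or> i \<in> weyl_support b"
      by (auto simp: weyl_support_def weyl_coeff_diff weyl_coeff_scale)
    then have "s * i \<le> weyl_sdeg s a"
      using weyl_sdeg_ge[of i a s] weyl_sdeg_ge[of i b s] assms(2) by auto
    moreover have "s * i \<noteq> weyl_sdeg s a"
    proof
      assume "s * i = weyl_sdeg s a"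
      then have "i = s * weyl_sdeg s a" using s by (metis mult.assoc mult_1)
      then show False
        using i assms(2,3) by (simp add: weyl_support_def weyl_coeff_diff weyl_coeff_scale weyl_lead_def)
    qed
    ultimately show "s * i \<le> weyl_sdeg s a - 1" by simp
  qed
  then show ?thesis by simp
qed simp

lemma weyl_deg_eq_sdeg:
  assumes "a \<noteq> 0" shows "weyl_deg a = weyl_sdeg 1 a"
  unfolding weyl_deg_def weyl_in_span_pieces_iff_support
  using weyl_sdeg_ge[of _ a 1] weyl_sdeg_in_support[of 1 a] assms
  by (intro Least_equality) auto

lemma weyl_deg_minus_eq_sdeg:
  assumes "a \<noteq> 0" shows "weyl_deg_minus a = weyl_sdeg (-1) a"
proof -
  have "(GREATEST d. weyl_support a \<subseteq> {d..}) = - weyl_sdeg (-1) a"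
    using weyl_sdeg_ge[of _ a "-1"] weyl_sdeg_in_support[of "-1" a] assms
    by (intro Greatest_equality) force+
  then show ?thesis by (simp add: weyl_deg_minus_def weyl_in_span_pieces_iff_support)
qed

lemma weyl_adjoin_H_iff: "a \<in> weyl_adjoin weyl_H \<longleftrightarrow> weyl_support a \<subseteq> {0}"
proof
  assume "a \<in> weyl_adjoin weyl_H"
  then have "a \<in> weyl_piece 0" by (auto simp: weyl_piece_def weyl_v_def)
  then have "a \<in> weyl.span (\<Union>i\<in>{0}. weyl_piece i)" by (simp add: weyl.span_base)
  then show "weyl_support a \<subseteq> {0}" by (simp only: weyl_in_span_pieces_iff_support)
next
  assume "weyl_support a \<subseteq> {0}"
  then obtain I f where "I \<subseteq> {0}" "a = (\<Sum>i\<in>I. weyl_poly (f i) weyl_H * weyl_v i)"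
    unfolding weyl_in_span_pieces_iff_support[symmetric] weyl_span_pieces_iff by blast
  then have "a = weyl_poly 0 weyl_H \<or> a = weyl_poly (f 0) weyl_H"
    by (auto simp: subset_singleton_iff weyl_v_def)
  then show "a \<in> weyl_adjoin weyl_H" unfolding weyl_adjoin_def by blast
qed

text \<open>The quotient p / q is invariant under translation by \<open>i\<close>, so it is constant
  along the multiples of \<open>i\<close> beyond the last root of \<open>q\<close> among them. These
  are infinitely many points.\<close>

lemma poly_shift_proportional:
  fixes p q :: "'k::field_char_0 poly"
  assumes "q \<noteq> 0" "i \<noteq> (0::int)"
    and eq: "p * pcompose q [:of_int i, 1:] = q * pcompose p [:of_int i, 1:]"
  shows "\<exists>k. p = smult k q"
proof -
  define x :: "nat \<Rightarrow> 'k" where "x n = of_int (int n * i)" for n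
  have inj: "inj_on x A" for A using assms(2) by (auto simp: x_def inj_on_def simp del: of_int_mult)
  have "finite (x -` {z. poly q z = 0})"
    using poly_roots_finite[OF assms(1)] inj by (rule finite_vimageI)
  then obtain N where "\<forall>n\<in>x -` {z. poly q z = 0}. n < N"
    unfolding finite_nat_set_iff_bounded by blast
  then have N: "poly q (x n) \<noteq> 0" if "n \<ge> N" for n using that by auto
  have shift: "poly p (x n) * poly q (x (Suc n)) = poly q (x n) * poly p (x (Suc n))" for n
    using arg_cong[OF eq, of "\<lambda>r. poly r (x n)"] by (simp add: poly_pcompose x_def algebra_simps)
  define k where "k = poly p (x N) / poly q (x N)"
  have "poly p (x n) = k * poly q (x n)" if "n \<ge> N" for n
    using that
  proof (induction rule: dec_induct)
    case (step n)
    then have "poly q (x n) * (k * poly q (x (Suc n))) = poly q (x n) * poly p (x (Suc n))"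
      using shift[of n]
      by (simp add: mult_ac)
    then show ?case using N[of n] step by simp
  qed (use N in \<open>simp add: k_def\<close>)
  then have "x ` {N..} \<subseteq> {z. poly (p - smult k q) z = 0}" by auto
  moreover have "infinite (x ` {N..})"
    using finite_imageD[OF _ inj] infinite_Ici by blast
  ultimately have "p - smult k q = 0" using poly_roots_finite finite_subset by blast
  then show ?thesis by auto
qed

text \<open>The largest integer root of \<open>q\<close> produces one of \<open>p\<close>, and the largest integer root of \<open>p\<close>
  then contradicts the maximality of both.\<close>

lemma poly_shift_root_contradiction:
  fixes p q :: "'k::field_char_0 poly"
  assumes "p \<noteq> 0" "q \<noteq> 0" "poly q 0 = 0" "m > (0::int)" "i > (0::int)"
    and eq: "q * pcompose p [:of_int (- m), 1:] = p * pcompose q [:of_int i, 1:]"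
  shows False
proof -
  define R where "R r = {z::int. poly r (of_int z :: 'k) = 0}" for r
  have fin: "finite (R r)" if "r \<noteq> 0" for r
    using finite_vimageI[OF poly_roots_finite[OF that], of of_int]
    by (simp add: R_def vimage_def inj_on_def)
  have eval: "poly q (of_int n) * poly p (of_int (n - m)) = poly p (of_int n) * poly q (of_int (n + i))" for n
    using arg_cong[OF eq, of "\<lambda>r. poly r (of_int n)"] by (simp add: poly_pcompose add.commute)
  define r where "r = Max (R q)"
  have "0 \<in> R q" using assms(3) by (simp add: R_def)
  then have r: "r \<in> R q" unfolding r_def using fin[OF assms(2)] by (intro Max_in) auto
  have q: "poly q (of_int z) \<noteq> 0" if "z > r" for z
    using Max_ge[OF fin[OF assms(2)], of z] that by (auto simp: R_def r_def)
  have "r \<in> R p" using eval[of r] r q[of "r + i"] assms(5) by (simp add: R_def)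
  define t where "t = Max (R p)"
  have t: "t \<in> R p" unfolding t_def using fin[OF assms(1)] \<open>r \<in> R p\<close> by (intro Max_in) auto
  have "t \<ge> r" unfolding t_def using fin[OF assms(1)] \<open>r \<in> R p\<close> by (rule Max_ge)
  have p: "poly p (of_int z) \<noteq> 0" if "z > t" for z
    using Max_ge[OF fin[OF assms(1)], of z] that by (auto simp: R_def t_def)
  \<comment> \<open>At t + m the left side vanishes because t is a root of \<open>p\<close>, while
    both arguments on the right lie beyond the largest integer roots.\<close>
  show False
    using eval[of "t + m"] t p[of "t + m"] q[of "t + m + i"] \<open>t \<ge> r\<close> assms(4,5) by (simp add: R_def)
qed

text \<open>Comparing the leading terms of \<open>a * b\<close> and \<open>b * a\<close> gives an
  identity between translates. A negative degree of \<open>b\<close> would make the two translations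
  point in opposite directions, which the preceding lemma excludes.\<close>

lemma weyl_sdeg_commuting_nonneg:
  assumes s: "s * s = 1" and "a * b = b * a" "weyl_sdeg s a > 0" "a \<noteq> 0" "b \<noteq> 0"
  shows "weyl_sdeg s b \<ge> 0"
proof (rule ccontr)
  assume "\<not> weyl_sdeg s b \<ge> 0"
  let ?c = "\<lambda>x. [:of_int (s * weyl_sdeg s x), 1:]"
  have eq: "weyl_lead s b * pcompose (weyl_lead s a) (?c b) = weyl_lead s a * pcompose (weyl_lead s b) (?c a)"
    using weyl_lead_mult[OF s, of a b] weyl_lead_mult[OF s, of b a] assms by simp
  have nz: "weyl_lead s a \<noteq> 0" "weyl_lead s b \<noteq> 0" using weyl_lead_nonzero[OF s] assms by auto
  have "s = 1 \<or> s = -1" using s by (simp add: zmult_eq_1_iff)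
  then show False
  proof
    assume [simp]: "s = 1"
    have "poly (weyl_lead s b) 0 = 0"
      using \<open>\<not> weyl_sdeg s b \<ge> 0\<close> unfolding weyl_lead_def by (intro poly_weyl_coeff_at_0) simp
    then show False
      using poly_shift_root_contradiction[of "weyl_lead s a" "weyl_lead s b" "- weyl_sdeg s b" "weyl_sdeg s a"]
        nz eq \<open>\<not> weyl_sdeg s b \<ge> 0\<close> assms(3) by simp
  next
    assume [simp]: "s = -1"
    \<comment> \<open>For s = -1 it is \<open>a\<close> whose leading component has negative index
      and thus the root 0, so the two leading polynomials exchange roles.\<close>
    have "poly (weyl_lead s a) 0 = 0"
      using assms(3) unfolding weyl_lead_def by (intro poly_weyl_coeff_at_0) simp
    then show False
      using poly_shift_root_contradiction[of "weyl_lead s b" "weyl_lead s a" "weyl_sdeg s a" "- weyl_sdeg s b"]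
        nz eq \<open>\<not> weyl_sdeg s b \<ge> 0\<close> assms(3) by simp
  qed
qed

text \<open>The two commutation identities share the translate \<open>?A'\<close> because
  \<open>b\<close> and \<open>c\<close> have equal degree. Eliminating it shows that the quotient of
  the leading polynomials of \<open>b\<close> and \<open>c\<close> is invariant under a nonzero
  translation.\<close>

lemma weyl_sdeg_commuting_lead:
  assumes s: "s * s = 1" and comm: "a * b = b * a" "a * c = c * a" and "weyl_sdeg s a > 0"
    and nz: "a \<noteq> 0" "b \<noteq> 0" "c \<noteq> 0" and "weyl_sdeg s b = weyl_sdeg s c"
  shows "\<exists>k. weyl_lead s b = smult k (weyl_lead s c)"
proof (rule poly_shift_proportional)
  let ?A = "weyl_lead s a" and ?B = "weyl_lead s b" and ?C = "weyl_lead s c"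
  let ?u = "[:of_int (s * weyl_sdeg s a), 1:] :: 'a poly"
  let ?A' = "pcompose ?A [:of_int (s * weyl_sdeg s c), 1:]"
  show "?C \<noteq> 0" using weyl_lead_nonzero[OF s] nz by blast
  show "s * weyl_sdeg s a \<noteq> 0" using s assms(4) by auto
  have b: "?B * ?A' = ?A * pcompose ?B ?u"
    using weyl_lead_mult[OF s, of a b] weyl_lead_mult[OF s, of b a] assms by simp
  have c: "?C * ?A' = ?A * pcompose ?C ?u"
    using weyl_lead_mult[OF s, of a c] weyl_lead_mult[OF s, of c a] assms by simp
  have "?A * (?B * pcompose ?C ?u) = ?B * (?C * ?A')" by (simp only: c mult_ac)
  also have "\<dots> = ?C * (?B * ?A')" by (simp only: mult_ac)
  also have "\<dots> = ?A * (?C * pcompose ?B ?u)" by (simp only: b mult_ac)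
  finally show "?B * pcompose ?C ?u = ?C * pcompose ?B ?u"
    using weyl_lead_nonzero[OF s nz(1)] by simp
qed

section \<open>Degree functions with one-dimensional graded pieces\<close>

text \<open>\<open>deg_lead\<close> says that each graded piece has dimension at most one. The
  guards against 0 are there because the degree functions substituted for \<open>d\<close> have no
  meaningful value at 0.\<close>

locale degree_subalgebra =
  fixes C :: "'k::field_char_0 weyl set" and d :: "'k weyl \<Rightarrow> int"
  assumes comm: "commutative_subalgebra C"
    and deg_mult: "\<And>a b. a \<in> C \<Longrightarrow> b \<in> C \<Longrightarrow> a \<noteq> 0 \<Longrightarrow> b \<noteq> 0 \<Longrightarrow> d (a * b) = d a + d b"
    and deg_add: "\<And>a b. a \<in> C \<Longrightarrow> b \<in> C \<Longrightarrow> a \<noteq> 0 \<Longrightarrow> b \<noteq> 0 \<Longrightarrow> a + b \<noteq> 0 \<Longrightarrow>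
      d (a + b) \<le> max (d a) (d b)"
    and deg_nonneg: "\<And>a. a \<in> C \<Longrightarrow> a \<noteq> 0 \<Longrightarrow> d a \<ge> 0"
    and deg_lead: "\<And>a b. a \<in> C \<Longrightarrow> b \<in> C \<Longrightarrow> a \<noteq> 0 \<Longrightarrow> b \<noteq> 0 \<Longrightarrow> d a = d b \<Longrightarrow>
      \<exists>k. a = k *\<^sub>W b \<or> d (a - k *\<^sub>W b) < d a"

text \<open>One element \<open>a\<close> of positive signed degree controls all of \<open>C\<close>:
  every element commutes with \<open>a\<close>, so no signed degree is negative and leading terms of
  equal degree are proportional.\<close>

lemma degree_subalgebra_sdeg:
  assumes s: "s * s = 1" and comm: "commutative_subalgebra C"
    and a: "a \<in> C" "a \<noteq> 0" "weyl_sdeg s a > 0"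
  shows "degree_subalgebra C (weyl_sdeg s)"
proof
  fix b c assume b: "b \<in> C" "b \<noteq> 0"
  have "a * b = b * a" using comm a b by (simp add: commutative_subalgebra_def)
  then show "weyl_sdeg s b \<ge> 0" using weyl_sdeg_commuting_nonneg[OF s] a b by blast
  assume c: "c \<in> C" "c \<noteq> 0" and eq: "weyl_sdeg s b = weyl_sdeg s c"
  have "a * c = c * a" using comm a c by (simp add: commutative_subalgebra_def)
  then obtain k where "weyl_lead s b = smult k (weyl_lead s c)"
    using weyl_sdeg_commuting_lead[OF s] \<open>a * b = b * a\<close> a b c eq by blast
  with weyl_sdeg_cancel_lead[OF s eq] show "\<exists>k. b = k *\<^sub>W c \<or> weyl_sdeg s (b - k *\<^sub>W c) < weyl_sdeg s b"
    by blast
qed (use comm s in \<open>simp_all add: weyl_sdeg_mult weyl_sdeg_add\<close>)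

lemma commutative_weyl_adjoin: "commutative_subalgebra (weyl_adjoin a)"
  unfolding commutative_subalgebra_def weyl_subalgebra_def weyl.subspace_def
proof (intro conjI ballI allI)
  show "0 \<in> weyl_adjoin a" "1 \<in> weyl_adjoin a"
    using rangeI[of "\<lambda>p. weyl_poly p a" 0] rangeI[of "\<lambda>p. weyl_poly p a" 1]
    by (simp_all add: weyl_adjoin_def)
qed (auto simp: weyl_adjoin_def simp flip: weyl_poly_add weyl_poly_mult weyl_poly_smult
    intro: weyl_poly_commute)

text \<open>For a = p(H) the polynomial \<open>weyl_coeff a 0\<close> is p(x + 1), so the function
  is the degree in H, and equal degrees are cancelled by the quotient of leading
  coefficients.\<close>

lemma degree_subalgebra_weyl_H:
  "degree_subalgebra (weyl_adjoin weyl_H) (\<lambda>a. int (degree (weyl_coeff a 0)))"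
proof
  have c0: "weyl_coeff a 0 \<noteq> 0" "weyl_support a = {0}"
    if "a \<in> weyl_adjoin weyl_H" "a \<noteq> 0" for a :: "'a weyl"
  proof -
    show "weyl_support a = {0}"
      using that weyl_adjoin_H_iff[of a] weyl_support_empty_iff[of a] by blast
    then show "weyl_coeff a 0 \<noteq> 0" by (auto simp: weyl_support_def)
  qed
  fix a b :: "'a weyl"
  assume a: "a \<in> weyl_adjoin weyl_H" "a \<noteq> 0" and b: "b \<in> weyl_adjoin weyl_H" "b \<noteq> 0"
  have "weyl_coeff (a * b) 0 = weyl_coeff b 0 * weyl_coeff a 0"
    using weyl_coeff_mult_unique[of 0 b a 0] c0(2)[OF a] c0(2)[OF b] by simp
  then show "int (degree (weyl_coeff (a * b) 0)) =
      int (degree (weyl_coeff a 0)) + int (degree (weyl_coeff b 0))"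
    using c0(1)[OF a] c0(1)[OF b] by (simp add: degree_mult_eq)
  assume eq: "int (degree (weyl_coeff a 0)) = int (degree (weyl_coeff b 0))"
  let ?k = "lead_coeff (weyl_coeff a 0) / lead_coeff (weyl_coeff b 0)"
  let ?r = "weyl_coeff a 0 - smult ?k (weyl_coeff b 0)"
  show "\<exists>k. a = k *\<^sub>W b \<or> int (degree (weyl_coeff (a - k *\<^sub>W b) 0)) < int (degree (weyl_coeff a 0))"
  proof (intro exI[of _ ?k] disjCI)
    assume less: "\<not> int (degree (weyl_coeff (a - ?k *\<^sub>W b) 0)) < int (degree (weyl_coeff a 0))"
    have "coeff ?r (degree (weyl_coeff a 0)) = 0" using eq c0(1)[OF b] by simp
    moreover have "degree ?r \<le> degree (weyl_coeff a 0)"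
      using eq by (intro degree_diff_le degree_smult_le[THEN order_trans]) auto
    ultimately have "?r = 0"
      using less by (metis eq_zero_or_degree_less of_nat_less_iff weyl_coeff_diff weyl_coeff_scale
          degree_0 le_neq_implies_less leading_coeff_0_iff)
    moreover have "a - ?k *\<^sub>W b \<in> weyl_adjoin weyl_H"
      using a b commutative_weyl_adjoin[of "weyl_H :: 'a weyl"]
      by (auto simp: commutative_subalgebra_def weyl_subalgebra_def weyl.subspace_diff weyl.subspace_scale)
    ultimately have "a - ?k *\<^sub>W b = 0" using c0(1) by (metis weyl_coeff_diff weyl_coeff_scale)
    then show "a = ?k *\<^sub>W b" by simp
  qed
next
  fix a b :: "'a weyl"
  show "int (degree (weyl_coeff (a + b) 0)) \<le> max (int (degree (weyl_coeff a 0))) (int (degree (weyl_coeff b 0)))"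
    using degree_add_le_max[of "weyl_coeff a 0" "weyl_coeff b 0"] by (simp add: weyl_coeff_add le_max_iff_disj)
qed (simp_all add: commutative_weyl_adjoin)

text \<open>If no element has positive degree for either sign, all supports lie in {0}, so C
  \<subseteq> K[H]; since K[H] is commutative, maximality gives equality.\<close>

theorem maximal_commutative_trichotomy:
  assumes "maximal_commutative_subalgebra C"
  shows "C = weyl_adjoin weyl_H \<or> (\<exists>a\<in>C. a \<noteq> 0 \<and> weyl_sdeg 1 a > 0) \<or>
    (\<exists>a\<in>C. a \<noteq> 0 \<and> weyl_sdeg (-1) a > 0)"
proof (rule disjCI)
  assume "\<not> ((\<exists>a\<in>C. a \<noteq> 0 \<and> weyl_sdeg 1 a > 0) \<or> (\<exists>a\<in>C. a \<noteq> 0 \<and> weyl_sdeg (-1) a > 0))"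
  then have "weyl_support a \<subseteq> {0}" if "a \<in> C" for a
    using that weyl_sdeg_ge[of _ a 1] weyl_sdeg_ge[of _ a "-1"]
    by (cases "a = 0") (force simp: weyl_support_def)+
  then have "C \<subseteq> weyl_adjoin weyl_H" by (auto simp: weyl_adjoin_H_iff)
  then show "C = weyl_adjoin weyl_H"
    using assms commutative_weyl_adjoin[of weyl_H] unfolding maximal_commutative_subalgebra_def by blast
qed

section \<open>Subalgebras with one-dimensional graded pieces\<close>

lemma weyl_scale_const: "k *\<^sub>W 1 = weyl_const k"
  by (simp add: weyl_scale_def)

context degree_subalgebra
begin

lemma subspace: "weyl.subspace C"
  and one_closed: "1 \<in> C"
  and mult_closed: "a \<in> C \<Longrightarrow> b \<in> C \<Longrightarrow> a * b \<in> C"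
  and mult_commute: "a \<in> C \<Longrightarrow> b \<in> C \<Longrightarrow> a * b = b * a"
  using comm by (auto simp: commutative_subalgebra_def weyl_subalgebra_def)

lemmas zero_closed = weyl.subspace_0[OF subspace]
  and add_closed = weyl.subspace_add[OF subspace]
  and diff_closed = weyl.subspace_diff[OF subspace]
  and scale_closed = weyl.subspace_scale[OF subspace]
  and sum_closed = weyl.subspace_sum[OF subspace]

lemmas closed = zero_closed one_closed mult_closed add_closed diff_closed scale_closed

lemma power_closed: "a \<in> C \<Longrightarrow> a ^ n \<in> C"
  by (induction n) (simp_all add: closed)

lemma const_closed: "weyl_const k \<in> C"
  using scale_closed[OF one_closed, of k] by (simp add: weyl_scale_const)

lemma weyl_poly_closed: "a \<in> C \<Longrightarrow> weyl_poly p a \<in> C"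
  unfolding weyl_poly_def by (intro sum_closed scale_closed power_closed)

lemma deg_1: "d 1 = 0"
  using deg_mult[of 1 1] one_closed by simp

lemma deg_const: "k \<noteq> 0 \<Longrightarrow> d (weyl_const k) = 0"
proof -
  assume "k \<noteq> 0"
  then have eq: "weyl_const k * weyl_const (1 / k) = (1 :: 'k weyl)"
    by (simp add: weyl_const_1 flip: weyl_const_mult)
  then have nz: "weyl_const k \<noteq> 0" "weyl_const (1 / k) \<noteq> 0" by auto
  have "d (weyl_const k) + d (weyl_const (1 / k)) = 0"
    using deg_mult[OF const_closed const_closed nz] eq deg_1 by simp
  then show ?thesis
    using deg_nonneg[OF const_closed nz(1)] deg_nonneg[OF const_closed nz(2)] by simp
qed

lemma deg_scale:
  assumes "a \<in> C" "a \<noteq> 0" "k \<noteq> 0"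
  shows "d (k *\<^sub>W a) = d a"
proof -
  have "weyl_const k \<noteq> (0 :: 'k weyl)"
    using assms(3) weyl.scale_eq_0_iff[of k "1 :: 'k weyl"] by (simp add: weyl_scale_const)
  then show ?thesis
    using deg_mult[OF const_closed assms(1) _ assms(2)] deg_const[OF assms(3)]
    by (simp add: weyl_scale_def)
qed

lemma deg_power: "a \<in> C \<Longrightarrow> a \<noteq> 0 \<Longrightarrow> d (a ^ n) = int n * d a"
  by (induction n) (simp_all add: deg_1 deg_mult power_closed algebra_simps)

definition filt :: "int \<Rightarrow> 'k weyl set"
  where "filt n = {c \<in> C. c = 0 \<or> d c \<le> n}"

lemma filtI: "a \<in> C \<Longrightarrow> (a \<noteq> 0 \<Longrightarrow> d a \<le> n) \<Longrightarrow> a \<in> filt n"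
  by (auto simp: filt_def)

lemma filt_closed: "a \<in> filt n \<Longrightarrow> a \<in> C"
  by (simp add: filt_def)

lemma filt_deg: "a \<in> filt n \<Longrightarrow> a \<noteq> 0 \<Longrightarrow> d a \<le> n"
  by (simp add: filt_def)

lemma filt_self: "a \<in> C \<Longrightarrow> a \<in> filt (d a)"
  by (simp add: filt_def)

lemma filt_0 [simp]: "0 \<in> filt n"
  by (simp add: filt_def zero_closed)

lemma filt_mono: "a \<in> filt m \<Longrightarrow> m \<le> n \<Longrightarrow> a \<in> filt n"
  by (auto simp: filt_def)

lemma filt_add:
  assumes "a \<in> filt n" "b \<in> filt n" shows "a + b \<in> filt n"
proof (cases "a = 0 \<or> b = 0")
  case False
  then show ?thesis
    using assms deg_add[of a b] filt_deg[of a n] filt_deg[of b n]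
    by (intro filtI) (auto simp: filt_closed add_closed intro: order_trans)
qed (use assms in auto)

lemma filt_scale: "a \<in> filt n \<Longrightarrow> k *\<^sub>W a \<in> filt n"
  using deg_scale[of a k] filt_deg[of a n] filt_closed[of a n]
  by (intro filtI scale_closed) auto

lemma filt_diff: "a \<in> filt n \<Longrightarrow> b \<in> filt n \<Longrightarrow> a - b \<in> filt n"
  using filt_add[of a n "(-1) *\<^sub>W b"] filt_scale[of b n "-1"] by simp

lemma filt_mult: "a \<in> filt m \<Longrightarrow> b \<in> filt n \<Longrightarrow> a * b \<in> filt (m + n)"
  using deg_mult[of a b] filt_deg[of a m] filt_closed[of a m] filt_deg[of b n] filt_closed[of b n]
  by (intro filtI mult_closed) auto

lemma filt_sum: "(\<And>i. i \<in> I \<Longrightarrow> f i \<in> filt n) \<Longrightarrow> (\<Sum>i\<in>I. f i) \<in> filt n"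
  by (induction I rule: infinite_finite_induct) (simp_all add: filt_add)

lemma filt_less: "a \<in> filt n \<Longrightarrow> n < d a \<Longrightarrow> a = 0"
  by (auto simp: filt_def)

lemma lead_nonzero:
  assumes "a \<in> C" "b \<in> C" "a \<noteq> 0" "b \<noteq> 0" "d a = d b"
  obtains k where "k \<noteq> 0" "a - k *\<^sub>W b \<in> filt (d a - 1)"
proof -
  obtain k where k: "a = k *\<^sub>W b \<or> d (a - k *\<^sub>W b) < d a"
    using deg_lead[OF assms] by blast
  have "k \<noteq> 0" using k assms by auto
  moreover have "a - k *\<^sub>W b \<in> filt (d a - 1)" using k assms by (auto simp: filt_def closed)
  ultimately show ?thesis using that by blast
qed

lemma deg_add_lower:
  assumes "a \<in> C" "a \<noteq> 0" "b \<in> filt (d a - 1)"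
  shows "a + b \<noteq> 0" "d (a + b) = d a"
proof -
  have b: "b \<in> C" using assms by (simp add: filt_closed)
  have "\<not> a + b \<in> filt (d a - 1)"
  proof
    assume "a + b \<in> filt (d a - 1)"
    then have "a + b - b \<in> filt (d a - 1)" using assms(3) by (rule filt_diff)
    then show False using filt_less[of a "d a - 1"] assms by simp
  qed
  moreover have "a + b \<in> filt (d a)"
    using assms by (intro filt_add filt_self filt_mono[OF assms(3)]) auto
  ultimately show "a + b \<noteq> 0" "d (a + b) = d a" by (auto simp: filt_def)
qed

text \<open>Up to lower degree \<open>a\<close> is a scalar multiple of 1, and there are no nonzero
  elements of negative degree.\<close>

lemma deg_eq_0_imp_const:
  assumes "a \<in> C" "a \<noteq> 0" "d a = 0"
  shows "a \<in> range weyl_const"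
proof -
  obtain k where "a - k *\<^sub>W 1 \<in> filt (-1)"
    using lead_nonzero[of a 1] assms one_closed deg_1 by auto
  then have "a - k *\<^sub>W 1 = 0" using deg_nonneg by (force simp: filt_def)
  then show ?thesis by (simp add: weyl_scale_const)
qed

lemma deg_pos_iff:
  assumes "a \<in> C"
  shows "a \<noteq> 0 \<and> d a > 0 \<longleftrightarrow> a \<notin> range weyl_const"
proof
  assume a: "a \<noteq> 0 \<and> d a > 0"
  show "a \<notin> range weyl_const"
  proof
    assume "a \<in> range weyl_const"
    then obtain k where "a = weyl_const k" by blast
    then show False using a deg_const[of k] by (cases "k = 0") simp_all
  qed
next
  assume "a \<notin> range weyl_const"
  then have "a \<noteq> 0" using rangeI[of weyl_const 0] by (metis weyl_const_0)
  moreover from this have "d a \<noteq> 0" using \<open>a \<notin> range weyl_const\<close> deg_eq_0_imp_const[OF assms] by blast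
  ultimately show "a \<noteq> 0 \<and> d a > 0" using deg_nonneg[OF assms] by force
qed

text \<open>The powers of \<open>a\<close> have strictly increasing degrees, so the top term
  dominates.\<close>

lemma weyl_poly_nonzero:
  assumes "a \<in> C" "a \<noteq> 0" "d a > 0" "p \<noteq> 0"
  shows "weyl_poly p a \<noteq> 0"
proof (cases "degree p")
  case 0
  then obtain k where "p = [:k:]" "k \<noteq> 0" using assms(4) by (auto elim: degree_eq_zeroE)
  then show ?thesis
    using weyl.scale_eq_0_iff[of k "1 :: 'k weyl"] by (simp add: weyl_poly_pCons weyl_scale_const)
next
  case (Suc n)
  let ?h = "lead_coeff p *\<^sub>W a ^ Suc n"
  have h: "?h \<in> C" "?h \<noteq> 0" "d ?h = int (Suc n) * d a"
    using assms by (simp_all add: closed power_closed deg_scale deg_power del: power_Suc of_nat_Suc)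
  have "(\<Sum>i\<le>n. coeff p i *\<^sub>W a ^ i) \<in> filt (d ?h - 1)"
  proof (rule filt_sum, rule filt_scale)
    fix i assume "i \<in> {..n}"
    then have "int i * d a < int (Suc n) * d a" using assms by simp
    then show "a ^ i \<in> filt (d ?h - 1)"
      using assms unfolding h(3) by (simp add: filt_def power_closed deg_power)
  qed
  from deg_add_lower(1)[OF h(1,2) this] show ?thesis
    by (simp add: weyl_poly_def Suc add.commute)
qed

lemma transcendental: "a \<in> C \<Longrightarrow> a \<noteq> 0 \<Longrightarrow> d a > 0 \<Longrightarrow> weyl_transcendental a"
  unfolding weyl_transcendental_def
proof (rule injI)
  fix p q assume a: "a \<in> C" "a \<noteq> 0" "d a > 0" and eq: "weyl_poly p a = weyl_poly q a"
  have "weyl_poly (p - q) a + weyl_poly q a = weyl_poly p a" by (simp flip: weyl_poly_add)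
  then show "p = q" using weyl_poly_nonzero[OF a, of "p - q"] eq by auto
qed

text \<open>The unique term of largest degree cannot be cancelled by the others.\<close>

lemma sum_distinct_degrees_nonzero:
  assumes "finite I" "I \<noteq> {}" "\<And>i. i \<in> I \<Longrightarrow> f i \<in> C \<and> f i \<noteq> 0" "inj_on (\<lambda>i. d (f i)) I"
  shows "(\<Sum>i\<in>I. f i) \<noteq> 0"
proof -
  have "Max ((\<lambda>i. d (f i)) ` I) \<in> (\<lambda>i. d (f i)) ` I" using assms by (intro Max_in) auto
  then obtain j where j: "j \<in> I" "Max ((\<lambda>i. d (f i)) ` I) = d (f j)" by blast
  have "(\<Sum>i\<in>I - {j}. f i) \<in> filt (d (f j) - 1)"
  proof (rule filt_sum)
    fix i assume i: "i \<in> I - {j}"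
    have "d (f i) \<le> d (f j)" using i assms(1) by (auto simp flip: j(2))
    moreover have "d (f i) \<noteq> d (f j)" using i j(1) assms(4) by (auto dest: inj_onD)
    ultimately show "f i \<in> filt (d (f j) - 1)" using assms(3) i by (simp add: filt_def)
  qed
  from deg_add_lower(1)[OF _ _ this] show ?thesis
    using assms j(1) by (simp add: sum.remove)
qed

end

section \<open>Nonzero derivations and their degree shift\<close>

locale degree_derivation = degree_subalgebra C d
  for C :: "'k::field_char_0 weyl set" and d :: "'k weyl \<Rightarrow> int" +
  fixes \<delta> :: "'k weyl \<Rightarrow> 'k weyl"
  assumes deriv: "\<delta> \<in> derivations C" and nontrivial: "\<exists>c\<in>C. \<delta> c \<noteq> 0"
begin

lemma deriv_closed: "a \<in> C \<Longrightarrow> \<delta> a \<in> C"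
  and deriv_add: "a \<in> C \<Longrightarrow> b \<in> C \<Longrightarrow> \<delta> (a + b) = \<delta> a + \<delta> b"
  and deriv_scale: "a \<in> C \<Longrightarrow> \<delta> (k *\<^sub>W a) = k *\<^sub>W \<delta> a"
  and deriv_mult: "a \<in> C \<Longrightarrow> b \<in> C \<Longrightarrow> \<delta> (a * b) = \<delta> a * b + a * \<delta> b"
  using deriv by (auto simp: derivations_def)

lemma deriv_0: "\<delta> 0 = 0"
  using deriv_scale[of 0 0] zero_closed by simp

lemma deriv_1: "\<delta> 1 = 0"
  using deriv_mult[of 1 1] one_closed by simp

lemma deriv_const: "\<delta> (weyl_const k) = 0"
  using deriv_scale[OF one_closed, of k] by (simp add: weyl_scale_const deriv_1)

lemma deriv_diff: "a \<in> C \<Longrightarrow> b \<in> C \<Longrightarrow> \<delta> (a - b) = \<delta> a - \<delta> b"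
  by (metis deriv_add diff_closed diff_add_cancel add_diff_cancel_right')

lemma deriv_sum: "(\<And>i. i \<in> I \<Longrightarrow> f i \<in> C) \<Longrightarrow> \<delta> (\<Sum>i\<in>I. f i) = (\<Sum>i\<in>I. \<delta> (f i))"
  by (induction I rule: infinite_finite_induct) (simp_all add: deriv_0 deriv_add sum_closed)

lemma deriv_power:
  assumes "a \<in> C"
  shows "\<delta> (a ^ n) = of_nat n *\<^sub>W (a ^ (n - 1) * \<delta> a)"
proof (induction n)
  case (Suc n)
  have "\<delta> (a ^ Suc n) = a ^ n * \<delta> a + a * of_nat n *\<^sub>W (a ^ (n - 1) * \<delta> a)"
    using assms by (simp add: deriv_mult power_closed Suc mult_commute deriv_closed)
  also have "a * of_nat n *\<^sub>W (a ^ (n - 1) * \<delta> a) = of_nat n *\<^sub>W (a ^ n * \<delta> a)"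
    by (cases n) (simp_all add: weyl_scale_mult_right mult.assoc del: of_nat_Suc)
  also have "a ^ n * \<delta> a + of_nat n *\<^sub>W (a ^ n * \<delta> a) = of_nat (Suc n) *\<^sub>W (a ^ n * \<delta> a)"
    by (simp add: weyl.scale_left_distrib)
  finally show ?case by simp
qed (simp add: deriv_1)

lemma deriv_weyl_poly:
  assumes "a \<in> C"
  shows "\<delta> (weyl_poly p a) = weyl_poly (pderiv p) a * \<delta> a"
proof (induction p)
  case (pCons c p)
  have "\<delta> (weyl_poly (pCons c p) a) = \<delta> a * weyl_poly p a + a * (weyl_poly (pderiv p) a * \<delta> a)"
    using assms by (simp add: weyl_poly_pCons deriv_add deriv_mult deriv_const weyl_poly_closed
        mult_closed const_closed pCons.IH)
  also have "\<delta> a * weyl_poly p a = weyl_poly p a * \<delta> a"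
    using assms by (simp add: mult_commute weyl_poly_closed deriv_closed)
  finally show ?case
    by (simp add: pderiv_pCons weyl_poly_add weyl_poly_pCons distrib_right mult.assoc)
qed (simp add: deriv_0)

lemma nonconst: "a \<in> C \<Longrightarrow> \<delta> a \<noteq> 0 \<Longrightarrow> a \<noteq> 0 \<and> d a > 0"
  by (auto simp: deg_pos_iff deriv_const)

text \<open>Only finitely many degrees \<open>n\<close> of elements of \<open>C\<close> have the property that \<open>n - d a\<close> is not a
  degree; an element of any other degree is a product with \<open>a\<close> up to lower terms.\<close>

lemma deriv_filt_bounded: "\<exists>M. \<forall>n. \<forall>c\<in>filt n. \<delta> c \<in> filt (n + M)"
proof -
  obtain a where a: "a \<in> C" "\<delta> a \<noteq> 0" using nontrivial by blast
  define p where "p = d a"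
  have p: "p > 0" "a \<noteq> 0" using nonconst[OF a] by (auto simp: p_def)
  define S where "S = d ` (C - {0})"
  \<comment> \<open>\<open>X\<close> is the Apery set of the semigroup of degrees with respect to
    \<open>p\<close>: it contains at most one element of each residue class modulo \<open>p\<close>,
    hence is finite.\<close>
  define X where "X = {n \<in> S. n - p \<notin> S}"
  have S_add: "n + int j * p \<in> S" if "n \<in> S" for n j
  proof -
    from that obtain b where "b \<in> C" "b \<noteq> 0" "n = d b" by (auto simp: S_def)
    then have "n + int j * p = d (b * a ^ j)" "b * a ^ j \<in> C - {0}"
      using a p by (simp_all add: deg_mult power_closed deg_power p_def mult_closed)
    then show ?thesis unfolding S_def by blast
  qed
  have X_less: "m \<notin> X" if "n \<in> S" "n < m" "n mod p = m mod p" for m n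
  proof -
    have "p dvd m - n" using that(3) by (metis mod_eq_dvd_iff)
    then obtain q where q: "m - n = p * q" by blast
    then have "p * q > 0" using that(2) by linarith
    then have "q > 0" using p(1) by (simp add: zero_less_mult_iff)
    have "n + int (nat (q - 1)) * p \<in> S" using that(1) by (rule S_add)
    moreover have "n + int (nat (q - 1)) * p = m - p" using q \<open>q > 0\<close> by (simp add: algebra_simps)
    ultimately show ?thesis by (simp add: X_def)
  qed
  have "inj_on (\<lambda>n. n mod p) X"
  proof (rule inj_onI)
    fix m n assume "m \<in> X" "n \<in> X" "m mod p = n mod p"
    then show "m = n" using X_less[of m n] X_less[of n m] by (cases m n rule: linorder_cases) (auto simp: X_def)
  qed
  moreover have "(\<lambda>n. n mod p) ` X \<subseteq> {0..<p}" using p by auto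
  ultimately have finX: "finite X" by (rule inj_on_finite) simp
  have "\<forall>n\<in>S. \<exists>b. b \<in> C \<and> b \<noteq> 0 \<and> d b = n" by (auto simp: S_def)
  then obtain r where r: "\<And>n. n \<in> S \<Longrightarrow> r n \<in> C \<and> r n \<noteq> 0 \<and> d (r n) = n" by metis
  \<comment> \<open>\<open>M\<close> is chosen to work for \<open>a\<close> and for one
    representative of each degree in \<open>X\<close>. Where the derivation kills a representative
    the entry is arbitrary but harmless, as \<open>filt\<close> always contains 0.\<close>
  define M where "M = Max (insert (d (\<delta> a) - p) ((\<lambda>n. d (\<delta> (r n)) - n) ` X))"
  have "d (\<delta> a) - p \<le> M" unfolding M_def using finX by (intro Max_ge) auto
  then have Ma: "\<delta> a \<in> filt (p + M)" using a by (simp add: filt_def deriv_closed)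
  have Mr: "\<delta> (r n) \<in> filt (n + M)" if "n \<in> X" for n
  proof -
    have "d (\<delta> (r n)) - n \<le> M" unfolding M_def using finX that by (intro Max_ge) auto
    then show ?thesis using r[of n] that by (simp add: filt_def deriv_closed X_def)
  qed
  have main: "\<delta> c \<in> filt (d c + M)" if "c \<in> C" "c \<noteq> 0" for c
    using that
  proof (induction "nat (d c)" arbitrary: c rule: less_induct)
    case less
    have IH: "\<delta> e \<in> filt (n + M)" if "e \<in> filt n" "n < d c" for e n
    proof (cases "e = 0")
      case False
      then have e: "e \<in> C" "d e \<le> n" using that by (auto simp: filt_def)
      then have "nat (d e) < nat (d c)" using deg_nonneg[of e] False that(2) by simp
      from less.hyps[OF this e(1) False] show ?thesis by (rule filt_mono) (use e in simp)
    qed (simp add: deriv_0)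
    \<comment> \<open>It suffices to bound one element \<open>b\<close> of the same degree:
      \<open>c\<close> differs from a multiple of \<open>b\<close> by an element of lower degree,
      which the induction covers.\<close>
    have via: "\<delta> c \<in> filt (d c + M)"
      if b: "b \<in> C" "b \<noteq> 0" "d b = d c" and db: "\<delta> b \<in> filt (d c + M)" for b
    proof -
      obtain k where k: "c - k *\<^sub>W b \<in> filt (d c - 1)"
        using lead_nonzero[OF less.prems(1) b(1) less.prems(2) b(2)] b(3) by metis
      have "\<delta> c = k *\<^sub>W \<delta> b + \<delta> (c - k *\<^sub>W b)"
        using less.prems b by (simp add: deriv_diff deriv_scale closed)
      moreover have "\<delta> (c - k *\<^sub>W b) \<in> filt (d c + M)"
        using IH[OF k] by (rule filt_mono) simp_all
      ultimately show ?thesis using db by (simp add: filt_add filt_scale)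
    qed
    have dc: "d c \<in> S" using less.prems by (auto simp: S_def)
    show ?case
    proof (cases "d c \<in> X")
      case True
      then show ?thesis using via[of "r (d c)"] r[OF dc] Mr by blast
    next
      case False
      then have "d c - p \<in> S" using dc by (simp add: X_def)
      then obtain b where "b \<in> C - {0}" "d c - p = d b" unfolding S_def by blast
      then have b: "b \<in> C" "b \<noteq> 0" "d b = d c - p" by auto
      have "\<delta> a * b \<in> filt (p + M + (d c - p))" by (rule filt_mult) (use Ma b in \<open>auto simp: filt_def\<close>)
      moreover have "a * \<delta> b \<in> filt (p + (d c - p + M))"
        using filt_self[OF a(1)] IH[OF filt_self[OF b(1)]] b p
        by (intro filt_mult) (simp_all add: p_def)
      ultimately have "\<delta> (a * b) \<in> filt (d c + M)"
        using a b by (simp add: deriv_mult filt_add add.commute)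
      then show ?thesis
        using via[of "a * b"] a b p by (simp add: mult_closed deg_mult p_def)
    qed
  qed
  show ?thesis
  proof (intro exI allI ballI)
    fix n c assume c: "c \<in> filt n"
    show "\<delta> c \<in> filt (n + M)"
    proof (cases "c = 0")
      case False
      show ?thesis
        by (rule filt_mono[OF main[OF filt_closed[OF c] False]]) (use filt_deg[OF c False] in simp)
    qed (simp add: deriv_0)
  qed
qed

text \<open>Any two nonscalar elements have proportional powers up to lower terms, so the largest shift of
  the degree is attained everywhere.\<close>

lemma deriv_degree_shift:
  obtains M where "\<And>y. y \<in> C \<Longrightarrow> y \<noteq> 0 \<Longrightarrow> d y > 0 \<Longrightarrow> \<delta> y \<noteq> 0 \<and> d (\<delta> y) = d y + M"
    and "\<And>n c. c \<in> filt n \<Longrightarrow> \<delta> c \<in> filt (n + M)"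
proof -
  obtain M0 where M0: "\<And>n c. c \<in> filt n \<Longrightarrow> \<delta> c \<in> filt (n + M0)"
    using deriv_filt_bounded by blast
  have le: "d (\<delta> c) - d c \<le> M0" if "c \<in> C \<and> \<delta> c \<noteq> 0" for c
    using M0[OF filt_self, of c] that by (simp add: filt_def)
  \<comment> \<open>The shifts are bounded above by \<open>M0\<close>, so minimising the natural
    number \<open>M0\<close> minus the shift yields an element of maximal shift.\<close>
  obtain x where x: "x \<in> C" "\<delta> x \<noteq> 0"
    and max: "\<And>y. y \<in> C \<and> \<delta> y \<noteq> 0 \<Longrightarrow> nat (M0 - (d (\<delta> x) - d x)) \<le> nat (M0 - (d (\<delta> y) - d y))"
    using nontrivial ex_has_least_nat[of "\<lambda>y. y \<in> C \<and> \<delta> y \<noteq> 0" _ "\<lambda>y. nat (M0 - (d (\<delta> y) - d y))"]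
    by blast
  define M where "M = d (\<delta> x) - d x"
  have max: "d (\<delta> y) - d y \<le> M" if "y \<in> C \<and> \<delta> y \<noteq> 0" for y
    using max[OF that] le[OF that] le[of x] x unfolding M_def by linarith
  have shift: "\<delta> c \<in> filt (n + M)" if "c \<in> filt n" for c n
    using that
  proof (intro filtI)
    assume "\<delta> c \<noteq> 0"
    then show "d (\<delta> c) \<le> n + M"
      using max[of c] filt_closed[OF that] filt_deg[OF that] deriv_0 by force
  qed (simp add: filt_closed deriv_closed)
  have "\<delta> y \<noteq> 0 \<and> d (\<delta> y) = d y + M" if y: "y \<in> C" "y \<noteq> 0" "d y > 0" for y
  proof -
    have x': "x \<noteq> 0" "d x > 0" using nonconst x by auto
    define p q where "p = nat (d x)" and "q = nat (d y)"
    have pq: "d x = int p" "d y = int q" "p > 0" "q > 0" using x' y by (auto simp: p_def q_def)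
    let ?N = "int p * int q"
    have dxy: "d (x ^ q) = ?N" "d (y ^ p) = ?N" using x x' y pq by (simp_all add: deg_power mult.commute)
    \<comment> \<open>Both powers have degree p q. Since no shift exceeds \<open>M\<close>, the
      lower terms of y^p cannot disturb the leading term of \<delta> (y^p), which therefore comes
      from x^q.\<close>
    obtain k where k: "k \<noteq> 0" "y ^ p - k *\<^sub>W x ^ q \<in> filt (?N - 1)"
      using lead_nonzero[of "y ^ p" "x ^ q"] x x' y dxy by (metis power_closed power_not_zero)
    have dx: "\<delta> (x ^ q) \<noteq> 0 \<and> d (\<delta> (x ^ q)) = ?N + M"
    proof -
      have "x ^ (q - 1) * \<delta> x \<noteq> 0" "x ^ (q - 1) * \<delta> x \<in> C"
        using x x' by (simp_all add: power_closed mult_closed deriv_closed)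
      moreover have "d (x ^ (q - 1) * \<delta> x) = ?N + M"
      proof -
        have "d (x ^ (q - 1) * \<delta> x) = int (q - 1) * d x + d (\<delta> x)"
          using x x' by (simp add: power_closed deg_mult deg_power deriv_closed)
        also have "int (q - 1) = int q - 1" using pq by simp
        finally show ?thesis using pq by (simp add: M_def left_diff_distrib right_diff_distrib mult.commute)
      qed
      ultimately show ?thesis using pq x by (simp add: deriv_power deg_scale)
    qed
    have "\<delta> (y ^ p) = k *\<^sub>W \<delta> (x ^ q) + \<delta> (y ^ p - k *\<^sub>W x ^ q)"
      using x y by (simp add: deriv_diff deriv_scale power_closed closed)
    moreover have "\<delta> (y ^ p - k *\<^sub>W x ^ q) \<in> filt (d (k *\<^sub>W \<delta> (x ^ q)) - 1)"
      using shift[OF k(2)] dx k(1) x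
      by (simp add: deg_scale deriv_closed power_closed algebra_simps)
    ultimately have "\<delta> (y ^ p) \<noteq> 0" "d (\<delta> (y ^ p)) = ?N + M"
      using deg_add_lower[of "k *\<^sub>W \<delta> (x ^ q)" "\<delta> (y ^ p - k *\<^sub>W x ^ q)"] dx k(1) x
      by (simp_all add: deg_scale deriv_closed power_closed scale_closed)
    moreover have "\<delta> (y ^ p) = of_nat p *\<^sub>W (y ^ (p - 1) * \<delta> y)" using y by (simp add: deriv_power)
    ultimately have dy: "\<delta> y \<noteq> 0" "d (of_nat p *\<^sub>W (y ^ (p - 1) * \<delta> y)) = ?N + M" by auto
    have "d (of_nat p *\<^sub>W (y ^ (p - 1) * \<delta> y)) = int (p - 1) * d y + d (\<delta> y)"
      using y pq dy by (simp add: deg_scale deg_mult deg_power deriv_closed power_closed mult_closed)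
    also have "int (p - 1) = int p - 1" using pq by simp
    finally show ?thesis using dy pq by (simp add: left_diff_distrib)
  qed
  with shift show ?thesis using that by blast
qed

text \<open>A nonscalar element has positive degree, and there the degree shift includes that the
  derivative is nonzero.\<close>

lemma ker_eq: "ker_on C \<delta> = range weyl_const"
proof (rule deriv_degree_shift)
  fix M assume "\<And>y. y \<in> C \<Longrightarrow> y \<noteq> 0 \<Longrightarrow> d y > 0 \<Longrightarrow> \<delta> y \<noteq> 0 \<and> d (\<delta> y) = d y + M"
  then show ?thesis using deg_pos_iff by (auto simp: ker_on_def const_closed deriv_const)
qed

lemma funpow_deriv_closed: "a \<in> C \<Longrightarrow> (\<delta> ^^ n) a \<in> C"
  by (induction n) (simp_all add: deriv_closed)

section \<open>Slices and local nilpotency\<close>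

text \<open>Take the least m such that the m-th iterate kills \<open>c\<close>; then m \<ge> 2. The
  iterate u of order m - 2 has a nonzero derivative lying in the kernel, hence a nonzero scalar k,
  and u / k is a slice.\<close>

lemma slice_exists:
  assumes "c \<in> C" "\<delta> c \<noteq> 0" "(\<delta> ^^ n) c = 0"
  obtains t where "t \<in> C" "\<delta> t = 1"
proof -
  define m where "m = (LEAST m. (\<delta> ^^ m) c = 0)"
  have m: "(\<delta> ^^ m) c = 0" unfolding m_def using assms(3) by (rule LeastI)
  have m': "(\<delta> ^^ l) c \<noteq> 0" if "l < m" for l using that not_less_Least unfolding m_def by blast
  have "m \<noteq> 0" using m assms deriv_0 by (cases "m = 0") auto
  moreover have "m \<noteq> 1" using m assms by (cases "m = 1") auto
  ultimately obtain l where l: "m = Suc (Suc l)" by (metis One_nat_def not0_implies_Suc)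
  let ?u = "(\<delta> ^^ l) c"
  have "\<delta> ?u \<in> ker_on C \<delta>" using m assms by (simp add: l ker_on_def deriv_closed funpow_deriv_closed)
  then obtain k where k: "\<delta> ?u = weyl_const k" by (auto simp: ker_eq)
  have "k \<noteq> 0" using m'[of "Suc l"] k by (auto simp: l)
  then have "\<delta> ((1 / k) *\<^sub>W ?u) = 1"
    using assms k by (simp add: deriv_scale funpow_deriv_closed weyl_const_1 flip: weyl_scale_const)
  then show ?thesis by (rule that[rotated]) (simp add: assms scale_closed funpow_deriv_closed)
qed

text \<open>Since 1 has degree 0, the common shift is minus the degree of \<open>t\<close>. Thus
  each application strictly lowers the degree until a scalar is reached.\<close>

lemma slice_nilpotent:
  assumes "t \<in> C" "\<delta> t = 1" "c \<in> C"
  shows "\<exists>n\<ge>1. (\<delta> ^^ n) c = 0"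
proof (rule deriv_degree_shift)
  fix M assume M: "\<And>y. y \<in> C \<Longrightarrow> y \<noteq> 0 \<Longrightarrow> d y > 0 \<Longrightarrow> \<delta> y \<noteq> 0 \<and> d (\<delta> y) = d y + M"
  have t: "t \<noteq> 0" "d t > 0" using nonconst assms by auto
  then have "M < 0" using M[OF assms(1)] assms(2) deg_1 by simp
  show ?thesis
    using assms(3)
  proof (induction "nat (d c)" arbitrary: c rule: less_induct)
    case less
    show ?case
    proof (cases "c \<in> range weyl_const")
      case True
      then show ?thesis by (intro exI[of _ 1]) (auto simp: deriv_const)
    next
      case False
      then have "\<delta> c \<noteq> 0 \<and> d (\<delta> c) = d c + M" using M less.prems by (simp flip: deg_pos_iff)
      then have "nat (d (\<delta> c)) < nat (d c)"
        using \<open>M < 0\<close> False deg_pos_iff[OF less.prems] by auto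
      from less.hyps[OF this] obtain n where "(\<delta> ^^ n) (\<delta> c) = 0"
        using less.prems by (auto simp: deriv_closed)
      then show ?thesis by (intro exI[of _ "Suc n"]) (simp add: funpow_swap1)
    qed
  qed
qed

text \<open>Integration: by induction on the order of nilpotency \<delta> c is a polynomial q(t),
  and c differs from Q(t), where Q' = q, by an element of the kernel, that is, by a scalar.\<close>

lemma slice_adjoin:
  assumes "t \<in> C" "\<delta> t = 1"
  shows "C = weyl_adjoin t"
proof
  \<comment> \<open>Antiderivatives exist in characteristic zero; the leading monomial is integrated
    and the degree drops.\<close>
  have prim: "\<exists>Q. pderiv Q = q" for q :: "'k poly"
  proof (induction q rule: measure_induct_rule[of degree])
    case (less q)
    let ?c = "lead_coeff q" and ?n = "degree q"
    define Q where "Q = monom (?c / of_nat (Suc ?n)) (Suc ?n)"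
    have Q: "pderiv Q = monom ?c ?n" by (simp add: Q_def pderiv_monom del: of_nat_Suc)
    show ?case
    proof (cases "?n = 0")
      case True
      then have "pderiv Q = q" using Q by (auto elim!: degree_eq_zeroE simp: monom_0)
      then show ?thesis by blast
    next
      case False
      have "degree (q - monom ?c ?n) \<le> ?n" by (intro degree_diff_le) (auto simp: degree_monom_le)
      moreover have "coeff (q - monom ?c ?n) ?n = 0" by simp
      ultimately have "degree (q - monom ?c ?n) < ?n"
        using False eq_zero_or_degree_less[of "q - monom ?c ?n" ?n] by auto
      from less[OF this] obtain R where "pderiv R = q - monom ?c ?n" by blast
      then have "pderiv (R + Q) = q" using Q by (simp add: pderiv_add)
      then show ?thesis by blast
    qed
  qed
  have "c \<in> weyl_adjoin t" if "c \<in> C" "(\<delta> ^^ n) c = 0" for n c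
    using that
  proof (induction n arbitrary: c)
    case 0
    then show ?case using rangeI[of "\<lambda>p. weyl_poly p t" 0] by (simp add: weyl_adjoin_def)
  next
    case (Suc n)
    have "\<delta> c \<in> weyl_adjoin t"
      using Suc.prems by (intro Suc.IH) (simp_all add: deriv_closed funpow_swap1)
    then obtain q where q: "\<delta> c = weyl_poly q t" by (auto simp: weyl_adjoin_def)
    obtain Q where Q: "pderiv Q = q" using prim by blast
    have "c - weyl_poly Q t \<in> ker_on C \<delta>"
      using Suc.prems assms q Q
      by (simp add: ker_on_def deriv_diff weyl_poly_closed diff_closed deriv_weyl_poly)
    then obtain k where "c - weyl_poly Q t = weyl_const k" by (auto simp: ker_eq)
    then have "c = weyl_poly (Q + [:k:]) t"
      by (simp add: weyl_poly_add weyl_poly_pCons diff_eq_eq add.commute)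
    then show ?case by (auto simp: weyl_adjoin_def)
  qed
  then show "C \<subseteq> weyl_adjoin t" using slice_nilpotent[OF assms] by blast
  show "weyl_adjoin t \<subseteq> C" using assms by (auto simp: weyl_adjoin_def weyl_poly_closed)
qed

lemma locally_nilpotent_iff_slice: "locally_nilpotent_on C \<delta> \<longleftrightarrow> (\<exists>t\<in>C. \<delta> t = 1)"
proof
  assume *: "locally_nilpotent_on C \<delta>"
  obtain c where c: "c \<in> C" "\<delta> c \<noteq> 0" using nontrivial by blast
  have "c \<in> (\<Union>n\<in>{1..}. ker_on C (\<delta> ^^ n))" using * c unfolding locally_nilpotent_on_def by simp
  then obtain n where "(\<delta> ^^ n) c = 0" by (auto simp: ker_on_def)
  then show "\<exists>t\<in>C. \<delta> t = 1" using slice_exists[OF c] by blast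
next
  assume "\<exists>t\<in>C. \<delta> t = 1"
  then show "locally_nilpotent_on C \<delta>"
    unfolding locally_nilpotent_on_def using slice_nilpotent by (force simp: ker_on_def)
qed

text \<open>A slice serves as \<open>c\<close> with n = 2, since the derivation kills 1; conversely
  such a \<open>c\<close> produces a slice.\<close>

lemma locally_nilpotent_iff_element:
  "locally_nilpotent_on C \<delta> \<longleftrightarrow> (\<exists>c\<in>C - ker_on C \<delta>. \<exists>n\<ge>2. (\<delta> ^^ n) c = 0)"
  unfolding locally_nilpotent_iff_slice
proof
  assume "\<exists>t\<in>C. \<delta> t = 1"
  then show "\<exists>c\<in>C - ker_on C \<delta>. \<exists>n\<ge>2. (\<delta> ^^ n) c = 0"
    by (force simp: ker_on_def deriv_1 numeral_2_eq_2)
qed (auto simp: ker_on_def elim: slice_exists)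

lemma locally_nilpotent_iff_normal_form: "locally_nilpotent_on C \<delta> \<longleftrightarrow> lnd_normal_form C \<delta>"
  unfolding locally_nilpotent_iff_slice
proof
  assume "\<exists>t\<in>C. \<delta> t = 1"
  then obtain t where t: "t \<in> C" "\<delta> t = 1" by blast
  then show "lnd_normal_form C \<delta>"
    unfolding lnd_normal_form_def
    using transcendental[of t] nonconst[of t] slice_adjoin[of t] by (intro bexI[of _ t]) (simp_all add: deriv_weyl_poly)
next
  assume "lnd_normal_form C \<delta>"
  then obtain t where t: "t \<in> C" "\<And>p. \<delta> (weyl_poly p t) = weyl_poly (pderiv p) t"
    unfolding lnd_normal_form_def by blast
  from t(2)[of "[:0, 1:]"] have "\<delta> t = 1"
    by (simp add: weyl_poly_pCons weyl_const_1 pderiv_pCons)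
  then show "\<exists>t\<in>C. \<delta> t = 1" using t(1) by blast
qed

end

section \<open>Semisimple derivations\<close>

text \<open>The derivation is triangular for the degree filtration with diagonal entry r n in degree
  n. As \<open>r\<close> is nonzero and the characteristic is zero, these entries are
  distinct.\<close>

locale diagonal_derivation = degree_derivation C d \<delta>
  for C :: "'k::field_char_0 weyl set" and d \<delta> +
  fixes r :: 'k
  assumes r_nonzero: "r \<noteq> 0"
    and deriv_lead: "\<And>y. y \<in> C \<Longrightarrow> y \<noteq> 0 \<Longrightarrow> \<delta> y - (r * of_int (d y)) *\<^sub>W y \<in> filt (d y - 1)"

text \<open>The eigenvector \<open>c\<close> keeps its degree, so the common shift is 0. If c and y
  have degrees p and q, then y^p agrees with a multiple of c^q up to lower terms, and computing the
  diagonal entry at y^p in both ways yields p \<nu> = q \<mu>.\<close>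

lemma (in degree_derivation) diagonal_derivationI:
  assumes c: "c \<in> C" "c \<noteq> 0" "\<mu> \<noteq> 0" "\<delta> c = \<mu> *\<^sub>W c"
  shows "d c > 0" "diagonal_derivation C d \<delta> (\<mu> / of_int (d c))"
proof -
  have "\<delta> c \<noteq> 0" using c by simp
  then show dc: "d c > 0" using nonconst[OF c(1)] by blast
  obtain M where M: "\<And>y. y \<in> C \<Longrightarrow> y \<noteq> 0 \<Longrightarrow> d y > 0 \<Longrightarrow> \<delta> y \<noteq> 0 \<and> d (\<delta> y) = d y + M"
    and shift: "\<And>n c. c \<in> filt n \<Longrightarrow> \<delta> c \<in> filt (n + M)"
    using deriv_degree_shift by blast
  have "M = 0" using M[OF c(1,2) dc] c by (simp add: deg_scale)
  show "diagonal_derivation C d \<delta> (\<mu> / of_int (d c))"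
  proof
    show "\<mu> / of_int (d c) \<noteq> 0" using c dc by simp
    fix y assume y: "y \<in> C" "y \<noteq> 0"
    show "\<delta> y - (\<mu> / of_int (d c) * of_int (d y)) *\<^sub>W y \<in> filt (d y - 1)"
    proof (cases "d y = 0")
      case True
      then obtain k where "y = weyl_const k" using deg_eq_0_imp_const[OF y] by blast
      then show ?thesis using True by (simp add: deriv_const)
    next
      case False
      then have dy: "d y > 0" using deg_nonneg[OF y] by simp
      define p q where "p = nat (d c)" and "q = nat (d y)"
      have pq: "d c = int p" "d y = int q" "p > 0" "q > 0" using dc dy by (auto simp: p_def q_def)
      let ?N = "int p * int q" and ?z = "y ^ p"
      have dcy: "d (c ^ q) = ?N" "d ?z = ?N" using c y pq by (simp_all add: deg_power mult.commute)
      obtain k where k: "?z - k *\<^sub>W c ^ q \<in> filt (?N - 1)"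
        using lead_nonzero[of ?z "c ^ q"] c y dcy by (metis power_closed power_not_zero)
      define e where "e = ?z - k *\<^sub>W c ^ q"
      have z: "?z = k *\<^sub>W c ^ q + e" and e: "e \<in> filt (?N - 1)" using k by (simp_all add: e_def)
      have "d (\<delta> y) = d y" "\<delta> y \<noteq> 0" using M[OF y dy] \<open>M = 0\<close> by auto
      \<comment> \<open>\<open>\<nu>\<close> is the still unknown diagonal entry at
        \<open>y\<close>.\<close>
      then obtain \<nu> where \<nu>: "\<delta> y - \<nu> *\<^sub>W y \<in> filt (d y - 1)"
        using lead_nonzero[of "\<delta> y" y] y by (metis deriv_closed)
      have "\<delta> ?z - (of_nat p * \<nu>) *\<^sub>W ?z = of_nat p *\<^sub>W (y ^ (p - 1) * (\<delta> y - \<nu> *\<^sub>W y))"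
      proof -
        have "?z = y ^ (p - 1) * y" using pq by (metis power_minus_mult)
        then have "(of_nat p * \<nu>) *\<^sub>W ?z = of_nat p *\<^sub>W (y ^ (p - 1) * \<nu> *\<^sub>W y)"
          by (simp add: weyl_scale_mult_right)
        then show ?thesis
          using deriv_power[OF y(1), of p] by (simp only: right_diff_distrib weyl.scale_right_diff_distrib)
      qed
      moreover have "y ^ (p - 1) * (\<delta> y - \<nu> *\<^sub>W y) \<in> filt (int (p - 1) * d y + (d y - 1))"
        using y by (intro filt_mult \<nu>) (simp add: filt_def power_closed deg_power)
      moreover have "int (p - 1) * d y + (d y - 1) = ?N - 1"
        using pq by (simp add: of_nat_diff algebra_simps)
      ultimately have A: "\<delta> ?z - (of_nat p * \<nu>) *\<^sub>W ?z \<in> filt (?N - 1)"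
        by (simp only: filt_scale)
      have "\<delta> (c ^ q) = (of_nat q * \<mu>) *\<^sub>W c ^ q"
      proof -
        have "c ^ q = c ^ (q - 1) * c" using pq by (metis power_minus_mult)
        then have "c ^ (q - 1) * \<delta> c = \<mu> *\<^sub>W c ^ q" using c by (simp add: weyl_scale_mult_right)
        then show ?thesis using deriv_power[OF c(1), of q] by simp
      qed
      then have "\<delta> ?z - (of_nat q * \<mu>) *\<^sub>W ?z = \<delta> e - (of_nat q * \<mu>) *\<^sub>W e"
        unfolding z using c filt_closed[OF e]
        by (simp add: deriv_add deriv_scale power_closed scale_closed weyl.scale_right_distrib mult.commute)
      then have B: "\<delta> ?z - (of_nat q * \<mu>) *\<^sub>W ?z \<in> filt (?N - 1)"
        using shift[OF e] filt_scale[OF e] \<open>M = 0\<close> by (simp add: filt_diff)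
      \<comment> \<open>The difference of \<open>B\<close> and \<open>A\<close> is a multiple of
        \<open>?z\<close> lying below the degree of \<open>?z\<close>, so its coefficient must
        vanish.\<close>
      have "(of_nat p * \<nu> - of_nat q * \<mu>) *\<^sub>W ?z \<in> filt (?N - 1)"
        using filt_diff[OF B A] by (simp add: weyl.scale_left_diff_distrib)
      then have "of_nat p * \<nu> = of_nat q * \<mu>"
        using filt_less[of "(of_nat p * \<nu> - of_nat q * \<mu>) *\<^sub>W ?z" "?N - 1"] y dcy
        by (cases "of_nat p * \<nu> = of_nat q * \<mu>") (simp_all add: deg_scale power_closed)
      then have "\<nu> = \<mu> / of_int (d c) * of_int (d y)" using pq by (simp add: field_simps)
      then show ?thesis using \<nu> by simp
    qed
  qed
qed

section \<open>Eigenspaces and diagonalization\<close>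

context diagonal_derivation
begin

definition degs :: "int set"
  where "degs = d ` (C - {0})"

text \<open>The index is the degree \<open>m\<close> instead of the eigenvalue r m, so that
  multiplication adds integer indices.\<close>

definition eig :: "int \<Rightarrow> 'k weyl set"
  where "eig m = {y \<in> C. \<delta> y = (r * of_int m) *\<^sub>W y}"

lemma eigenspace_eq_eig: "eigenspace C \<delta> (r * of_int m) = eig m"
  by (auto simp: eigenspace_def ker_on_def eig_def)

lemma eig_closed: "y \<in> eig m \<Longrightarrow> y \<in> C"
  by (simp add: eig_def)

lemma eig_0 [simp]: "0 \<in> eig m"
  by (simp add: eig_def zero_closed deriv_0)

lemma eig_1: "1 \<in> eig 0"
  by (simp add: eig_def one_closed deriv_1)

lemma eig_scale: "y \<in> eig m \<Longrightarrow> k *\<^sub>W y \<in> eig m"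
  by (simp add: eig_def scale_closed deriv_scale mult.commute)

lemma eig_add: "y \<in> eig m \<Longrightarrow> z \<in> eig m \<Longrightarrow> y + z \<in> eig m"
  by (simp add: eig_def add_closed deriv_add weyl.scale_right_distrib)

lemma eig_diff: "y \<in> eig m \<Longrightarrow> z \<in> eig m \<Longrightarrow> y - z \<in> eig m"
  by (simp add: eig_def diff_closed deriv_diff weyl.scale_right_diff_distrib)

lemma eig_sum: "(\<And>i. i \<in> I \<Longrightarrow> f i \<in> eig m) \<Longrightarrow> (\<Sum>i\<in>I. f i) \<in> eig m"
  by (induction I rule: infinite_finite_induct) (simp_all add: eig_add)

lemma eig_mult: "y \<in> eig m \<Longrightarrow> z \<in> eig n \<Longrightarrow> y * z \<in> eig (m + n)"
  by (simp add: eig_def mult_closed deriv_mult weyl_scale_mult_left weyl_scale_mult_right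
      distrib_left weyl.scale_left_distrib)

lemma eig_power: "y \<in> eig m \<Longrightarrow> y ^ n \<in> eig (int n * m)"
proof (induction n)
  case (Suc n)
  then show ?case using eig_mult[of y m "y ^ n" "int n * m"] by (simp add: distrib_right)
qed (simp add: eig_1)

text \<open>Otherwise a nonzero multiple of \<open>y\<close> would lie in a filtration step below
  the degree of \<open>y\<close>.\<close>

lemma deg_eigenvector:
  assumes "y \<in> C" "y \<noteq> 0" "\<delta> y = \<mu> *\<^sub>W y"
  shows "\<mu> = r * of_int (d y)"
proof -
  have "(\<mu> - r * of_int (d y)) *\<^sub>W y \<in> filt (d y - 1)"
    using deriv_lead[OF assms(1,2)] assms(3) by (simp add: weyl.scale_left_diff_distrib)
  then show ?thesis
    using filt_less[of "(\<mu> - r * of_int (d y)) *\<^sub>W y" "d y - 1"] assms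
    by (cases "\<mu> = r * of_int (d y)") (simp_all add: deg_scale)
qed

lemma eig_deg: "y \<in> eig m \<Longrightarrow> y \<noteq> 0 \<Longrightarrow> d y = m"
  using deg_eigenvector[of y "r * of_int m"] r_nonzero by (simp add: eig_def)

text \<open>Cancelling leading terms leaves an element of the same eigenspace of degree below
  \<open>m\<close>; nonzero elements there have degree exactly \<open>m\<close>.\<close>

lemma eig_proportional:
  assumes "y \<in> eig m" "z \<in> eig m" "z \<noteq> 0"
  obtains k where "y = k *\<^sub>W z"
proof (cases "y = 0")
  case True
  then show ?thesis using that[of 0] by simp
next
  case False
  have d: "d y = m" "d z = m" using assms False eig_deg by auto
  obtain k where k: "y - k *\<^sub>W z \<in> filt (m - 1)"
    using lead_nonzero[of y z] assms False d by (metis eig_closed)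
  have "y - k *\<^sub>W z \<in> eig m" using assms by (simp add: eig_diff eig_scale)
  then have "y - k *\<^sub>W z = 0" using eig_deg filt_less[OF k] by fastforce
  then have "y = k *\<^sub>W z" by simp
  then show ?thesis by (rule that)
qed

text \<open>Diagonalization of a triangular map with distinct diagonal entries. For y of degree n,
  applying \<delta> - r n lowers the degree, so the result decomposes by induction; it is lifted
  back along \<delta> - r n in the lower eigenspaces, and y minus this lift is an
  eigenvector.\<close>

lemma eig_decomposition:
  assumes "y \<in> C" "y = 0 \<or> d y < int N"
  obtains f where "\<And>m. f m \<in> eig (int m)" "y = (\<Sum>m<N. f m)"
proof -
  have "\<exists>f. (\<forall>m. f m \<in> eig (int m)) \<and> y = (\<Sum>m<N. f m)"
    using assms
  proof (induction N arbitrary: y)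
    case 0
    then have "y = 0" using deg_nonneg[of y] by (cases "y = 0") auto
    then show ?case by (intro exI[of _ "\<lambda>_. 0"]) simp
  next
    case (Suc n)
    show ?case
    proof (cases "y = 0 \<or> d y < int n")
      case True
      then obtain f where f: "\<And>m. f m \<in> eig (int m)" "y = (\<Sum>m<n. f m)"
        using Suc.IH[OF Suc.prems(1)] by blast
      then show ?thesis by (intro exI[of _ "f(n := 0)"]) simp
    next
      case False
      then have dy: "d y = int n" "y \<noteq> 0" using Suc.prems by auto
      define z where "z = \<delta> y - (r * of_nat n) *\<^sub>W y"
      have "z \<in> filt (int n - 1)" using deriv_lead[OF Suc.prems(1) dy(2)] dy(1) by (simp add: z_def)
      then have "z \<in> C" "z = 0 \<or> d z < int n" by (auto simp: filt_def)
      then obtain f where f: "\<And>m. f m \<in> eig (int m)" "z = (\<Sum>m<n. f m)"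
        using Suc.IH by blast
      \<comment> \<open>On the eigenspace of index m < n the map \<delta> - r n is the nonzero
        scalar r (m - n), so \<open>g m\<close> is the preimage of \<open>f m\<close>.\<close>
      define g where "g m = (1 / (r * (of_nat m - of_nat n))) *\<^sub>W f m" for m
      have g: "g m \<in> eig (int m)" for m using f(1) by (simp add: g_def eig_scale)
      let ?G = "\<Sum>m<n. g m"
      have GC: "?G \<in> C" using g by (intro sum_closed) (auto intro: eig_closed)
      have "\<delta> (g m) - (r * of_nat n) *\<^sub>W g m = f m" if "m < n" for m
      proof -
        have "r * (of_nat m - of_nat n) \<noteq> (0 :: 'k)" using that r_nonzero by simp
        moreover have "\<delta> (g m) - (r * of_nat n) *\<^sub>W g m = (r * (of_nat m - of_nat n)) *\<^sub>W g m"
          using g[of m] by (simp add: eig_def right_diff_distrib weyl.scale_left_diff_distrib)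
        ultimately show ?thesis by (simp add: g_def)
      qed
      then have "(\<Sum>m<n. \<delta> (g m) - (r * of_nat n) *\<^sub>W g m) = z" unfolding f(2) by (intro sum.cong) auto
      moreover have "(\<Sum>m<n. \<delta> (g m) - (r * of_nat n) *\<^sub>W g m) = \<delta> ?G - (r * of_nat n) *\<^sub>W ?G"
        using g by (subst deriv_sum) (auto intro: eig_closed simp: sum_subtractf weyl.scale_sum_right)
      ultimately have "y - ?G \<in> eig (int n)"
        using Suc.prems(1) GC
        by (simp add: eig_def diff_closed deriv_diff z_def weyl.scale_right_diff_distrib algebra_simps)
      then show ?thesis
        using g by (intro exI[of _ "g(n := y - ?G)"]) simp
    qed
  qed
  then show ?thesis using that by blast
qed

lemma eig_decomposition_ex:
  assumes "y \<in> C"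
  obtains N f where "\<And>m. f m \<in> eig (int m)" "y = (\<Sum>m<N. f m)"
proof -
  have "y = 0 \<or> d y < int (Suc (nat (d y)))" by linarith
  then show ?thesis by (rule eig_decomposition[OF assms]) (rule that)
qed

lemma degs_nonneg: "n \<in> degs \<Longrightarrow> n \<ge> 0"
  using deg_nonneg by (auto simp: degs_def)

lemma eig_in_degs: "y \<in> eig m \<Longrightarrow> y \<noteq> 0 \<Longrightarrow> m \<in> degs"
  using eig_deg[of y m] eig_closed[of y m] by (auto simp: degs_def)

text \<open>The top component in the decomposition of an element of degree \<open>n\<close> cannot
  vanish, since the other components have smaller degree.\<close>

lemma eig_exists:
  assumes "n \<in> degs"
  obtains y where "y \<in> eig n" "y \<noteq> 0"
proof -
  obtain y where y: "y \<in> C" "y \<noteq> 0" "d y = n" using assms by (auto simp: degs_def)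
  define N where "N = nat n"
  have N: "n = int N" using degs_nonneg[OF assms] by (simp add: N_def)
  obtain f where f: "\<And>m. f m \<in> eig (int m)" "y = (\<Sum>m<Suc N. f m)"
    using eig_decomposition[OF y(1), of "Suc N"] y(3) N by auto
  have "f N \<noteq> 0"
  proof
    assume "f N = 0"
    then have "y = (\<Sum>m<N. f m)" using f(2) by simp
    also have "\<dots> \<in> filt (n - 1)"
    proof (rule filt_sum)
      fix m assume "m \<in> {..<N}"
      then show "f m \<in> filt (n - 1)"
        using f(1)[of m] eig_deg[of "f m" "int m"] N by (intro filtI) (auto intro: eig_closed)
    qed
    finally show False using filt_less[of y "n - 1"] y by simp
  qed
  then show ?thesis using that f(1)[of N] N by simp
qed

lemma zero_degs: "0 \<in> degs"
  using eig_in_degs[OF eig_1] by simp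

lemma degs_add: "m \<in> degs \<Longrightarrow> n \<in> degs \<Longrightarrow> m + n \<in> degs"
  by (metis eig_exists eig_in_degs eig_mult no_zero_divisors)

lemma degs_scale: "m \<in> degs \<Longrightarrow> int j * m \<in> degs"
  by (induction j) (simp_all add: zero_degs degs_add distrib_right)

lemma degs_nontrivial: "\<exists>n\<in>degs. n > 0"
  using nontrivial nonconst by (force simp: degs_def)

lemma Ev_eq: "Ev C \<delta> = (\<lambda>n. r * of_int n) ` degs"
proof
  show "Ev C \<delta> \<subseteq> (\<lambda>n. r * of_int n) ` degs"
    using deg_eigenvector by (force simp: Ev_def degs_def)
  show "(\<lambda>n. r * of_int n) ` degs \<subseteq> Ev C \<delta>"
  proof
    fix \<mu> assume "\<mu> \<in> (\<lambda>n. r * of_int n) ` degs"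
    then obtain n where "n \<in> degs" "\<mu> = r * of_int n" by blast
    then show "\<mu> \<in> Ev C \<delta>" by (elim eig_exists) (auto simp: Ev_def eig_def)
  qed
qed

lemma Ev_cases:
  assumes "\<mu> \<in> Ev C \<delta>"
  obtains n where "n \<in> degs" "\<mu> = r * of_int n" "eigenspace C \<delta> \<mu> = eig n"
  using assms unfolding Ev_eq by (auto simp: eigenspace_eq_eig)

text \<open>Uniqueness: nonzero members for different eigenvalues have different degrees, so a sum
  of them is nonzero. Existence: the decomposition indexed by degrees is regrouped by
  eigenvalues.\<close>

lemma direct_sum_eigenspaces: "internal_direct_sum (Ev C \<delta>) (eigenspace C \<delta>) C"
  unfolding internal_direct_sum_def bij_betw_def
proof
  let ?P = "{f. finite {k. f k \<noteq> 0} \<and> (\<forall>k\<in>Ev C \<delta>. f k \<in> eigenspace C \<delta> k) \<and>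
    (\<forall>k. k \<notin> Ev C \<delta> \<longrightarrow> f k = 0)}"
  let ?s = "\<lambda>f :: 'k \<Rightarrow> 'k weyl. \<Sum>k | f k \<noteq> 0. f k"
  have mem: "f k \<in> C" "f k \<noteq> 0 \<Longrightarrow> k = r * of_int (d (f k))" if "f \<in> ?P" for f k
  proof -
    have "f k \<in> eigenspace C \<delta> k"
      using that by (cases "k \<in> Ev C \<delta>") (simp_all add: eigenspace_def ker_on_def zero_closed deriv_0)
    then have "f k \<in> C" "\<delta> (f k) = k *\<^sub>W f k" by (simp_all add: eigenspace_def ker_on_def)
    then show "f k \<in> C" "f k \<noteq> 0 \<Longrightarrow> k = r * of_int (d (f k))" using deg_eigenvector by blast+
  qed
  show "inj_on ?s ?P"
  proof (rule inj_onI)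
    fix f g assume f: "f \<in> ?P" and g: "g \<in> ?P" and eq: "?s f = ?s g"
    define h where "h k = f k - g k" for k
    have hP: "h \<in> ?P"
    proof -
      have "{k. h k \<noteq> 0} \<subseteq> {k. f k \<noteq> 0} \<union> {k. g k \<noteq> 0}" by (auto simp: h_def)
      then have "finite {k. h k \<noteq> 0}" by (rule finite_subset) (use f g in auto)
      then show ?thesis
        using f g by (auto simp: h_def eigenspace_def ker_on_def diff_closed deriv_diff
            weyl.scale_right_diff_distrib)
    qed
    let ?A = "{k. f k \<noteq> 0} \<union> {k. g k \<noteq> 0}"
    have finA: "finite ?A" using f g by auto
    have sums: "?s f = (\<Sum>k\<in>?A. f k)" "?s g = (\<Sum>k\<in>?A. g k)" "?s h = (\<Sum>k\<in>?A. h k)"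
      by (rule sum.mono_neutral_left; use finA in \<open>auto simp: h_def\<close>)+
    have "?s h = 0" using eq unfolding sums by (simp add: h_def sum_subtractf)
    moreover have "?s h \<noteq> 0" if "{k. h k \<noteq> 0} \<noteq> {}"
    proof (rule sum_distinct_degrees_nonzero)
      show "inj_on (\<lambda>k. d (h k)) {k. h k \<noteq> 0}"
      proof (rule inj_onI)
        fix k l assume "k \<in> {k. h k \<noteq> 0}" "l \<in> {k. h k \<noteq> 0}" "d (h k) = d (h l)"
        then show "k = l" using mem(2)[OF hP, of k] mem(2)[OF hP, of l] by simp
      qed
      show "finite {k. h k \<noteq> 0}" using hP by blast
    qed (use that mem(1)[OF hP] in simp_all)
    ultimately have "h k = 0" for k by blast
    then show "f = g" by (auto simp: h_def)
  qed
  show "?s ` ?P = C"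
  proof
    show "?s ` ?P \<subseteq> C" using mem(1) by (blast intro: sum_closed)
    show "C \<subseteq> ?s ` ?P"
    proof
      fix y assume y: "y \<in> C"
      obtain N f where f: "\<And>m. f m \<in> eig (int m)" "y = (\<Sum>m<N. f m)"
        using eig_decomposition_ex[OF y] by blast
      let ?I = "{..<N}" and ?e = "\<lambda>m. r * of_nat m"
      \<comment> \<open>\<open>F\<close> transports the family \<open>f\<close> along m \<mapsto> r
        m. This map is injective, so each sum has at most one term; a nonzero \<open>f m\<close>
        forces m to be a degree.\<close>
      define F where "F k = (\<Sum>m | m \<in> ?I \<and> ?e m = k. f m)" for k
      have F_out: "F k = 0" if "k \<notin> ?e ` ?I" for k
        unfolding F_def by (rule sum.neutral) (use that in auto)
      have F_Ev: "F k = 0" if "k \<notin> Ev C \<delta>" for k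
        unfolding F_def
      proof (rule sum.neutral, rule ballI)
        fix m assume m: "m \<in> {m. m \<in> ?I \<and> ?e m = k}"
        show "f m = 0"
        proof (rule ccontr)
          assume "f m \<noteq> 0"
          then have "int m \<in> degs" using f(1) eig_in_degs by blast
          then show False using that m by (force simp: Ev_eq)
        qed
      qed
      have F_eig: "F k \<in> eigenspace C \<delta> k" for k
      proof (cases "k \<in> Ev C \<delta>")
        case True
        then obtain n where n: "k = r * of_int n" "eigenspace C \<delta> k = eig n" by (rule Ev_cases)
        have "f m \<in> eig n" if "?e m = k" for m
        proof -
          have "(of_int (int m) :: 'k) = of_int n" using that n r_nonzero by simp
          then show ?thesis using f(1)[of m] by (simp only: of_int_eq_iff)
        qed
        then show ?thesis unfolding n(2) F_def by (intro eig_sum) auto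
      qed (simp add: F_Ev eigenspace_def ker_on_def zero_closed deriv_0)
      have fin: "finite {k. F k \<noteq> 0}"
        by (rule finite_subset[of _ "?e ` ?I"]) (use F_out in auto)
      have "y = (\<Sum>k\<in>?e ` ?I. F k)"
        unfolding f(2) F_def by (rule sum.image_gen) simp
      also have "\<dots> = ?s F"
        by (rule sum.mono_neutral_right) (use F_out in auto)
      finally show "y \<in> ?s ` ?P" using fin F_Ev F_eig by blast
    qed
  qed
qed

lemma semisimple: "semisimple_on C \<delta>"
  using direct_sum_eigenspaces by (simp add: semisimple_on_def)

lemma dim_eigenspace:
  assumes "\<mu> \<in> Ev C \<delta>"
  shows "weyl.dim (eigenspace C \<delta> \<mu>) = 1"
proof -
  obtain n where n: "n \<in> degs" "eigenspace C \<delta> \<mu> = eig n" using assms by (rule Ev_cases)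
  obtain y where y: "y \<in> eig n" "y \<noteq> 0" using eig_exists[OF n(1)] .
  have "eig n \<subseteq> weyl.span {y}"
    using eig_proportional[OF _ y] by (metis subsetI weyl.span_base weyl.span_scale singletonI)
  then have "weyl.dim (eig n) = card {y}"
    using y by (intro weyl.dim_unique[of "{y}"]) (auto simp: weyl.dependent_single)
  then show ?thesis using n by simp
qed

section \<open>The monoid algebra\<close>

text \<open>\<open>g\<close> is the least positive difference of two degrees. With q = n div g the
  remainder of n is the difference of the degrees n + q b and q a, so it is 0 by minimality.\<close>

lemma degs_gcd:
  obtains g a b where "g > 0" "a \<in> degs" "b \<in> degs" "a - b = g" "\<And>n. n \<in> degs \<Longrightarrow> g dvd n"
proof -
  define G where "G = {nat (a - b) | a b. a \<in> degs \<and> b \<in> degs \<and> a - b > 0}"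
  obtain n0 where "n0 \<in> degs" "n0 > 0" using degs_nontrivial by blast
  then have "nat (n0 - 0) \<in> G" using zero_degs unfolding G_def by force
  then have "(LEAST x. x \<in> G) \<in> G" by (rule LeastI)
  then obtain a b where ab: "a \<in> degs" "b \<in> degs" "a - b > 0" "(LEAST x. x \<in> G) = nat (a - b)"
    unfolding G_def by blast
  have least: "a - b \<le> a' - b'" if "a' \<in> degs" "b' \<in> degs" "a' - b' > 0" for a' b'
  proof -
    have "nat (a' - b') \<in> G" using that unfolding G_def by blast
    then have "nat (a - b) \<le> nat (a' - b')" using ab(4) Least_le[of "\<lambda>x. x \<in> G"] by metis
    then show ?thesis using ab(3) that(3) by linarith
  qed
  have "a - b dvd n" if n: "n \<in> degs" for n
  proof (rule ccontr)
    let ?g = "a - b"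
    let ?q = "n div ?g"
    assume "\<not> ?g dvd n"
    then have pos: "n mod ?g > 0" using ab(3) by (simp add: dvd_eq_mod_eq_0 order_less_le)
    have q: "?q \<ge> 0" using degs_nonneg[OF n] ab(3) by (simp add: pos_imp_zdiv_nonneg_iff)
    have "?q * a \<in> degs" "?q * b \<in> degs"
      using degs_scale[of a "nat ?q"] degs_scale[of b "nat ?q"] q ab by simp_all
    moreover have "n mod ?g = (n + ?q * b) - ?q * a"
      using div_mult_mod_eq[of n ?g] by (simp add: algebra_simps)
    ultimately have "?g \<le> n mod ?g"
      using least[of "n + ?q * b" "?q * a"] degs_add[OF n] pos by simp
    moreover have "n mod ?g < ?g" using ab(3) by simp
    ultimately show False by simp
  qed
  then show ?thesis using that[of "a - b" a b] ab by simp
qed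

text \<open>The \<open>e n\<close> are the powers of the element \<open>u / w\<close> of the field of fractions, where \<open>u\<close> and \<open>w\<close> are
  eigenvectors whose degrees differ by the greatest common divisor of all degrees.\<close>

lemma eig_multiplicative_basis:
  obtains e where "e 0 = 1"
    and "\<And>n. int n \<in> degs \<Longrightarrow> e n \<in> eig (int n) \<and> e n \<noteq> 0"
    and "\<And>m n. int m \<in> degs \<Longrightarrow> int n \<in> degs \<Longrightarrow> e (m + n) = e m * e n"
proof -
  obtain g a b where g: "g > 0" "a \<in> degs" "b \<in> degs" "a - b = g" "\<And>n. n \<in> degs \<Longrightarrow> g dvd n"
    by (rule degs_gcd) blast
  obtain u where u: "u \<in> eig a" "u \<noteq> 0" using eig_exists[OF g(2)] .
  obtain w where w: "w \<in> eig b" "w \<noteq> 0" using eig_exists[OF g(3)] .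
  define q where "q n = nat (int n div g)" for n
  have q: "int (q n) * g = int n" if "int n \<in> degs" for n
    using g(5)[OF that] g(1) by (simp add: q_def pos_imp_zdiv_nonneg_iff)
  have q_add: "q (m + n) = q m + q n" if "int m \<in> degs" "int n \<in> degs" for m n
  proof -
    have "int (m + n) \<in> degs" using degs_add[OF that] by simp
    then have "int (q (m + n)) * g = int (q m + q n) * g"
      using q[of "m + n"] q[OF that(1)] q[OF that(2)] by (simp add: distrib_right)
    then show ?thesis using g(1) by simp
  qed
  \<comment> \<open>The equation expresses y = (u / w)^(q n) without fractions. A rescaled
    eigenvector of index n solves it, because both sides lie in the same one-dimensional
    eigenspace.\<close>
  have "\<exists>y. y \<in> eig (int n) \<and> y \<noteq> 0 \<and> y * w ^ q n = u ^ q n" if n: "int n \<in> degs" for n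
  proof -
    obtain x where x: "x \<in> eig (int n)" "x \<noteq> 0" using eig_exists[OF n] .
    have "int (q n) * (a - b) = int n" using q[OF n] g(4) by simp
    then have "int n + int (q n) * b = int (q n) * a" by (simp add: right_diff_distrib)
    then have "x * w ^ q n \<in> eig (int (q n) * a)"
      using eig_mult[OF x(1) eig_power[OF w(1)], of "q n"] by simp
    then obtain k where k: "u ^ q n = k *\<^sub>W (x * w ^ q n)"
      using eig_proportional[OF eig_power[OF u(1)], of "x * w ^ q n" "q n"] x w by auto
    moreover have "k \<noteq> 0" using k u by auto
    ultimately show ?thesis
      using x by (intro exI[of _ "k *\<^sub>W x"]) (simp add: eig_scale weyl_scale_mult_left)
  qed
  then obtain e where e: "\<And>n. int n \<in> degs \<Longrightarrow> e n \<in> eig (int n) \<and> e n \<noteq> 0 \<and> e n * w ^ q n = u ^ q n"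
    by metis
  have "e (m + n) = e m * e n" if mn: "int m \<in> degs" "int n \<in> degs" for m n
  proof -
    have C: "e m \<in> C" "e n \<in> C" "w \<in> C" using e[OF mn(1)] e[OF mn(2)] w eig_closed by auto
    \<comment> \<open>The two sides are compared after multiplication by a power of
      \<open>w\<close>, which is cancelled at the end as there are no zero divisors.\<close>
    have "e m * e n * w ^ (q m + q n) = e m * (e n * w ^ q m) * w ^ q n"
      by (simp add: power_add mult.assoc)
    also have "e n * w ^ q m = w ^ q m * e n" using C by (intro mult_commute power_closed)
    also have "e m * (w ^ q m * e n) * w ^ q n = (e m * w ^ q m) * (e n * w ^ q n)"
      by (simp only: mult.assoc)
    also have "\<dots> = u ^ q (m + n)" using e mn by (simp add: q_add power_add)
    also have "\<dots> = e (m + n) * w ^ (q m + q n)"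
      using e[of "m + n"] degs_add[OF mn] q_add[OF mn] by simp
    finally show ?thesis using w by simp
  qed
  moreover have "e 0 = 1" using e[of 0] zero_degs by (simp add: q_def)
  ultimately show ?thesis using that e by blast
qed

text \<open>The map t^i \<mapsto> e i is multiplicative on the monoid algebra, injective because the
  e i have distinct degrees, and surjective because each eigenspace is a line. The required
  isomorphism is its inverse.\<close>

lemma monoid_algebra_normal_form: "monoid_algebra_normal_form C \<delta>"
proof -
  obtain e where e0: "e 0 = 1"
    and e: "\<And>n. int n \<in> degs \<Longrightarrow> e n \<in> eig (int n) \<and> e n \<noteq> 0"
    and e_mult: "\<And>m n. int m \<in> degs \<Longrightarrow> int n \<in> degs \<Longrightarrow> e (m + n) = e m * e n"
    by (rule eig_multiplicative_basis) blast
  define E where "E = {n. int n \<in> degs}"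
  let ?P = "monoid_subalgebra E :: 'k poly set"
  \<comment> \<open>Defined on all polynomials, although \<open>e i\<close> is controlled only for i
    in \<open>E\<close>; the multiplicative and injective behaviour is claimed on \<open>?P\<close>
    alone.\<close>
  define \<psi> where "\<psi> p = (\<Sum>i\<le>degree p. coeff p i *\<^sub>W e i)" for p :: "'k poly"
  have \<psi>_superset: "\<psi> p = (\<Sum>i\<le>n. coeff p i *\<^sub>W e i)" if "degree p \<le> n" for p n
    unfolding \<psi>_def by (rule sum.mono_neutral_left) (use that in \<open>auto simp: coeff_eq_0\<close>)
  have \<psi>_add: "\<psi> (p + q) = \<psi> p + \<psi> q" for p q
    by (simp add: \<psi>_superset[of _ "max (degree p) (degree q)"] degree_add_le
        weyl.scale_left_distrib sum.distrib)
  have \<psi>_smult: "\<psi> (smult k p) = k *\<^sub>W \<psi> p" for k p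
    by (simp add: \<psi>_superset[of _ "degree p"] degree_smult_le weyl.scale_sum_right)
  have \<psi>_0: "\<psi> 0 = 0" by (simp add: \<psi>_def)
  have \<psi>_monom: "\<psi> (monom c n) = c *\<^sub>W e n" for c n
  proof -
    have "\<psi> (monom c n) = (\<Sum>i\<le>n. if i = n then c *\<^sub>W e n else 0)"
      unfolding \<psi>_superset[OF degree_monom_le] by (rule sum.cong) auto
    then show ?thesis by simp
  qed
  have \<psi>_sum: "\<psi> (\<Sum>i\<in>I. f i) = (\<Sum>i\<in>I. \<psi> (f i))" for f and I :: "nat set"
    by (induction I rule: infinite_finite_induct) (simp_all add: \<psi>_0 \<psi>_add)
  have \<psi>_mult: "\<psi> (p * q) = \<psi> p * \<psi> q" if p: "p \<in> ?P" and q: "q \<in> ?P" for p q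
  proof -
    have "p * q = (\<Sum>i\<le>degree p. \<Sum>j\<le>degree q. monom (coeff p i * coeff q j) (i + j))"
    proof -
      have "p * q = (\<Sum>i\<le>degree p. monom (coeff p i) i) * (\<Sum>j\<le>degree q. monom (coeff q j) j)"
        by (simp only: poly_as_sum_of_monoms)
      then show ?thesis by (simp add: sum_product mult_monom)
    qed
    then have "\<psi> (p * q) = (\<Sum>i\<le>degree p. \<Sum>j\<le>degree q. (coeff p i * coeff q j) *\<^sub>W e (i + j))"
      by (simp add: \<psi>_sum \<psi>_monom)
    also have "\<dots> = (\<Sum>i\<le>degree p. \<Sum>j\<le>degree q. (coeff p i *\<^sub>W e i) * (coeff q j *\<^sub>W e j))"
    proof (intro sum.cong refl)
      fix i j
      show "(coeff p i * coeff q j) *\<^sub>W e (i + j) = (coeff p i *\<^sub>W e i) * (coeff q j *\<^sub>W e j)"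
      proof (cases "coeff p i = 0 \<or> coeff q j = 0")
        case False
        then have "int i \<in> degs" "int j \<in> degs" using p q by (auto simp: monoid_subalgebra_def E_def)
        then show ?thesis by (simp add: e_mult weyl_scale_mult_left weyl_scale_mult_right)
      qed auto
    qed
    also have "\<dots> = \<psi> p * \<psi> q" by (simp add: \<psi>_def sum_product)
    finally show ?thesis .
  qed
  have term_closed: "coeff p i *\<^sub>W e i \<in> eig (int i)" if "p \<in> ?P" for p i
    using that e[of i] by (cases "coeff p i = 0") (auto simp: monoid_subalgebra_def E_def eig_scale)
  have \<psi>_closed: "\<psi> p \<in> C" if "p \<in> ?P" for p
    unfolding \<psi>_def using term_closed[OF that] by (intro sum_closed) (blast intro: eig_closed)
  have \<psi>_nonzero: "\<psi> p \<noteq> 0" if p: "p \<in> ?P" "p \<noteq> 0" for p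
  proof -
    let ?I = "{i. i \<le> degree p \<and> coeff p i \<noteq> 0}"
    have i: "coeff p i *\<^sub>W e i \<noteq> 0" if "i \<in> ?I" for i
      using that e[of i] p by (auto simp: monoid_subalgebra_def E_def)
    have "(\<Sum>i\<in>?I. coeff p i *\<^sub>W e i) \<noteq> 0"
    proof (rule sum_distinct_degrees_nonzero)
      show "?I \<noteq> {}" using p(2) by (metis (mono_tags, lifting) empty_Collect_eq leading_coeff_0_iff order_refl)
      show "inj_on (\<lambda>i. d (coeff p i *\<^sub>W e i)) ?I"
        using eig_deg[OF term_closed[OF p(1)] i] by (auto intro!: inj_onI)
    qed (use i term_closed[OF p(1)] in \<open>auto intro: eig_closed\<close>)
    moreover have "\<psi> p = (\<Sum>i\<in>?I. coeff p i *\<^sub>W e i)"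
      unfolding \<psi>_def by (rule sum.mono_neutral_right) auto
    ultimately show ?thesis by simp
  qed
  have P_diff: "p - q \<in> ?P" "p + q \<in> ?P" "smult k p \<in> ?P" if "p \<in> ?P" "q \<in> ?P" for p q k
  proof -
    have "r \<in> ?P \<longleftrightarrow> (\<forall>i. i \<notin> E \<longrightarrow> coeff r i = 0)" for r
      by (auto simp: monoid_subalgebra_def)
    then show "p - q \<in> ?P" "p + q \<in> ?P" "smult k p \<in> ?P" using that by simp_all
  qed
  have P_mult: "p * q \<in> ?P" if "p \<in> ?P" "q \<in> ?P" for p q
    unfolding monoid_subalgebra_def
  proof (intro CollectI allI impI)
    fix n assume "coeff (p * q) n \<noteq> 0"
    then have "(\<Sum>i\<le>n. coeff p i * coeff q (n - i)) \<noteq> 0" by (simp add: coeff_mult)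
    then obtain i where "i \<in> {..n}" "coeff p i * coeff q (n - i) \<noteq> 0"
      by (rule sum.not_neutral_contains_not_neutral)
    then have i: "i \<le> n" "coeff p i \<noteq> 0" "coeff q (n - i) \<noteq> 0" by simp_all
    have "i \<in> E" using that(1) i(2) unfolding monoid_subalgebra_def by blast
    moreover have "n - i \<in> E" using that(2) i(3) unfolding monoid_subalgebra_def by blast
    ultimately have "int i \<in> degs" "int (n - i) \<in> degs" by (simp_all add: E_def)
    then have "int i + int (n - i) \<in> degs" by (rule degs_add)
    then show "n \<in> E" using i(1) by (simp add: E_def)
  qed
  have bij: "bij_betw \<psi> ?P C"
    unfolding bij_betw_def
  proof
    show "inj_on \<psi> ?P"
    proof (rule inj_onI)
      fix p q assume p: "p \<in> ?P" "q \<in> ?P" and "\<psi> p = \<psi> q"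
      then have "\<psi> (p - q) = 0" using \<psi>_add[of "p - q" q] by simp
      then show "p = q" using \<psi>_nonzero[OF P_diff(1)[OF p]] by auto
    qed
    show "\<psi> ` ?P = C"
    proof
      show "C \<subseteq> \<psi> ` ?P"
      proof
        fix y assume y: "y \<in> C"
        obtain N f where f: "\<And>m. f m \<in> eig (int m)" "y = (\<Sum>m<N. f m)"
          using eig_decomposition_ex[OF y] by blast
        have "\<exists>k. f m = k *\<^sub>W e m \<and> (k \<noteq> 0 \<longrightarrow> m \<in> E)" for m
        proof (cases "f m = 0")
          case False
          then have m: "int m \<in> degs" using eig_in_degs f(1) by blast
          then obtain k where "f m = k *\<^sub>W e m" using eig_proportional[OF f(1)] e by metis
          then show ?thesis using m by (auto simp: E_def)
        qed (auto intro: exI[of _ 0])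
        then obtain k where k: "\<And>m. f m = k m *\<^sub>W e m" "\<And>m. k m \<noteq> 0 \<Longrightarrow> m \<in> E" by metis
        let ?p = "\<Sum>m<N. monom (k m) m"
        have "?p \<in> ?P" using k(2) by (auto simp: monoid_subalgebra_def coeff_sum split: if_splits)
        moreover have "\<psi> ?p = y" unfolding f(2) by (simp add: \<psi>_sum \<psi>_monom \<psi>_add k(1))
        ultimately show "y \<in> \<psi> ` ?P" by blast
      qed
    qed (use \<psi>_closed in auto)
  qed
  define \<phi> where "\<phi> = inv_into ?P \<psi>"
  have \<phi>: "bij_betw \<phi> C ?P" unfolding \<phi>_def using bij by (rule bij_betw_inv_into)
  have \<phi>_eqI: "\<phi> y = p" if "p \<in> ?P" "\<psi> p = y" for y p
    using that bij by (auto simp: \<phi>_def bij_betw_def inv_into_f_f)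
  have \<phi>_mem: "\<phi> y \<in> ?P" "\<psi> (\<phi> y) = y" if "y \<in> C" for y
    using that \<phi> bij by (auto simp: bij_betw_def \<phi>_def f_inv_into_f)
  have one_P: "1 \<in> ?P" using zero_degs by (auto simp: monoid_subalgebra_def E_def)
  have \<psi>_1: "\<psi> 1 = 1" using \<psi>_monom[of 1 0] e0 by (simp add: one_pCons monom_0)
  have "alg_iso_to_poly C ?P \<phi>"
    unfolding alg_iso_to_poly_def
  proof (intro conjI ballI allI)
    fix a b k assume a: "a \<in> C" and b: "b \<in> C"
    show "\<phi> (a + b) = \<phi> a + \<phi> b"
      by (rule \<phi>_eqI) (simp_all add: P_diff(2) \<psi>_add \<phi>_mem a b)
    show "\<phi> (a * b) = \<phi> a * \<phi> b"
      by (rule \<phi>_eqI) (simp_all add: P_mult \<psi>_mult \<phi>_mem a b)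
  next
    fix k a assume a: "a \<in> C"
    show "\<phi> (k *\<^sub>W a) = smult k (\<phi> a)"
      by (rule \<phi>_eqI) (use P_diff(3)[OF \<phi>_mem(1)[OF a] one_P] in \<open>simp_all add: \<psi>_smult \<phi>_mem a\<close>)
  qed (use \<phi> \<phi>_eqI[OF one_P \<psi>_1] in simp_all)
  moreover have "\<phi> (\<delta> a) = smult r (monom 1 1 * pderiv (\<phi> a))" if a: "a \<in> C" for a
  proof (rule \<phi>_eqI)
    let ?p = "\<phi> a"
    let ?q = "smult r (monom 1 1 * pderiv ?p)"
    \<comment> \<open>The Euler operator multiplies the coefficient of t^i by r i, the same factor
      by which \<delta> scales \<open>e i\<close>.\<close>
    have coeff_q: "coeff ?q i = r * of_nat i * coeff ?p i" for i
      by (cases i) (simp_all add: coeff_monom_mult coeff_pderiv)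
    then show "?q \<in> ?P" using \<phi>_mem(1)[OF a] by (auto simp: monoid_subalgebra_def)
    have "degree ?q \<le> degree ?p"
    proof (intro degree_le allI impI)
      fix i assume "degree ?p < i"
      then show "coeff ?q i = 0" unfolding coeff_q by (simp add: coeff_eq_0)
    qed
    then have "\<psi> ?q = (\<Sum>i\<le>degree ?p. coeff ?q i *\<^sub>W e i)" by (rule \<psi>_superset)
    also have "\<dots> = (\<Sum>i\<le>degree ?p. \<delta> (coeff ?p i *\<^sub>W e i))"
    proof (intro sum.cong refl)
      fix i
      have "\<delta> (coeff ?p i *\<^sub>W e i) = (r * of_int (int i)) *\<^sub>W (coeff ?p i *\<^sub>W e i)"
        using term_closed[OF \<phi>_mem(1)[OF a], of i] unfolding eig_def by blast
      then show "coeff ?q i *\<^sub>W e i = \<delta> (coeff ?p i *\<^sub>W e i)" unfolding coeff_q by simp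
    qed
    also have "\<dots> = \<delta> (\<psi> ?p)"
      unfolding \<psi>_def using term_closed[OF \<phi>_mem(1)[OF a]]
      by (intro deriv_sum[symmetric]) (blast intro: eig_closed)
    finally show "\<psi> ?q = \<delta> a" using \<phi>_mem(2)[OF a] by simp
  qed
  moreover have "additive_submonoid E"
    using zero_degs degs_add by (auto simp: additive_submonoid_def E_def)
  moreover have "E \<noteq> {0}"
  proof -
    obtain n where "n \<in> degs" "n > 0" using degs_nontrivial by blast
    then have "nat n \<in> E" "nat n \<noteq> 0" by (auto simp: E_def)
    then show ?thesis by blast
  qed
  moreover have "Ev C \<delta> = (\<lambda>n. r * of_nat n) ` E"
  proof -
    have "degs = int ` E"
    proof (intro equalityI subsetI)
      fix n assume "n \<in> degs"
      then have "n = int (nat n)" "nat n \<in> E" using degs_nonneg by (simp_all add: E_def)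
      then show "n \<in> int ` E" by (rule image_eqI)
    qed (auto simp: E_def)
    then show ?thesis by (simp add: Ev_eq image_image)
  qed
  ultimately show ?thesis unfolding monoid_algebra_normal_form_def using r_nonzero by blast
qed

end

section \<open>The monoid of eigenvalues and extensions of Euler derivations\<close>

context diagonal_derivation
begin

lemma Ev_monoid: "additive_submonoid (Ev C \<delta>)"
proof -
  have "r * of_int m + r * of_int n \<in> Ev C \<delta>" if "m \<in> degs" "n \<in> degs" for m n
    using degs_add[OF that] by (force simp: Ev_eq distrib_left)
  then show ?thesis
    using zero_degs by (force simp: additive_submonoid_def Ev_eq)
qed

text \<open>Take \<rho> = r g with g the greatest common divisor of the degrees; g is a difference
  of two degrees, so \<rho> is a difference of two eigenvalues. The last clause serves the case
  K[H], where the same \<rho> must be the diagonal scalar.\<close>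

lemma Ev_generator:
  "\<exists>\<rho>. \<rho> \<noteq> 0 \<and> Ev C \<delta> \<subseteq> range (\<lambda>n. of_nat n * \<rho>) \<and>
    group_closure (Ev C \<delta>) = range (\<lambda>z. of_int z * \<rho>) \<and> (1 \<in> degs \<longrightarrow> \<rho> = r)"
proof -
  obtain g a b where g: "g > 0" "a \<in> degs" "b \<in> degs" "a - b = g" "\<And>n. n \<in> degs \<Longrightarrow> g dvd n"
    by (rule degs_gcd) blast
  define \<rho> where "\<rho> = r * of_int g"
  have Ev_nat: "\<exists>n. \<mu> = of_nat n * \<rho>" if \<mu>: "\<mu> \<in> Ev C \<delta>" for \<mu>
  proof -
    obtain m where m: "m \<in> degs" "\<mu> = r * of_int m"
      using \<mu> unfolding Ev_eq by blast
    obtain q where q: "m = g * q" using g(5)[OF m(1)] by blast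
    then have "g * q \<ge> 0" using degs_nonneg[OF m(1)] by simp
    then have "q \<ge> 0" using g(1) by (simp add: zero_le_mult_iff)
    then have "\<mu> = of_nat (nat q) * \<rho>" by (simp add: m q \<rho>_def)
    then show ?thesis ..
  qed
  have "group_closure (Ev C \<delta>) = range (\<lambda>z. of_int z * \<rho>)"
  proof (intro equalityI subsetI)
    fix x assume "x \<in> group_closure (Ev C \<delta>)"
    then show "x \<in> range (\<lambda>z. of_int z * \<rho>)"
    proof induction
      case (base s)
      then consider "s = 0" | "s \<in> Ev C \<delta>" by blast
      then show ?case
      proof cases
        case 1
        then show ?thesis by (intro range_eqI[of _ _ 0]) simp
      next
        case 2
        then obtain n where "s = of_nat n * \<rho>" using Ev_nat by blast
        then show ?thesis by (intro range_eqI[of _ _ "int n"]) simp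
      qed
    next
      case (diff s t)
      then obtain y z where "s = of_int y * \<rho>" "t = of_int z * \<rho>" by blast
      then have "s - t = of_int (y - z) * \<rho>" by (simp add: left_diff_distrib)
      then show ?case by blast
    qed
  next
    fix x assume "x \<in> range (\<lambda>z. of_int z * \<rho>)"
    then obtain z where x: "x = of_int z * \<rho>" by blast
    have "r * of_int a \<in> Ev C \<delta>" "r * of_int b \<in> Ev C \<delta>" using g by (auto simp: Ev_eq)
    then have "r * of_int a - r * of_int b \<in> group_closure (Ev C \<delta>)"
      by (intro group_closure.diff group_closure.base) auto
    moreover have "r * of_int a - r * of_int b = \<rho>"
      by (simp add: \<rho>_def right_diff_distrib flip: g(4))
    ultimately have \<rho>: "\<rho> \<in> group_closure (Ev C \<delta>)" by simp
    have nat: "of_nat n * \<rho> \<in> group_closure (Ev C \<delta>)" for n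
      by (induction n) (simp_all add: group_closure_add \<rho> distrib_right)
    show "x \<in> group_closure (Ev C \<delta>)"
    proof (cases "z \<ge> 0")
      case True
      then show ?thesis using nat[of "nat z"] x by simp
    next
      case False
      then have "of_nat (nat (- z)) = (- of_int z :: 'k)" by simp
      then have "- x \<in> group_closure (Ev C \<delta>)" using nat[of "nat (- z)"] x by simp
      then show ?thesis using group_closure_minus_iff by blast
    qed
  qed
  moreover have "\<rho> = r" if "1 \<in> degs"
    using g(5)[OF that] g(1) by (simp add: \<rho>_def)
  moreover have "Ev C \<delta> \<subseteq> range (\<lambda>n. of_nat n * \<rho>)" using Ev_nat by blast
  moreover have "\<rho> \<noteq> 0" using r_nonzero g(1) by (simp add: \<rho>_def)
  ultimately show ?thesis by blast
qed

text \<open>The difference of two extensions is a derivation that kills the nonscalar element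
  \<open>c\<close>, whereas a nonzero derivation has only scalars in its kernel.\<close>

lemma unique_euler_extension:
  assumes c: "c \<in> C" "c \<noteq> 0" "\<delta> c = \<mu> *\<^sub>W c" "\<mu> \<noteq> 0"
  shows "unique_euler_extension C \<delta> \<mu> c"
proof -
  have dc: "d c > 0" using nonconst[OF c(1)] c by simp
  have "\<delta> (weyl_poly p c) = \<mu> *\<^sub>W (c * weyl_poly (pderiv p) c)" for p
    using c by (simp add: deriv_weyl_poly weyl_scale_mult_right mult_commute weyl_poly_closed)
  moreover have "\<delta>' a = \<delta> a"
    if \<delta>': "\<delta>' \<in> derivations C" "\<And>p. \<delta>' (weyl_poly p c) = \<mu> *\<^sub>W (c * weyl_poly (pderiv p) c)"
      and a: "a \<in> C" for \<delta>' a
  proof (rule ccontr)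
    assume "\<delta>' a \<noteq> \<delta> a"
    let ?D = "\<lambda>a. \<delta>' a - \<delta> a"
    have "?D \<in> derivations C"
      using \<delta>'(1) deriv unfolding derivations_def
      by (simp add: diff_closed weyl.scale_right_diff_distrib algebra_simps)
    \<comment> \<open>The assumed disagreement at \<open>a\<close> makes the difference a nonzero
      derivation, so its kernel is known.\<close>
    then interpret D: degree_derivation C d ?D
      using a \<open>\<delta>' a \<noteq> \<delta> a\<close> by unfold_locales auto
    have "\<delta>' c = \<mu> *\<^sub>W c"
      using \<delta>'(2)[of "[:0, 1:]"] by (simp add: weyl_poly_pCons weyl_const_1 pderiv_pCons)
    then have "?D c = 0" using c by simp
    then have "c \<in> ker_on C ?D" using c(1) by (simp add: ker_on_def)
    then have "c \<in> range weyl_const" by (simp only: D.ker_eq)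
    then show False using deg_pos_iff[OF c(1)] c(2) dc by blast
  qed
  ultimately show ?thesis
    unfolding unique_euler_extension_def Let_def
    using c transcendental[OF c(1,2) dc] deriv by blast
qed

lemma Ev_rescaled:
  assumes "\<mu> \<in> Ev C \<delta> - {0}" "c \<in> eigenspace C \<delta> \<mu> - {0}"
  shows "\<mu> / of_int (d c) = r" "unique_euler_extension C \<delta> \<mu> c" "c \<in> C" "c \<noteq> 0"
proof -
  have c: "c \<in> C" "c \<noteq> 0" "\<delta> c = \<mu> *\<^sub>W c" using assms by (auto simp: eigenspace_def ker_on_def)
  then have "\<mu> = r * of_int (d c)" by (rule deg_eigenvector)
  then show "\<mu> / of_int (d c) = r" using assms(1) by auto
  show "unique_euler_extension C \<delta> \<mu> c" using c assms(1) by (intro unique_euler_extension) auto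
qed (use assms in \<open>auto simp: eigenspace_def ker_on_def\<close>)

end

section \<open>The three cases of the semisimple structure\<close>

lemma case_supp_of_diagonal:
  assumes "diagonal_derivation C (weyl_sdeg 1) \<delta> r"
  shows "case_supp C \<delta>"
proof -
  interpret diagonal_derivation C "weyl_sdeg 1" \<delta> r by fact
  have supp: "supp C = degs"
    unfolding supp_def degs_def by (rule image_cong) (auto simp: weyl_deg_eq_sdeg)
  show ?thesis
    unfolding case_supp_def supp
    using Ev_rescaled Ev_eq r_nonzero by (auto simp: weyl_deg_eq_sdeg)
qed

text \<open>\<open>supp_minus\<close> consists of the negatives of the degrees, so the scalar
  changes sign to -r.\<close>

lemma case_supp_minus_of_diagonal:
  assumes "diagonal_derivation C (weyl_sdeg (-1)) \<delta> r"
  shows "case_supp_minus C \<delta>"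
proof -
  interpret diagonal_derivation C "weyl_sdeg (-1)" \<delta> r by fact
  have "supp_minus C = uminus ` degs"
    unfolding supp_minus_def degs_def image_image by (rule image_cong) (auto simp: weyl_deg_minus_eq_sdeg)
  then have Ev: "Ev C \<delta> = (\<lambda>n. - r * of_int n) ` supp_minus C"
    by (simp add: Ev_eq image_image)
  have "Ev C \<delta> = (\<lambda>n. - (\<mu> / of_int (weyl_deg_minus c)) * of_int n) ` supp_minus C"
    if "\<mu> \<in> Ev C \<delta> - {0}" "c \<in> eigenspace C \<delta> \<mu> - {0}" for \<mu> c
  proof -
    have "\<mu> / of_int (weyl_deg_minus c) = r"
      using Ev_rescaled(1)[OF that] Ev_rescaled(4)[OF that] by (simp add: weyl_deg_minus_eq_sdeg)
    then show ?thesis using Ev by simp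
  qed
  moreover have "\<exists>\<rho>'. \<rho>' \<noteq> 0 \<and> Ev C \<delta> = (\<lambda>n. \<rho>' * of_int n) ` supp_minus C"
    using Ev r_nonzero by (intro exI[of _ "- r"]) simp
  ultimately show ?thesis
    unfolding case_supp_minus_def using Ev_rescaled(2) by blast
qed

text \<open>H has degree 1, so all naturals are degrees, and \<delta> H - r H has degree at most 0
  and is a scalar k. This scalar is the reason for the shift of H in the conclusion.\<close>

lemma case_KH_of_diagonal:
  fixes C :: "'k::field_char_0 weyl set"
  assumes "diagonal_derivation C d \<delta> r"
    and d: "d = (\<lambda>a. int (degree (weyl_coeff a 0)))" and C: "C = weyl_adjoin weyl_H"
  shows "1 \<in> diagonal_derivation.degs C d" "case_KH C \<delta> r"
proof -
  interpret diagonal_derivation C d \<delta> r by fact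
  have H: "weyl_H = weyl_poly [:0, 1:] (weyl_H :: 'k weyl)"
    by (simp add: weyl_poly_pCons weyl_const_1)
  then have HC: "weyl_H \<in> C" unfolding C weyl_adjoin_def by blast
  have "weyl_coeff (weyl_H :: 'k weyl) 0 = [:1, 1:]"
    using weyl_coeff_sum_pieces[of "{0}" "\<lambda>_. [:0, 1 :: 'k:]" 0]
    by (simp add: weyl_v_def weyl_vpoly_def pcompose_pCons flip: H)
  then have dH: "d weyl_H = 1" and "(weyl_H :: 'k weyl) \<noteq> 0" by (auto simp: d)
  then show one: "1 \<in> degs" using HC unfolding degs_def by force
  have "\<delta> weyl_H - r *\<^sub>W weyl_H \<in> filt 0"
    using deriv_lead[OF HC \<open>weyl_H \<noteq> 0\<close>] dH by simp
  then have "\<delta> weyl_H - r *\<^sub>W weyl_H \<in> range weyl_const"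
    using filt_deg filt_closed deg_pos_iff by fastforce
  then obtain k where k: "\<delta> weyl_H = r *\<^sub>W weyl_H + weyl_const k"
    by (auto simp: diff_eq_eq add.commute)
  \<comment> \<open>The scalar k is absorbed by choosing the shift -k / r.\<close>
  have "r *\<^sub>W weyl_const (- k / r) = weyl_const (- k)"
    using r_nonzero by (simp add: weyl_scale_def flip: weyl_const_mult)
  moreover have "weyl_const (- k) + weyl_const k = (0 :: 'k weyl)" by (simp flip: weyl_const_add)
  ultimately have "\<delta> weyl_H = r *\<^sub>W (weyl_H - weyl_const (- k / r))"
    using k by (simp add: weyl.scale_right_diff_distrib eq_neg_iff_add_eq_0 add.commute)
  then have "\<delta> (weyl_poly p weyl_H) = r *\<^sub>W ((weyl_H - weyl_const (- k / r)) * weyl_poly (pderiv p) weyl_H)" for p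
    using HC by (simp add: deriv_weyl_poly weyl_scale_mult_right)
      (metis mult_commute diff_closed const_closed weyl_poly_closed)
  moreover have "Ev C \<delta> = range (\<lambda>n. r * of_nat n)"
  proof -
    have "degs = range int"
      using degs_nonneg degs_scale[OF one] by (auto intro: nonneg_int_cases)
    then show ?thesis by (simp add: Ev_eq image_image)
  qed
  ultimately show "case_KH C \<delta> r" unfolding case_KH_def by blast
qed

text \<open>For K[H] the degree function is pinned down, since the conclusion of that case is
  derived from the degree in H.\<close>

lemma degree_subalgebra_exists:
  fixes C :: "'k::field_char_0 weyl set"
  assumes "maximal_commutative_subalgebra C"
  obtains d where "degree_subalgebra C d"
    "C = weyl_adjoin weyl_H \<Longrightarrow> d = (\<lambda>a. int (degree (weyl_coeff a 0)))"
proof (cases "C = weyl_adjoin weyl_H")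
  case True
  then show ?thesis using that degree_subalgebra_weyl_H by blast
next
  case False
  have "commutative_subalgebra C" using assms by (simp add: maximal_commutative_subalgebra_def)
  then have "\<exists>s. degree_subalgebra C (weyl_sdeg s)"
    using False maximal_commutative_trichotomy[OF assms] degree_subalgebra_sdeg[of 1 C]
      degree_subalgebra_sdeg[of "-1" C] by auto
  then show ?thesis using that False by blast
qed

text \<open>The same eigenvector makes \<delta> diagonal for every admissible degree function
  (\<open>diag\<close>). Hence each support case can use the signed degree that its hypothesis makes
  available, even when both cases apply.\<close>

lemma semisimple_structure_of_eigenvector:
  fixes C :: "'k::field_char_0 weyl set"
  assumes max: "maximal_commutative_subalgebra C" and deriv: "\<delta> \<in> derivations C"
    and c: "c \<in> C" "c \<noteq> 0" "\<mu> \<noteq> 0" "\<delta> c = \<mu> *\<^sub>W c"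
  shows "semisimple_structure C \<delta>"
proof -
  have comm: "commutative_subalgebra C" using max by (simp add: maximal_commutative_subalgebra_def)
  have nontriv: "\<exists>c\<in>C. \<delta> c \<noteq> 0" using c by (intro bexI[of _ c]) simp_all
  have diag: "diagonal_derivation C d \<delta> (\<mu> / of_int (d c))" if "degree_subalgebra C d" for d
  proof -
    interpret degree_subalgebra C d by fact
    interpret degree_derivation C d \<delta> using deriv nontriv by unfold_locales
    show ?thesis using c by (rule diagonal_derivationI)
  qed
  obtain d where d: "degree_subalgebra C d"
    "C = weyl_adjoin weyl_H \<Longrightarrow> d = (\<lambda>a. int (degree (weyl_coeff a 0)))"
    using degree_subalgebra_exists[OF max] by blast
  define r where "r = \<mu> / of_int (d c)"
  interpret diagonal_derivation C d \<delta> r unfolding r_def by (rule diag[OF d(1)])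
  obtain \<rho> where \<rho>: "\<rho> \<noteq> 0" "Ev C \<delta> \<subseteq> range (\<lambda>n. of_nat n * \<rho>)"
    "group_closure (Ev C \<delta>) = range (\<lambda>z. of_int z * \<rho>)" "1 \<in> degs \<longrightarrow> \<rho> = r"
    using Ev_generator by blast
  have KH: "case_KH C \<delta> \<rho>" if "C = weyl_adjoin weyl_H"
    using case_KH_of_diagonal[OF diagonal_derivation_axioms d(2)[OF that] that] \<rho>(4) by simp
  have plus: "degree_subalgebra C (weyl_sdeg 1)" if "a \<in> C" "a \<noteq> 0" "weyl_sdeg 1 a > 0" for a
    using that comm by (intro degree_subalgebra_sdeg) auto
  have minus: "degree_subalgebra C (weyl_sdeg (-1))" if "a \<in> C" "a \<noteq> 0" "weyl_sdeg (-1) a > 0" for a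
    using that comm by (intro degree_subalgebra_sdeg) auto
  have supp: "case_supp C \<delta>" if hyp: "{0} \<subset> supp C \<and> supp C \<subseteq> {0..}"
  proof -
    obtain n where "n \<in> supp C" "n \<noteq> 0" using hyp by blast
    moreover from this have "n \<ge> 0" using hyp by auto
    ultimately have "n \<in> supp C" "n > 0" by simp_all
    then obtain a where a: "a \<in> C - {0}" "weyl_deg a > 0" unfolding supp_def by blast
    then have "a \<in> C" "a \<noteq> 0" "weyl_sdeg 1 a > 0" by (simp_all add: weyl_deg_eq_sdeg)
    then show ?thesis using diag[OF plus] case_supp_of_diagonal by blast
  qed
  have supp_minus: "case_supp_minus C \<delta>" if hyp: "{0} \<subset> supp_minus C \<and> supp_minus C \<subseteq> {..0}"
  proof -
    obtain n where "n \<in> supp_minus C" "n \<noteq> 0" using hyp by blast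
    moreover from this have "n \<le> 0" using hyp by auto
    ultimately have "n \<in> supp_minus C" "n < 0" by simp_all
    then obtain a where a: "a \<in> C - {0}" "- weyl_deg_minus a < 0" unfolding supp_minus_def by blast
    then have "a \<in> C" "a \<noteq> 0" "weyl_sdeg (-1) a > 0" by (simp_all add: weyl_deg_minus_eq_sdeg)
    then show ?thesis using diag[OF minus] case_supp_minus_of_diagonal by blast
  qed
  have some_case: "C = weyl_adjoin weyl_H \<or> ({0} \<subset> supp C \<and> supp C \<subseteq> {0..}) \<or>
      ({0} \<subset> supp_minus C \<and> supp_minus C \<subseteq> {..0})"
    using maximal_commutative_trichotomy[OF max]
  proof (elim disjE bexE conjE)
    fix a assume a: "a \<in> C" "a \<noteq> 0" "weyl_sdeg 1 a > 0"
    interpret D: degree_subalgebra C "weyl_sdeg 1" using plus[OF a] .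
    have supp: "supp C = weyl_sdeg 1 ` (C - {0})"
      unfolding supp_def by (rule image_cong) (auto simp: weyl_deg_eq_sdeg)
    have in_supp: "0 \<in> supp C" "weyl_sdeg 1 a \<in> supp C" "supp C \<subseteq> {0..}"
      unfolding supp using a D.one_closed D.deg_1 D.deg_nonneg by (force simp: image_iff)+
    have "supp C \<noteq> {0}" using in_supp(2) a(3) by auto
    then have "{0} \<subset> supp C" using in_supp(1) by blast
    then show ?thesis using in_supp(3) by blast
  next
    fix a assume a: "a \<in> C" "a \<noteq> 0" "weyl_sdeg (-1) a > 0"
    interpret D: degree_subalgebra C "weyl_sdeg (-1)" using minus[OF a] .
    have supp: "supp_minus C = (\<lambda>a. - weyl_sdeg (-1) a) ` (C - {0})"
      unfolding supp_minus_def by (rule image_cong) (auto simp: weyl_deg_minus_eq_sdeg)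
    have in_supp: "0 \<in> supp_minus C" "- weyl_sdeg (-1) a \<in> supp_minus C" "supp_minus C \<subseteq> {..0}"
      unfolding supp using a D.one_closed D.deg_1 D.deg_nonneg by (force simp: image_iff)+
    have "supp_minus C \<noteq> {0}" using in_supp(2) a(3) by auto
    then have "{0} \<subset> supp_minus C" using in_supp(1) by blast
    then show ?thesis using in_supp(3) by blast
  qed simp
  have dim: "\<forall>\<mu>\<in>Ev C \<delta>. weyl.dim (eigenspace C \<delta> \<mu>) = 1" using dim_eigenspace by blast
  show ?thesis
    unfolding semisimple_structure_def
    by (intro conjI exI[of _ \<rho>] direct_sum_eigenspaces dim Ev_monoid \<rho>(1-3) some_case
        impI[OF KH] impI[OF supp] impI[OF supp_minus]) simp_all
qed

section \<open>Back to an eigenvector, and the assembly\<close>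

context degree_derivation
begin

text \<open>In the decomposition of an element that \<delta> does not kill, some component has a
  nonzero eigenvalue.\<close>

lemma semisimple_imp_eigenvector:
  assumes "semisimple_on C \<delta>"
  shows "\<exists>c\<in>C. \<exists>\<mu>. c \<noteq> 0 \<and> \<mu> \<noteq> 0 \<and> \<delta> c = \<mu> *\<^sub>W c"
proof -
  obtain c where c: "c \<in> C" "\<delta> c \<noteq> 0" using nontrivial by blast
  obtain f where f: "\<forall>k\<in>Ev C \<delta>. f k \<in> eigenspace C \<delta> k" "\<forall>k. k \<notin> Ev C \<delta> \<longrightarrow> f k = 0"
    and sum: "c = (\<Sum>k | f k \<noteq> 0. f k)"
    using assms c(1) unfolding semisimple_on_def internal_direct_sum_def bij_betw_def by blast
  have fk: "f k \<in> C" "\<delta> (f k) = k *\<^sub>W f k" for k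
    using f by (cases "k \<in> Ev C \<delta>"; simp add: eigenspace_def ker_on_def zero_closed deriv_0)+
  have "\<delta> c = (\<Sum>k | f k \<noteq> 0. k *\<^sub>W f k)"
    unfolding sum using fk by (simp add: deriv_sum)
  then obtain k where "k *\<^sub>W f k \<noteq> 0"
    using c(2) by (metis (no_types, lifting) sum.neutral)
  then show ?thesis using fk[of k] by auto
qed

text \<open>The preimage of t^i with 0 \<noteq> i \<in> E is an eigenvector with eigenvalue \<rho>
  i, which is nonzero in characteristic zero.\<close>

lemma monoid_algebra_imp_eigenvector:
  assumes "monoid_algebra_normal_form C \<delta>"
  shows "\<exists>c\<in>C. \<exists>\<mu>. c \<noteq> 0 \<and> \<mu> \<noteq> 0 \<and> \<delta> c = \<mu> *\<^sub>W c"
proof -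
  obtain E \<phi> \<rho> where E: "additive_submonoid E" "E \<noteq> {0}"
    and iso: "alg_iso_to_poly C (monoid_subalgebra E) \<phi>" and \<rho>: "\<rho> \<noteq> 0"
    and \<delta>: "\<And>a. a \<in> C \<Longrightarrow> \<phi> (\<delta> a) = smult \<rho> (monom 1 1 * pderiv (\<phi> a))"
    using assms unfolding monoid_algebra_normal_form_def by blast
  obtain i where i: "i \<in> E" "i \<noteq> 0" using E by (auto simp: additive_submonoid_def)
  have inj: "inj_on \<phi> C" and im: "\<phi> ` C = monoid_subalgebra E"
    and scale: "\<And>k a. a \<in> C \<Longrightarrow> \<phi> (k *\<^sub>W a) = smult k (\<phi> a)"
    using iso by (auto simp: alg_iso_to_poly_def bij_betw_def)
  have "monom 1 i \<in> monoid_subalgebra E" using i by (auto simp: monoid_subalgebra_def)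
  then obtain a where a: "a \<in> C" "\<phi> a = monom 1 i" using im by (metis imageE)
  have "\<phi> (\<delta> a) = \<phi> ((\<rho> * of_nat i) *\<^sub>W a)"
    using a i by (simp add: \<delta> scale pderiv_monom mult_monom smult_monom)
  then have "\<delta> a = (\<rho> * of_nat i) *\<^sub>W a"
    using inj a by (meson deriv_closed scale_closed inj_onD)
  moreover have "a \<noteq> 0" using scale[of a 0] a by auto
  ultimately show ?thesis using a \<rho> i by (intro bexI[of _ a] exI[of _ "\<rho> * of_nat i"]) auto
qed

end

theorem theorem1p4:
  fixes C :: "'k::field_char_0 weyl set" and \<delta> :: "'k weyl \<Rightarrow> 'k weyl"
  assumes "maximal_commutative_subalgebra C"
    and "\<delta> \<in> derivations C"
    and "\<exists>c\<in>C. \<delta> c \<noteq> 0"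
  shows
    "(locally_nilpotent_on C \<delta> \<longleftrightarrow>
        (\<exists>c\<in>C - ker_on C \<delta>. \<exists>n\<ge>2. (\<delta> ^^ n) c = 0)) \<and>
     (locally_nilpotent_on C \<delta> \<longleftrightarrow> lnd_normal_form C \<delta>) \<and>
     (semisimple_on C \<delta> \<longleftrightarrow>
        (\<exists>c\<in>C. \<exists>\<mu>. c \<noteq> 0 \<and> \<mu> \<noteq> 0 \<and> \<delta> c = \<mu> *\<^sub>W c)) \<and>
     (semisimple_on C \<delta> \<longleftrightarrow> semisimple_structure C \<delta>) \<and>
     (semisimple_on C \<delta> \<longleftrightarrow> monoid_algebra_normal_form C \<delta>) \<and>
     ker_on C \<delta> = range weyl_const"
proof -
  obtain d where "degree_subalgebra C d" using degree_subalgebra_exists[OF assms(1)] by blast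
  then interpret degree_subalgebra C d .
  interpret degree_derivation C d \<delta> using assms by unfold_locales
  \<comment> \<open>Condition (b) of the second part is the hub: it implies (a), (c) and (d), while
    (a) and (d) each return an eigenvector and (c) contains (a).\<close>
  have eigenvector: "semisimple_on C \<delta> \<and> semisimple_structure C \<delta> \<and> monoid_algebra_normal_form C \<delta>"
    if c: "c \<in> C" "c \<noteq> 0" "\<mu> \<noteq> 0" "\<delta> c = \<mu> *\<^sub>W c" for c \<mu>
  proof -
    interpret diagonal_derivation C d \<delta> "\<mu> / of_int (d c)" using c by (rule diagonal_derivationI)
    show ?thesis
      using semisimple monoid_algebra_normal_form
        semisimple_structure_of_eigenvector[OF assms(1,2) c] by blast
  qed
  have "semisimple_on C \<delta>" if "semisimple_structure C \<delta>"
    using that by (simp add: semisimple_structure_def semisimple_on_def)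
  then show ?thesis
    using locally_nilpotent_iff_element locally_nilpotent_iff_normal_form ker_eq
      eigenvector semisimple_imp_eigenvector monoid_algebra_imp_eigenvector by blast
qed

end
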